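(* Let $\alpha\in(0,1/2)$ be irrational and let $\mu$ be a probability measure on $\mathbb T$ such that $\mu_{-n}\sim\mu_n$, with Radon–Nikodym derivative $\frac{\mathrm d\mu_{-n}}{\mathrm d\mu_n}=h_n$, for every $n\in\mathbb Z$. Then, for the Tomita modular operator $\Delta$ and conjugation $J$ of the state $\omega_\mu$ on $\mathbb A_{2\alpha}$, in the GNS representation on $\mathcal H_{\omega_\mu}=\bigoplus_{n\in\mathbb Z}L^2(\mathbb T,\mu_n)$ described in the context, $$\mathcal D_\Delta=\Big\{x\in\mathcal H_{\omega_\mu}\ \Big|\ \sum_{n\in\mathbb Z}\int_{\mathbb T}|h_n(z)x_n(z)|^2\,\mathrm d\mu_n(z)<+\infty\Big\},$$ and $$(\Delta x)_n(z)=h_n(z)x_n(z),\qquad (Jx)_n(z)=h_n^{1/2}(z)\overline{x_{-n}(z)}.$$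
   Context: $\mathbb T$ is the unit circle, $R(z)=e^{2\pi\imath\alpha}z$, $\mu_n:=\mu\circ R^{-n}$, i.e. $\mu_n(E)=\mu(R^{-n}E)$; $\sim$ is equivalence of measures. $\mathbb A_{2\alpha}$ is the universal unital $C^*$-algebra generated by unitaries $U,V$ with $UV=e^{4\pi\imath\alpha}VU$. $W(k,n):=e^{-2\pi\imath\alpha kn}U^kV^n$, and $W(f):=\sum f(k,n)W(k,n)$ for finitely supported $f:\mathbb Z^2\to\mathbb C$; put $\check{f^{(n)}}(z)=\sum_kf(k,n)z^k$. The state $\omega_\mu$ is determined by $\omega_\mu(W(f))=\sum_{k}\left(\int_{\mathbb T}z^k\mathrm d\mu\right)f(k,0)$. The GNS representation of $\omega_\mu$ is realised by $\mathcal H_{\omega_\mu}=\bigoplus_{n\in\mathbb Z}L^2(\mathbb T,\mu_n)$, $(\pi_{\omega_\mu}(W(f))g)_n(z)=\sum_{l\in\mathbb Z}\check{f^{(l)}}(R^{n-l}z)\,g_{n-l}(R^{-l}z)$, $(\xi_{\omega_\mu})_n(z)=\delta_{n,0}$; thus $\pi_{\omega_\mu}(W(f))\xi_{\omega_\mu}=\bigoplus_n\check{f^{(n)}}$. Under the hypothesis, the support of $\omega_\mu$ in the bidual is central, so the map $\pi_{\omega_\mu}(a)\xi_{\omega_\mu}\mapsto\pi_{\omega_\mu}(a^* )\xi_{\omega_\mu}$ is well defined and closable; its closure $S$ has polar decomposition $S=J\Delta^{1/2}$. $\mathcal D_\Delta$ is the domain of $\Delta$. *)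

theory Defs
  imports "HOL-Probability.Probability" "HOL-Algebra.Module" "HOL-Algebra.Subrings"
begin

section \<open>Unital C*-algebras\<close>

definition complex_ring :: "complex ring" where
  "complex_ring = \<lparr>carrier = UNIV, monoid.mult = (*), one = 1, zero = 0, add = (+)\<rparr>"

record 'a cstar = "(complex, 'a) module" +
  star :: "'a \<Rightarrow> 'a"
  cnorm :: "'a \<Rightarrow> real"

text \<open>The value outside the carrier only serves to make this a total function satisfying the
  axioms of \<^locale>\<open>Metric_space\<close>, which constrain the distance on the whole type.\<close>

definition cstar_dist :: "'a cstar \<Rightarrow> 'a \<Rightarrow> 'a \<Rightarrow> real" where
  "cstar_dist A a b =
     (if a \<in> carrier A \<and> b \<in> carrier A then cnorm A (a \<ominus>\<^bsub>A\<^esub> b) else 0)"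

locale unital_cstar_algebra =
  fixes A :: "'a cstar" (structure)
  assumes is_ring: "ring A"
    and is_module: "Module.module complex_ring A"
    and one_not_zero: "\<one> \<noteq> \<zero>"
    and smult_mult_left:
      "\<And>c a b. a \<in> carrier A \<Longrightarrow> b \<in> carrier A \<Longrightarrow> (c \<odot> a) \<otimes> b = c \<odot> (a \<otimes> b)"
    and smult_mult_right:
      "\<And>c a b. a \<in> carrier A \<Longrightarrow> b \<in> carrier A \<Longrightarrow> a \<otimes> (c \<odot> b) = c \<odot> (a \<otimes> b)"
    and star_closed: "\<And>a. a \<in> carrier A \<Longrightarrow> star A a \<in> carrier A"
    and star_star: "\<And>a. a \<in> carrier A \<Longrightarrow> star A (star A a) = a"
    and star_add: "\<And>a b. a \<in> carrier A \<Longrightarrow> b \<in> carrier A \<Longrightarrow>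
      star A (a \<oplus> b) = star A a \<oplus> star A b"
    and star_smult: "\<And>c a. a \<in> carrier A \<Longrightarrow> star A (c \<odot> a) = cnj c \<odot> star A a"
    and star_mult: "\<And>a b. a \<in> carrier A \<Longrightarrow> b \<in> carrier A \<Longrightarrow>
      star A (a \<otimes> b) = star A b \<otimes> star A a"
    and cnorm_nonneg: "\<And>a. a \<in> carrier A \<Longrightarrow> 0 \<le> cnorm A a"
    and cnorm_eq_0: "\<And>a. a \<in> carrier A \<Longrightarrow> cnorm A a = 0 \<longleftrightarrow> a = \<zero>"
    and cnorm_triangle: "\<And>a b. a \<in> carrier A \<Longrightarrow> b \<in> carrier A \<Longrightarrow>
      cnorm A (a \<oplus> b) \<le> cnorm A a + cnorm A b"
    and cnorm_smult: "\<And>c a. a \<in> carrier A \<Longrightarrow> cnorm A (c \<odot> a) = cmod c * cnorm A a"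
    and cnorm_mult: "\<And>a b. a \<in> carrier A \<Longrightarrow> b \<in> carrier A \<Longrightarrow>
      cnorm A (a \<otimes> b) \<le> cnorm A a * cnorm A b"
    and cstar_identity: "\<And>a. a \<in> carrier A \<Longrightarrow> cnorm A (star A a \<otimes> a) = (cnorm A a)\<^sup>2"
    and complete: "Metric_space.mcomplete (carrier A) (cstar_dist A)"

definition cstar_unitary :: "'a cstar \<Rightarrow> 'a \<Rightarrow> bool" where
  "cstar_unitary A u \<longleftrightarrow> u \<in> carrier A \<and>
     star A u \<otimes>\<^bsub>A\<^esub> u = \<one>\<^bsub>A\<^esub> \<and> u \<otimes>\<^bsub>A\<^esub> star A u = \<one>\<^bsub>A\<^esub>"

definition unital_star_hom :: "'a cstar \<Rightarrow> 'b cstar \<Rightarrow> ('a \<Rightarrow> 'b) \<Rightarrow> bool" where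
  "unital_star_hom A B \<phi> \<longleftrightarrow> \<phi> \<in> ring_hom A B \<and>
     (\<forall>c. \<forall>a\<in>carrier A. \<phi> (c \<odot>\<^bsub>A\<^esub> a) = c \<odot>\<^bsub>B\<^esub> \<phi> a) \<and>
     (\<forall>a\<in>carrier A. \<phi> (star A a) = star B (\<phi> a))"

definition unital_cstar_subalgebra :: "'a set \<Rightarrow> 'a cstar \<Rightarrow> bool" where
  "unital_cstar_subalgebra B A \<longleftrightarrow> subring B A \<and>
     (\<forall>c. \<forall>b\<in>B. c \<odot>\<^bsub>A\<^esub> b \<in> B) \<and> (\<forall>b\<in>B. star A b \<in> B) \<and>
     closedin (Metric_space.mtopology (carrier A) (cstar_dist A)) B"

definition rotation_pair :: "real \<Rightarrow> 'a cstar \<Rightarrow> 'a \<Rightarrow> 'a \<Rightarrow> bool" where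
  "rotation_pair \<theta> A U V \<longleftrightarrow> cstar_unitary A U \<and> cstar_unitary A V \<and>
     U \<otimes>\<^bsub>A\<^esub> V = cis (2 * pi * \<theta>) \<odot>\<^bsub>A\<^esub> (V \<otimes>\<^bsub>A\<^esub> U)"

text \<open>\<open>(A, U, V)\<close> is the universal unital C*-algebra generated by unitaries \<open>U\<close>, \<open>V\<close> with
  \<open>UV = e\<^bsup>2\<pi>i\<theta>\<^esup>VU\<close>.  Uniqueness of \<open>\<phi>\<close> is implied by generation.
  Letting \<open>B\<close> range over the C*-algebras with elements in the same type \<open>'a\<close> is no restriction:
  only the C*-subalgebra of \<open>B\<close> generated by \<open>u\<close>, \<open>v\<close> matters, it has at most the cardinality
  of the continuum, and \<open>'a\<close> contains the scalar multiples of the unit of \<open>A\<close>, so an isomorphic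
  copy of that subalgebra lives in \<open>'a\<close>.\<close>

definition universal_rotation_algebra :: "real \<Rightarrow> 'a cstar \<Rightarrow> 'a \<Rightarrow> 'a \<Rightarrow> bool" where
  "universal_rotation_algebra \<theta> A U V \<longleftrightarrow>
     unital_cstar_algebra A \<and> rotation_pair \<theta> A U V \<and>
     (\<forall>B. unital_cstar_subalgebra B A \<longrightarrow> U \<in> B \<longrightarrow> V \<in> B \<longrightarrow> B = carrier A) \<and>
     (\<forall>(B :: 'a cstar) u v. unital_cstar_algebra B \<longrightarrow> rotation_pair \<theta> B u v \<longrightarrow>
        (\<exists>\<phi>. unital_star_hom A B \<phi> \<and> \<phi> U = u \<and> \<phi> V = v))"

text \<open>States are the positive linear functionals of norm one; for a functional with
  \<open>\<omega>(1) = 1\<close> the latter means \<open>\<bar>\<omega>(a)\<bar> \<le> \<parallel>a\<parallel>\<close>.\<close>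

definition cstar_state :: "'a cstar \<Rightarrow> ('a \<Rightarrow> complex) \<Rightarrow> bool" where
  "cstar_state A \<omega> \<longleftrightarrow>
     (\<forall>a\<in>carrier A. \<forall>b\<in>carrier A. \<omega> (a \<oplus>\<^bsub>A\<^esub> b) = \<omega> a + \<omega> b) \<and>
     (\<forall>c. \<forall>a\<in>carrier A. \<omega> (c \<odot>\<^bsub>A\<^esub> a) = c * \<omega> a) \<and>
     (\<forall>a\<in>carrier A. \<omega> (star A a \<otimes>\<^bsub>A\<^esub> a) \<in> \<real>\<^sub>\<ge>\<^sub>0) \<and>
     (\<forall>a\<in>carrier A. cmod (\<omega> a) \<le> cnorm A a) \<and>
     \<omega> \<one>\<^bsub>A\<^esub> = 1"

section \<open>Hilbert spaces and unbounded operators\<close>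

text \<open>As for modules in HOL-Algebra, the fields \<^const>\<open>monoid.mult\<close> and \<^const>\<open>one\<close> are
  not used.  Inner products are conjugate-linear in the first argument.\<close>

record 'v hilbert = "(complex, 'v) module" +
  ip :: "'v \<Rightarrow> 'v \<Rightarrow> complex"

definition hnorm :: "'v hilbert \<Rightarrow> 'v \<Rightarrow> real" where
  "hnorm H x = sqrt (Re (ip H x x))"

definition hdense :: "'v hilbert \<Rightarrow> 'v set \<Rightarrow> bool" where
  "hdense H D \<longleftrightarrow> D \<subseteq> carrier H \<and>
     (\<forall>x\<in>carrier H. \<forall>e>0. \<exists>y\<in>D. hnorm H (x \<ominus>\<^bsub>H\<^esub> y) < e)"

text \<open>Operators are identified with their graphs.  In \<open>semilinear_op H \<sigma> T\<close>, taking \<open>\<sigma> = id\<close>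
  gives linear and \<open>\<sigma> = cnj\<close> conjugate-linear operators, defined on the subspace
  \<open>Domain T\<close>.\<close>

definition semilinear_op :: "'v hilbert \<Rightarrow> (complex \<Rightarrow> complex) \<Rightarrow> ('v \<times> 'v) set \<Rightarrow> bool" where
  "semilinear_op H \<sigma> T \<longleftrightarrow> T \<subseteq> carrier H \<times> carrier H \<and> single_valued T \<and>
     (\<zero>\<^bsub>H\<^esub>, \<zero>\<^bsub>H\<^esub>) \<in> T \<and>
     (\<forall>(x, y)\<in>T. \<forall>(x', y')\<in>T. (x \<oplus>\<^bsub>H\<^esub> x', y \<oplus>\<^bsub>H\<^esub> y') \<in> T) \<and>
     (\<forall>c. \<forall>(x, y)\<in>T. (c \<odot>\<^bsub>H\<^esub> x, \<sigma> c \<odot>\<^bsub>H\<^esub> y) \<in> T)"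

definition graph_closure :: "'v hilbert \<Rightarrow> ('v \<times> 'v) set \<Rightarrow> ('v \<times> 'v) set" where
  "graph_closure H T = {(x, y). x \<in> carrier H \<and> y \<in> carrier H \<and>
     (\<forall>e>0. \<exists>(a, b)\<in>T. hnorm H (x \<ominus>\<^bsub>H\<^esub> a) < e \<and> hnorm H (y \<ominus>\<^bsub>H\<^esub> b) < e)}"

definition op_kernel :: "'v hilbert \<Rightarrow> ('v \<times> 'v) set \<Rightarrow> 'v set" where
  "op_kernel H T = {x. (x, \<zero>\<^bsub>H\<^esub>) \<in> T}"

definition op_adjoint :: "'v hilbert \<Rightarrow> ('v \<times> 'v) set \<Rightarrow> ('v \<times> 'v) set" where
  "op_adjoint H T = {(y, w). y \<in> carrier H \<and> w \<in> carrier H \<and>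
     (\<forall>(x, z)\<in>T. ip H y z = ip H w x)}"

definition positive_self_adjoint :: "'v hilbert \<Rightarrow> ('v \<times> 'v) set \<Rightarrow> bool" where
  "positive_self_adjoint H T \<longleftrightarrow> semilinear_op H id T \<and> hdense H (Domain T) \<and>
     op_adjoint H T = T \<and> (\<forall>(x, y)\<in>T. ip H x y \<in> \<real>\<^sub>\<ge>\<^sub>0)"

definition antilinear_partial_isometry :: "'v hilbert \<Rightarrow> ('v \<times> 'v) set \<Rightarrow> bool" where
  "antilinear_partial_isometry H J \<longleftrightarrow> semilinear_op H cnj J \<and> Domain J = carrier H \<and>
     (\<forall>(x, y)\<in>J. (\<forall>k\<in>op_kernel H J. ip H k x = 0) \<longrightarrow> hnorm H y = hnorm H x)"

text \<open>\<open>S = J T\<close> is the polar decomposition of the conjugate-linear operator \<open>S\<close>.  Relational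
  composition reads from left to right, so \<open>T O J\<close> is the operator applying \<open>T\<close> first, with
  its natural domain.\<close>

definition antilinear_polar_decomposition ::
  "'v hilbert \<Rightarrow> ('v \<times> 'v) set \<Rightarrow> ('v \<times> 'v) set \<Rightarrow> ('v \<times> 'v) set \<Rightarrow> bool" where
  "antilinear_polar_decomposition H S J T \<longleftrightarrow>
     positive_self_adjoint H T \<and> antilinear_partial_isometry H J \<and>
     op_kernel H J = op_kernel H T \<and> S = T O J"

section \<open>GNS representations and Tomita's modular objects\<close>

definition bounded_op :: "'v hilbert \<Rightarrow> ('v \<Rightarrow> 'v) \<Rightarrow> bool" where
  "bounded_op H T \<longleftrightarrow> T \<in> carrier H \<rightarrow> carrier H \<and>
     (\<forall>x\<in>carrier H. \<forall>y\<in>carrier H. T (x \<oplus>\<^bsub>H\<^esub> y) = T x \<oplus>\<^bsub>H\<^esub> T y) \<and>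
     (\<forall>c. \<forall>x\<in>carrier H. T (c \<odot>\<^bsub>H\<^esub> x) = c \<odot>\<^bsub>H\<^esub> T x) \<and>
     (\<exists>C. \<forall>x\<in>carrier H. hnorm H (T x) \<le> C * hnorm H x)"

definition star_representation ::
  "'a cstar \<Rightarrow> 'v hilbert \<Rightarrow> ('a \<Rightarrow> 'v \<Rightarrow> 'v) \<Rightarrow> bool" where
  "star_representation A H \<pi> \<longleftrightarrow>
     (\<forall>a\<in>carrier A. bounded_op H (\<pi> a)) \<and>
     (\<forall>a\<in>carrier A. \<forall>b\<in>carrier A. \<forall>x\<in>carrier H.
        \<pi> (a \<oplus>\<^bsub>A\<^esub> b) x = \<pi> a x \<oplus>\<^bsub>H\<^esub> \<pi> b x \<and> \<pi> (a \<otimes>\<^bsub>A\<^esub> b) x = \<pi> a (\<pi> b x)) \<and>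
     (\<forall>c. \<forall>a\<in>carrier A. \<forall>x\<in>carrier H. \<pi> (c \<odot>\<^bsub>A\<^esub> a) x = c \<odot>\<^bsub>H\<^esub> \<pi> a x) \<and>
     (\<forall>x\<in>carrier H. \<pi> \<one>\<^bsub>A\<^esub> x = x) \<and>
     (\<forall>a\<in>carrier A. \<forall>x\<in>carrier H. \<forall>y\<in>carrier H. ip H (\<pi> a x) y = ip H x (\<pi> (star A a) y))"

definition gns_representation ::
  "'a cstar \<Rightarrow> ('a \<Rightarrow> complex) \<Rightarrow> 'v hilbert \<Rightarrow> ('a \<Rightarrow> 'v \<Rightarrow> 'v) \<Rightarrow> 'v \<Rightarrow> bool" where
  "gns_representation A \<omega> H \<pi> \<xi> \<longleftrightarrow> star_representation A H \<pi> \<and> \<xi> \<in> carrier H \<and>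
     hdense H {\<pi> a \<xi> | a. a \<in> carrier A} \<and>
     (\<forall>a\<in>carrier A. \<omega> a = ip H \<xi> (\<pi> a \<xi>))"

definition tomita_operator ::
  "'a cstar \<Rightarrow> 'v hilbert \<Rightarrow> ('a \<Rightarrow> 'v \<Rightarrow> 'v) \<Rightarrow> 'v \<Rightarrow> ('v \<times> 'v) set" where
  "tomita_operator A H \<pi> \<xi> = graph_closure H {(\<pi> a \<xi>, \<pi> (star A a) \<xi>) | a. a \<in> carrier A}"

text \<open>In the polar decomposition \<open>S = J \<Delta>\<^bsup>1/2\<^esup>\<close> the positive factor \<open>T\<close> is \<open>\<Delta>\<^bsup>1/2\<^esup>\<close>, i.e.
  \<open>\<Delta> = T\<^sup>2\<close>.\<close>

definition modular_operator ::
  "'a cstar \<Rightarrow> 'v hilbert \<Rightarrow> ('a \<Rightarrow> 'v \<Rightarrow> 'v) \<Rightarrow> 'v \<Rightarrow> ('v \<times> 'v) set" where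
  "modular_operator A H \<pi> \<xi> =
     (THE \<Delta>. \<exists>J T. antilinear_polar_decomposition H (tomita_operator A H \<pi> \<xi>) J T \<and> \<Delta> = T O T)"

definition modular_conjugation ::
  "'a cstar \<Rightarrow> 'v hilbert \<Rightarrow> ('a \<Rightarrow> 'v \<Rightarrow> 'v) \<Rightarrow> 'v \<Rightarrow> ('v \<times> 'v) set" where
  "modular_conjugation A H \<pi> \<xi> =
     (THE J. \<exists>T. antilinear_polar_decomposition H (tomita_operator A H \<pi> \<xi>) J T)"

section \<open>\<open>L\<^sup>2\<close> spaces and Hilbert direct sums\<close>

definition sq_integrable :: "'t measure \<Rightarrow> ('t \<Rightarrow> complex) set" where
  "sq_integrable M = {f \<in> borel_measurable M. integrable M (\<lambda>z. (cmod (f z))\<^sup>2)}"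

definition L2_class :: "'t measure \<Rightarrow> ('t \<Rightarrow> complex) \<Rightarrow> ('t \<Rightarrow> complex) set" where
  "L2_class M f = {g \<in> sq_integrable M. AE z in M. g z = f z}"

definition rep :: "('t \<Rightarrow> complex) set \<Rightarrow> 't \<Rightarrow> complex" where
  "rep X = (SOME f. f \<in> X)"

definition L2 :: "'t measure \<Rightarrow> ('t \<Rightarrow> complex) set hilbert" where
  "L2 M = \<lparr>carrier = L2_class M ` sq_integrable M,
     monoid.mult = undefined, one = undefined,
     zero = L2_class M (\<lambda>z. 0),
     add = (\<lambda>X Y. L2_class M (\<lambda>z. rep X z + rep Y z)),
     smult = (\<lambda>c X. L2_class M (\<lambda>z. c * rep X z)),
     ip = (\<lambda>X Y. \<integral>z. cnj (rep X z) * rep Y z \<partial>M)\<rparr>"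

definition hilbert_sum :: "('i \<Rightarrow> 'v hilbert) \<Rightarrow> ('i \<Rightarrow> 'v) hilbert" where
  "hilbert_sum H = \<lparr>carrier =
       {x. (\<forall>i. x i \<in> carrier (H i)) \<and> (\<lambda>i. (hnorm (H i) (x i))\<^sup>2) summable_on UNIV},
     monoid.mult = undefined, one = undefined,
     zero = (\<lambda>i. \<zero>\<^bsub>H i\<^esub>),
     add = (\<lambda>x y i. x i \<oplus>\<^bsub>H i\<^esub> y i),
     smult = (\<lambda>c x i. c \<odot>\<^bsub>H i\<^esub> x i),
     ip = (\<lambda>x y. \<Sum>\<^sub>\<infinity>i. ip (H i) (x i) (y i))\<rparr>"

section \<open>The rotated measures and the Weyl elements\<close>

definition circle_space :: "complex measure" where
  "circle_space = restrict_space borel (sphere 0 1)"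

text \<open>\<open>rot \<alpha> n\<close> is \<open>R\<^sup>n\<close> for \<open>R(z) = e\<^bsup>2\<pi>i\<alpha>\<^esup>z\<close>.\<close>

definition rot :: "real \<Rightarrow> int \<Rightarrow> complex \<Rightarrow> complex" where
  "rot \<alpha> n z = cis (2 * pi * \<alpha>) powi n * z"

text \<open>\<open>\<mu>\<^sub>n(E) = \<mu>(R\<^bsup>-n\<^esup>E)\<close>: the set \<open>R\<^bsup>-n\<^esup>E\<close> is the preimage of \<open>E\<close> under \<open>R\<^sup>n\<close>.\<close>

definition rot_measure :: "real \<Rightarrow> complex measure \<Rightarrow> int \<Rightarrow> complex measure" where
  "rot_measure \<alpha> \<mu> n = distr \<mu> circle_space (rot \<alpha> n)"

definition equivalent_measures :: "'t measure \<Rightarrow> 't measure \<Rightarrow> bool" where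
  "equivalent_measures M N \<longleftrightarrow> absolutely_continuous M N \<and> absolutely_continuous N M"

definition weyl :: "real \<Rightarrow> 'a cstar \<Rightarrow> 'a \<Rightarrow> 'a \<Rightarrow> int \<Rightarrow> int \<Rightarrow> 'a" where
  "weyl \<alpha> A U V k n = cis (- 2 * pi * \<alpha> * of_int k * of_int n) \<odot>\<^bsub>A\<^esub>
     (U [^]\<^bsub>A\<^esub> k \<otimes>\<^bsub>A\<^esub> V [^]\<^bsub>A\<^esub> n)"

definition weyl_sum :: "real \<Rightarrow> 'a cstar \<Rightarrow> 'a \<Rightarrow> 'a \<Rightarrow> (int \<times> int \<Rightarrow> complex) \<Rightarrow> 'a" where
  "weyl_sum \<alpha> A U V f =
     (\<Oplus>\<^bsub>A\<^esub>p\<in>{p. f p \<noteq> 0}. f p \<odot>\<^bsub>A\<^esub> weyl \<alpha> A U V (fst p) (snd p))"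

definition check_poly :: "(int \<times> int \<Rightarrow> complex) \<Rightarrow> int \<Rightarrow> complex \<Rightarrow> complex" where
  "check_poly f n z = (\<Sum>k | f (k, n) \<noteq> 0. f (k, n) * z powi k)"

definition gns_space :: "real \<Rightarrow> complex measure \<Rightarrow> (int \<Rightarrow> (complex \<Rightarrow> complex) set) hilbert" where
  "gns_space \<alpha> \<mu> = hilbert_sum (\<lambda>n. L2 (rot_measure \<alpha> \<mu> n))"

definition gns_vector :: "real \<Rightarrow> complex measure \<Rightarrow> int \<Rightarrow> (complex \<Rightarrow> complex) set" where
  "gns_vector \<alpha> \<mu> n = L2_class (rot_measure \<alpha> \<mu> n) (\<lambda>z. if n = 0 then 1 else 0)"

text \<open>\<open>(\<pi>(W(f))g)\<^sub>n\<close>; all terms with \<open>l\<close> outside the finite summation range vanish.\<close>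

definition gns_action :: "real \<Rightarrow> complex measure \<Rightarrow> (int \<times> int \<Rightarrow> complex) \<Rightarrow>
    (int \<Rightarrow> (complex \<Rightarrow> complex) set) \<Rightarrow> int \<Rightarrow> (complex \<Rightarrow> complex) set" where
  "gns_action \<alpha> \<mu> f g n = L2_class (rot_measure \<alpha> \<mu> n)
     (\<lambda>z. \<Sum>l | \<exists>k. f (k, l) \<noteq> 0.
        check_poly f l (rot \<alpha> (n - l) z) * rep (g (n - l)) (rot \<alpha> (- l) z))"

end

(* The Weyl elements act on the GNS vector as trigonometric polynomials, so the Tomita operator S is
   the closure of (p_n) |-> (conj p_{-n}) on finite families of trigonometric polynomials.  These are
   dense in the direct sum of the spaces L^2(mu_n + mu_{-n}), whose norm is the graph norm of the
   closed operator (x_n) |-> (conj x_{-n}) on its maximal domain, so S is that operator.  Since h_n h_{-n} = 1,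
   it factors as the multiplication by the square roots of h_n followed by the isometry J of the
   theorem.  The work left is the uniqueness of the polar decomposition, obtained without a spectral
   theorem: a second positive factor T has the same square as the multiplication operator, hence
   commutes with the resolvent of that square and, by Weierstrass approximation, with its continuous
   functions, which is enough to compare T with the multiplication operator directly. *)

theory Submission
  imports Defs
begin

section \<open>Inner product spaces and self-adjoint operators\<close>

text \<open>The modular objects are definite descriptions, so exhibiting one polar decomposition is
  not enough: every competing pair J, T has to be identified. Injectivity of S makes J isometric
  everywhere, so T x has the norm of S x on the common domain; polarization and self-adjointness
  recover T^2 from these norms alone. The comparison of T with the multiplier s uses s / (1 + s^2),
  which is the square root of r (1 - r) for the resolvent symbol r = 1 / (1 + s^2): a bounded
  continuous function of r that still contains s. The passage from the algebra to its vectors rests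
  on the bound of the norm of \<pi>(a) \<xi> by the norm of a and on the density of the span of the
  Weyl elements, which generation by U and V provides. Vectors are families of equivalence classes,
  so computations use representing functions, and almost everywhere equalities are settled at the
  interface. For the same reason h_n, positive only almost everywhere, is replaced by a version that
  is positive at every point.\<close>

lemma carrier_complex_ring [simp]: "carrier complex_ring = UNIV"
  and complex_ring_ops [simp]:
    "a \<otimes>\<^bsub>complex_ring\<^esub> b = a * b" "\<one>\<^bsub>complex_ring\<^esub> = 1"
    "a \<oplus>\<^bsub>complex_ring\<^esub> b = a + b" "\<zero>\<^bsub>complex_ring\<^esub> = 0"
  by (simp_all add: complex_ring_def)

lemma cring_complex_ring: "cring complex_ring"
proof (rule cringI)
  show "abelian_group complex_ring"
    by (rule abelian_groupI) (auto simp: ac_simps intro: exI[of _ "- x" for x])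
  show "Group.comm_monoid complex_ring"
    by unfold_locales auto
qed (auto simp: algebra_simps)

lemma a_inv_complex_ring [simp]: "\<ominus>\<^bsub>complex_ring\<^esub> a = - a"
proof -
  interpret cring complex_ring by (rule cring_complex_ring)
  show ?thesis by (rule minus_equality) auto
qed

text \<open>The record extension is left open so that C*-algebras and Hilbert spaces are both
  instances.\<close>

locale complex_module = Module.module complex_ring V for V :: "(complex, 'v, 'r) module_scheme" (structure)
begin

lemma smult_1 [simp]: "x \<in> carrier V \<Longrightarrow> 1 \<odot> x = x"
  using smult_one[of x] by simp

lemma a_inv_eq_smult: "x \<in> carrier V \<Longrightarrow> \<ominus> x = (- 1) \<odot> x"
  using smult_l_minus[of 1 x] by simp

lemma diff_eq_smult: "\<lbrakk>x \<in> carrier V; y \<in> carrier V\<rbrakk> \<Longrightarrow> x \<ominus> y = x \<oplus> (- 1) \<odot> y"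
  by (simp add: a_minus_def a_inv_eq_smult)

lemma smult_smult: "x \<in> carrier V \<Longrightarrow> a \<odot> (b \<odot> x) = (a * b) \<odot> x"
  using smult_assoc1[of a b x] by simp

end

locale inner_product_space = complex_module H
  for H :: "'v hilbert" (structure) +
  assumes ip_add_right: "\<And>x y z. \<lbrakk>x \<in> carrier H; y \<in> carrier H; z \<in> carrier H\<rbrakk> \<Longrightarrow>
      ip H x (y \<oplus> z) = ip H x y + ip H x z"
    and ip_smult_right: "\<And>c x y. \<lbrakk>x \<in> carrier H; y \<in> carrier H\<rbrakk> \<Longrightarrow>
      ip H x (c \<odot> y) = c * ip H x y"
    and ip_cnj: "\<And>x y. \<lbrakk>x \<in> carrier H; y \<in> carrier H\<rbrakk> \<Longrightarrow> ip H y x = cnj (ip H x y)"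
    and ip_nonneg: "\<And>x. x \<in> carrier H \<Longrightarrow> ip H x x \<in> \<real>\<^sub>\<ge>\<^sub>0"
    and ip_definite: "\<And>x. \<lbrakk>x \<in> carrier H; ip H x x = 0\<rbrakk> \<Longrightarrow> x = \<zero>"
begin

lemma ip_add_left: "\<lbrakk>x \<in> carrier H; y \<in> carrier H; z \<in> carrier H\<rbrakk> \<Longrightarrow>
    ip H (x \<oplus> y) z = ip H x z + ip H y z"
  using ip_cnj[of z "x \<oplus> y"] ip_cnj[of z x] ip_cnj[of z y] ip_add_right[of z x y] by simp

lemma ip_smult_left: "\<lbrakk>x \<in> carrier H; y \<in> carrier H\<rbrakk> \<Longrightarrow> ip H (c \<odot> x) y = cnj c * ip H x y"
  using ip_cnj[of y "c \<odot> x"] ip_cnj[of y x] ip_smult_right[of y x c] by simp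

lemma ip_zero_right [simp]: "x \<in> carrier H \<Longrightarrow> ip H x \<zero> = 0"
  using ip_smult_right[of x \<zero> 0] by simp

lemma ip_zero_left [simp]: "x \<in> carrier H \<Longrightarrow> ip H \<zero> x = 0"
  using ip_cnj[of x \<zero>] by simp

lemma ip_diff_right: "\<lbrakk>x \<in> carrier H; y \<in> carrier H; z \<in> carrier H\<rbrakk> \<Longrightarrow>
    ip H x (y \<ominus> z) = ip H x y - ip H x z"
  by (simp add: diff_eq_smult ip_add_right ip_smult_right)

lemma ip_diff_left: "\<lbrakk>x \<in> carrier H; y \<in> carrier H; z \<in> carrier H\<rbrakk> \<Longrightarrow>
    ip H (x \<ominus> y) z = ip H x z - ip H y z"
  by (simp add: diff_eq_smult ip_add_left ip_smult_left)

lemma ip_self: "x \<in> carrier H \<Longrightarrow> ip H x x = of_real ((hnorm H x)\<^sup>2)"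
  using ip_nonneg[of x] by (auto simp: hnorm_def complex_nonneg_Reals_iff complex_eq_iff)

lemma hnorm_nonneg [simp]: "x \<in> carrier H \<Longrightarrow> 0 \<le> hnorm H x"
  using ip_nonneg[of x] by (auto simp: hnorm_def complex_nonneg_Reals_iff)

lemma hnorm_eq_0: "x \<in> carrier H \<Longrightarrow> hnorm H x = 0 \<longleftrightarrow> x = \<zero>"
  using ip_self[of x] ip_definite[of x] by (auto simp: hnorm_def)

lemma hnorm_smult: "x \<in> carrier H \<Longrightarrow> hnorm H (c \<odot> x) = cmod c * hnorm H x"
proof -
  assume x: "x \<in> carrier H"
  have "complex_of_real ((hnorm H (c \<odot> x))\<^sup>2) = of_real ((cmod c * hnorm H x)\<^sup>2)"
    using x ip_self[of "c \<odot> x"] ip_self[of x]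
    by (simp add: ip_smult_left ip_smult_right power_mult_distrib complex_norm_square mult_ac
        del: of_real_power)
  then have "(hnorm H (c \<odot> x))\<^sup>2 = (cmod c * hnorm H x)\<^sup>2"
    using of_real_eq_iff by blast
  then show ?thesis using x by (simp add: power2_eq_iff_nonneg)
qed

lemma hnorm_minus_commute: "\<lbrakk>x \<in> carrier H; y \<in> carrier H\<rbrakk> \<Longrightarrow> hnorm H (x \<ominus> y) = hnorm H (y \<ominus> x)"
  using hnorm_smult[of "x \<ominus> y" "- 1"] by (simp add: diff_eq_smult smult_r_distr smult_smult a_comm)

lemma cauchy_schwarz: "\<lbrakk>x \<in> carrier H; y \<in> carrier H\<rbrakk> \<Longrightarrow> cmod (ip H x y) \<le> hnorm H x * hnorm H y"
proof -
  assume x: "x \<in> carrier H" and y: "y \<in> carrier H"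
  show ?thesis
  proof (cases "y = \<zero>")
    case True
    then show ?thesis using x y by simp
  next
    case False
    define N where "N = (hnorm H y)\<^sup>2"
    have N: "N > 0" using False y hnorm_eq_0[of y] by (auto simp: N_def)
    \<comment> \<open>\<open>c\<close> is the coefficient of the orthogonal projection of
      \<open>x\<close> onto \<open>y\<close>; the squared norm of the remainder \<open>?w\<close> is
      the deficit in the squared inequality divided by \<open>N\<close>.\<close>
    define c where "c = ip H y x / of_real N"
    let ?w = "x \<ominus> c \<odot> y"
    have xy: "ip H y x = cnj (ip H x y)" using x y by (rule ip_cnj)
    have yy: "ip H y y = of_real N" using y ip_self by (simp add: N_def)
    have "ip H ?w ?w = ip H x x - ip H y x * ip H x y / of_real N"
      using x y N by (simp add: ip_diff_left ip_diff_right ip_smult_left ip_smult_right yy c_def xy)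
    also have "\<dots> = of_real ((hnorm H x)\<^sup>2 - (cmod (ip H x y))\<^sup>2 / N)"
      using x complex_norm_square[of "ip H x y"] by (simp add: xy ip_self mult.commute)
    finally have "0 \<le> (hnorm H x)\<^sup>2 - (cmod (ip H x y))\<^sup>2 / N"
      using ip_nonneg[of ?w] x y by (simp add: complex_nonneg_Reals_iff)
    then have "(cmod (ip H x y))\<^sup>2 \<le> (hnorm H x * hnorm H y)\<^sup>2"
      using N by (simp add: N_def field_simps power_mult_distrib)
    then show ?thesis using x y by (simp add: power2_le_iff_abs_le)
  qed
qed

lemma hnorm_triangle: "\<lbrakk>x \<in> carrier H; y \<in> carrier H\<rbrakk> \<Longrightarrow> hnorm H (x \<oplus> y) \<le> hnorm H x + hnorm H y"
proof -
  assume x: "x \<in> carrier H" and y: "y \<in> carrier H"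
  have "(hnorm H (x \<oplus> y))\<^sup>2 = Re (ip H (x \<oplus> y) (x \<oplus> y))"
    using x y by (simp add: ip_self del: of_real_power)
  also have "\<dots> = (hnorm H x)\<^sup>2 + (hnorm H y)\<^sup>2 + 2 * Re (ip H x y)"
    using x y ip_cnj[of x y] by (simp add: ip_add_left ip_add_right ip_self[OF x] ip_self[OF y] del: of_real_power)
  also have "\<dots> \<le> (hnorm H x)\<^sup>2 + (hnorm H y)\<^sup>2 + 2 * (hnorm H x * hnorm H y)"
    using cauchy_schwarz[OF x y] complex_Re_le_cmod[of "ip H x y"] by linarith
  finally have "(hnorm H (x \<oplus> y))\<^sup>2 \<le> (hnorm H x + hnorm H y)\<^sup>2"
    by (simp add: power2_sum)
  then show ?thesis using x y by (simp add: power2_le_iff_abs_le)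
qed

lemma diff_add_diff: "\<lbrakk>x \<in> carrier H; y \<in> carrier H; z \<in> carrier H\<rbrakk> \<Longrightarrow> (x \<ominus> y) \<oplus> (y \<ominus> z) = x \<ominus> z"
  by (simp add: a_minus_def a_assoc r_neg1)

lemma hnorm_triangle_diff: "\<lbrakk>x \<in> carrier H; y \<in> carrier H; z \<in> carrier H\<rbrakk> \<Longrightarrow>
    hnorm H (x \<ominus> z) \<le> hnorm H (x \<ominus> y) + hnorm H (y \<ominus> z)"
  using hnorm_triangle[of "x \<ominus> y" "y \<ominus> z"] by (simp add: diff_add_diff)

text \<open>Each coefficient is the conjugate of the scalar in front of \<open>v\<close>, because
  the inner product is conjugate-linear in its first argument. The identity turns equalities of
  norms into equalities of forms.\<close>

lemma polarization:
  assumes "u \<in> carrier H" "v \<in> carrier H"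
  shows "4 * ip H u v = of_real ((hnorm H (u \<oplus> v))\<^sup>2) - of_real ((hnorm H (u \<oplus> (- 1) \<odot> v))\<^sup>2)
     + \<i> * of_real ((hnorm H (u \<oplus> (- \<i>) \<odot> v))\<^sup>2) - \<i> * of_real ((hnorm H (u \<oplus> \<i> \<odot> v))\<^sup>2)"
proof -
  have e: "of_real ((hnorm H (u \<oplus> c \<odot> v))\<^sup>2) =
      ip H u u + c * ip H u v + cnj c * ip H v u + cnj c * c * ip H v v" for c
    using assms by (simp add: ip_self[symmetric] ip_add_left ip_add_right ip_smult_left
        ip_smult_right algebra_simps del: of_real_power)
  have e1: "of_real ((hnorm H (u \<oplus> v))\<^sup>2) = ip H u u + ip H u v + ip H v u + ip H v v"
    using e[of 1] assms by (simp del: of_real_power)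
  show ?thesis
    unfolding e e1 by (simp add: algebra_simps)
qed

text \<open>The equation that defines an adjoint passes to graph limits by Cauchy-Schwarz, so a
  self-adjoint operator is closed.\<close>

lemma op_adjoint_closed:
  assumes T: "T \<subseteq> carrier H \<times> carrier H" and adj: "op_adjoint H T = T"
  shows "graph_closure H T \<subseteq> T"
proof clarify
  fix y w assume yw: "(y, w) \<in> graph_closure H T"
  then have c: "y \<in> carrier H" "w \<in> carrier H" by (auto simp: graph_closure_def)
  have "ip H y z = ip H w x" if xz: "(x, z) \<in> T" for x z
  proof -
    have xzc: "x \<in> carrier H" "z \<in> carrier H" using xz T by auto
    have "cmod (ip H y z - ip H w x) \<le> 0 + e" if "e > 0" for e
    proof -
      \<comment> \<open>Scaled so that the two error terms together stay within \<open>e\<close>;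
        the summand 1 keeps the denominator positive for zero vectors.\<close>
      define d where "d = e / (hnorm H z + hnorm H x + 1)"
      have pos: "hnorm H z + hnorm H x + 1 > 0" using xzc by (smt (verit) hnorm_nonneg)
      have "d > 0" using that pos by (simp add: d_def)
      then obtain a b where ab: "(a, b) \<in> T" "hnorm H (y \<ominus> a) < d" "hnorm H (w \<ominus> b) < d"
        using yw by (fastforce simp: graph_closure_def)
      have abc: "a \<in> carrier H" "b \<in> carrier H" using ab T by auto
      have "(a, b) \<in> op_adjoint H T" using ab adj by simp
      then have "ip H a z = ip H b x" using xz by (auto simp: op_adjoint_def)
      then have "ip H y z - ip H w x = ip H (y \<ominus> a) z - ip H (w \<ominus> b) x"
        using c abc xzc by (simp add: ip_diff_left)
      then have "cmod (ip H y z - ip H w x) \<le> cmod (ip H (y \<ominus> a) z) + cmod (ip H (w \<ominus> b) x)"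
        using norm_triangle_ineq4 by metis
      also have "\<dots> \<le> hnorm H (y \<ominus> a) * hnorm H z + hnorm H (w \<ominus> b) * hnorm H x"
        using c abc xzc by (intro add_mono cauchy_schwarz) auto
      also have "\<dots> \<le> d * hnorm H z + d * hnorm H x"
        using ab xzc by (intro add_mono mult_right_mono) auto
      also have "\<dots> \<le> d * (hnorm H z + hnorm H x + 1)"
        using \<open>d > 0\<close> by (simp add: algebra_simps)
      also have "\<dots> = e" using pos by (simp add: d_def)
      finally show ?thesis by simp
    qed
    then have "cmod (ip H y z - ip H w x) \<le> 0" by (rule field_le_epsilon)
    then show ?thesis by simp
  qed
  then have "(y, w) \<in> op_adjoint H T" using c by (auto simp: op_adjoint_def)
  then show "(y, w) \<in> T" using adj by simp
qed

end

section \<open>Hilbert sums of \<open>L\<^sup>2\<close> spaces in terms of functions\<close>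

text \<open>The domain condition of the theorem is a sum over the index, while the estimates use
  integrals over the counting measure.\<close>

lemma infsum_ennreal_eq_nn_integral:
  fixes f :: "'i :: countable \<Rightarrow> ennreal"
  shows "(\<Sum>\<^sub>\<infinity>n. f n) = (\<integral>\<^sup>+n. f n \<partial>count_space UNIV)"
proof (rule antisym)
  show "(\<Sum>\<^sub>\<infinity>n. f n) \<le> (\<integral>\<^sup>+n. f n \<partial>count_space UNIV)"
    unfolding nonneg_infsum_complete[OF zero_le]
  proof (rule SUP_least)
    fix F :: "'i set" assume "F \<in> {F. finite F \<and> F \<subseteq> UNIV}"
    then have F: "finite F" by simp
    have "sum f F = (\<integral>\<^sup>+n. f n * indicator F n \<partial>count_space UNIV)"
      using F by (simp add: nn_integral_count_space_finite flip: nn_integral_count_space_indicator)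
    also have "\<dots> \<le> (\<integral>\<^sup>+n. f n \<partial>count_space UNIV)"
      by (intro nn_integral_mono) (auto simp: indicator_def)
    finally show "sum f F \<le> (\<integral>\<^sup>+n. f n \<partial>count_space UNIV)" .
  qed
  \<comment> \<open>These finite sets exhaust the countable index type along an injection into the
    naturals, so monotone convergence applies.\<close>
  define E where "E m = {i :: 'i. to_nat i < m}" for m
  have E: "finite (E m)" for m
    unfolding E_def by (rule finite_imageD[of to_nat])
      (auto intro: finite_subset[of _ "{..<m}"] inj_onI)
  have "f n = (SUP m. f n * indicator (E m) n)" for n
  proof (rule SUP_eqI[symmetric])
    fix y assume "\<And>m. m \<in> UNIV \<Longrightarrow> f n * indicator (E m) n \<le> y"
    from this[of "Suc (to_nat n)"] show "f n \<le> y" by (simp add: E_def)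
  qed (auto simp: indicator_def)
  then have "(\<integral>\<^sup>+n. f n \<partial>count_space UNIV) =
      (\<integral>\<^sup>+n. (SUP m. f n * indicator (E m) n) \<partial>count_space UNIV)"
    by simp
  also have "\<dots> = (SUP m. \<integral>\<^sup>+n. f n * indicator (E m) n \<partial>count_space UNIV)"
    by (rule nn_integral_monotone_convergence_SUP)
      (auto simp: E_def incseq_def le_fun_def indicator_def)
  also have "\<dots> = (SUP m. sum f (E m))"
    using E by (simp add: nn_integral_count_space_finite flip: nn_integral_count_space_indicator)
  also have "\<dots> \<le> (\<Sum>\<^sub>\<infinity>n. f n)"
    unfolding nonneg_infsum_complete[OF zero_le]
    using E by (intro SUP_least SUP_upper) auto
  finally show "(\<integral>\<^sup>+n. f n \<partial>count_space UNIV) \<le> (\<Sum>\<^sub>\<infinity>n. f n)" .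
qed

lemma summable_on_real_iff_nn_integral:
  fixes a :: "'i \<Rightarrow> real"
  assumes "\<And>n. 0 \<le> a n"
  shows "a summable_on UNIV \<longleftrightarrow> (\<integral>\<^sup>+n. ennreal (a n) \<partial>count_space UNIV) < \<infinity>"
proof -
  have "a summable_on UNIV \<longleftrightarrow> integrable (count_space UNIV) a"
    by (rule trans[OF summable_on_iff_abs_summable_on_real])
      (simp only: abs_summable_equivalent abs_summable_on_def)
  also have "\<dots> \<longleftrightarrow> (\<integral>\<^sup>+n. ennreal (a n) \<partial>count_space UNIV) < \<infinity>"
    using assms by (simp add: integrable_iff_bounded)
  finally show ?thesis .
qed

lemma infsum_real_eq_nn_integral:
  fixes a :: "'i \<Rightarrow> real"
  assumes "\<And>n. 0 \<le> a n" "a summable_on UNIV"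
  shows "ennreal (\<Sum>\<^sub>\<infinity>n. a n) = (\<integral>\<^sup>+n. ennreal (a n) \<partial>count_space UNIV)"
proof -
  have a: "integrable (count_space UNIV) a"
    using assms(2) summable_on_iff_abs_summable_on_real[of a UNIV]
    by (simp only: abs_summable_equivalent abs_summable_on_def)
  then have "(\<Sum>\<^sub>\<infinity>n. a n) = (\<integral>n. a n \<partial>count_space UNIV)"
    by (simp add: infsetsum_infsum[symmetric] infsetsum_def abs_summable_on_def)
  then show ?thesis using nn_integral_eq_integral[OF a] assms(1) by simp
qed

section \<open>Square-summable families of functions and their classes\<close>

definition sqsum :: "('i \<Rightarrow> 't measure) \<Rightarrow> ('i \<Rightarrow> 't \<Rightarrow> complex) \<Rightarrow> ennreal" where
  "sqsum M x = (\<integral>\<^sup>+n. \<integral>\<^sup>+z. ennreal ((cmod (x n z))\<^sup>2) \<partial>M n \<partial>count_space UNIV)"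

text \<open>Function-level model of the vectors: \<open>sqsum\<close> is a squared norm with
  extended nonnegative values, defined for every family, and its finiteness singles out the
  representatives of vectors. \<open>l2cls\<close> and \<open>l2rep\<close> pass between families
  and vectors.\<close>

definition l2fam :: "('i \<Rightarrow> 't measure) \<Rightarrow> ('i \<Rightarrow> 't \<Rightarrow> complex) set" where
  "l2fam M = {x. (\<forall>n. x n \<in> borel_measurable (M n)) \<and> sqsum M x < \<infinity>}"

definition l2cls :: "('i \<Rightarrow> 't measure) \<Rightarrow> ('i \<Rightarrow> 't \<Rightarrow> complex) \<Rightarrow> 'i \<Rightarrow> ('t \<Rightarrow> complex) set" where
  "l2cls M x = (\<lambda>n. L2_class (M n) (x n))"

definition l2rep :: "('i \<Rightarrow> ('t \<Rightarrow> complex) set) \<Rightarrow> 'i \<Rightarrow> 't \<Rightarrow> complex" where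
  "l2rep X = (\<lambda>n. rep (X n))"

definition l2sum :: "('i \<Rightarrow> 't measure) \<Rightarrow> ('i \<Rightarrow> ('t \<Rightarrow> complex) set) hilbert" where
  "l2sum M = hilbert_sum (\<lambda>n. L2 (M n))"

lemma borel_measurable_cnj [measurable (raw)]:
  "f \<in> borel_measurable M \<Longrightarrow> (\<lambda>z. cnj (f z)) \<in> borel_measurable M"
  by (rule borel_measurable_continuous_on[where f = cnj]) (auto intro!: continuous_intros)

lemma sq_integrable_measurable [measurable_dest]:
  "f \<in> sq_integrable M \<Longrightarrow> f \<in> borel_measurable M"
  by (simp add: sq_integrable_def)

lemma sq_integrable_iff:
  "f \<in> sq_integrable M \<longleftrightarrow>
    f \<in> borel_measurable M \<and> (\<integral>\<^sup>+z. ennreal ((cmod (f z))\<^sup>2) \<partial>M) < \<infinity>"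
  by (auto simp: sq_integrable_def integrable_iff_bounded)

lemma nn_integral_sq_integrable:
  "f \<in> sq_integrable M \<Longrightarrow>
    (\<integral>\<^sup>+z. ennreal ((cmod (f z))\<^sup>2) \<partial>M) = ennreal (\<integral>z. (cmod (f z))\<^sup>2 \<partial>M)"
  by (rule nn_integral_eq_integral) (auto simp: sq_integrable_def)

lemma L2_class_cong_AE: "AE z in M. f z = g z \<Longrightarrow> L2_class M f = L2_class M g"
  by (auto simp: L2_class_def elim: AE_mp)

lemma L2_class_self: "f \<in> sq_integrable M \<Longrightarrow> f \<in> L2_class M f"
  by (simp add: L2_class_def)

lemma L2_class_eq_iff: "f \<in> sq_integrable M \<Longrightarrow> L2_class M f = L2_class M g \<longleftrightarrow> (AE z in M. f z = g z)"
  using L2_class_self[of f M] L2_class_cong_AE[of f g M] by (auto simp: L2_class_def)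

lemma rep_L2_class:
  assumes "f \<in> sq_integrable M"
  shows "rep (L2_class M f) \<in> sq_integrable M" "AE z in M. rep (L2_class M f) z = f z"
proof -
  have "rep (L2_class M f) \<in> L2_class M f"
    unfolding rep_def using L2_class_self[OF assms] by (rule someI[of "\<lambda>g. g \<in> L2_class M f"])
  then show "rep (L2_class M f) \<in> sq_integrable M" "AE z in M. rep (L2_class M f) z = f z"
    by (auto simp: L2_class_def)
qed

text \<open>The crude bound |f g| <= |f|^2 + |g|^2 gives integrability and, applied to each
  component, a summable majorant for inner products over the index.\<close>

lemma sq_integrable_mult_integrable:
  assumes "f \<in> sq_integrable M" "g \<in> sq_integrable M"
  shows "integrable M (\<lambda>z. cnj (f z) * g z)"
    and "cmod (\<integral>z. cnj (f z) * g z \<partial>M) \<le> (\<integral>z. (cmod (f z))\<^sup>2 \<partial>M) + (\<integral>z. (cmod (g z))\<^sup>2 \<partial>M)"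
proof -
  have i: "integrable M (\<lambda>z. (cmod (f z))\<^sup>2 + (cmod (g z))\<^sup>2)"
    using assms by (auto simp: sq_integrable_def)
  have b: "norm (cnj (f z) * g z) \<le> (cmod (f z))\<^sup>2 + (cmod (g z))\<^sup>2" for z
  proof -
    have "0 \<le> cmod (f z) * cmod (g z)" by simp
    then show ?thesis
      using sum_squares_bound[of "cmod (f z)" "cmod (g z)"]
      unfolding norm_mult complex_mod_cnj by linarith
  qed
  have m: "(\<lambda>z. cnj (f z) * g z) \<in> borel_measurable M"
    using assms by measurable
  show int: "integrable M (\<lambda>z. cnj (f z) * g z)"
    by (rule Bochner_Integration.integrable_bound[OF i m]) (use b in \<open>auto intro: order_trans[OF b]\<close>)
  have "cmod (\<integral>z. cnj (f z) * g z \<partial>M) \<le> (\<integral>z. norm (cnj (f z) * g z) \<partial>M)"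
    by (rule integral_norm_bound)
  also have "\<dots> \<le> (\<integral>z. (cmod (f z))\<^sup>2 + (cmod (g z))\<^sup>2 \<partial>M)"
    by (rule integral_mono[OF integrable_norm[OF int] i]) (rule b)
  finally have "cmod (\<integral>z. cnj (f z) * g z \<partial>M) \<le> (\<integral>z. (cmod (f z))\<^sup>2 + (cmod (g z))\<^sup>2 \<partial>M)" .
  then show "cmod (\<integral>z. cnj (f z) * g z \<partial>M) \<le> (\<integral>z. (cmod (f z))\<^sup>2 \<partial>M) + (\<integral>z. (cmod (g z))\<^sup>2 \<partial>M)"
    using assms by (simp add: sq_integrable_def)
qed

lemma l2fam_component: "x \<in> l2fam M \<Longrightarrow> x n \<in> sq_integrable (M n)"
  unfolding sq_integrable_iff l2fam_def sqsum_def
  using nn_integral_ge_point[of n UNIV "\<lambda>n. \<integral>\<^sup>+z. ennreal ((cmod (x n z))\<^sup>2) \<partial>M n"]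
  by (auto intro: order_le_less_trans)

lemma l2fam_measurable: "x \<in> l2fam M \<Longrightarrow> x n \<in> borel_measurable (M n)"
  by (simp add: l2fam_def)

lemma sqsum_eq_integral: "\<lbrakk>\<And>n. x n \<in> sq_integrable (M n)\<rbrakk> \<Longrightarrow>
    sqsum M x = (\<integral>\<^sup>+n. ennreal (\<integral>z. (cmod (x n z))\<^sup>2 \<partial>M n) \<partial>count_space UNIV)"
  by (simp add: sqsum_def nn_integral_sq_integrable)

lemma l2fam_iff: "x \<in> l2fam M \<longleftrightarrow> (\<forall>n. x n \<in> sq_integrable (M n)) \<and>
    (\<lambda>n. \<integral>z. (cmod (x n z))\<^sup>2 \<partial>M n) summable_on UNIV" (is "?L \<longleftrightarrow> ?R")
proof -
  have "sqsum M x < \<infinity> \<longleftrightarrow> (\<lambda>n. \<integral>z. (cmod (x n z))\<^sup>2 \<partial>M n) summable_on UNIV"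
    if "\<forall>n. x n \<in> sq_integrable (M n)"
    using that by (simp add: sqsum_eq_integral summable_on_real_iff_nn_integral)
  moreover have "\<forall>n. x n \<in> sq_integrable (M n)" if ?L
    using l2fam_component[OF that] by blast
  ultimately show ?thesis
    by (auto simp: l2fam_def sq_integrable_iff)
qed

lemma sqsum_mono_AE:
  assumes "\<And>n. AE z in M n. cmod (x n z) \<le> cmod (y n z)"
  shows "sqsum M x \<le> sqsum M y"
  unfolding sqsum_def
proof (rule nn_integral_mono, rule nn_integral_mono_AE)
  fix n show "AE z in M n. ennreal ((cmod (x n z))\<^sup>2) \<le> ennreal ((cmod (y n z))\<^sup>2)"
    using assms[of n] by eventually_elim (simp add: power_mono)
qed

lemma sqsum_cong_AE:
  assumes "\<And>n. AE z in M n. x n z = y n z"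
  shows "sqsum M x = sqsum M y"
proof -
  have "AE z in M n. cmod (x n z) \<le> cmod (y n z)" for n
    using assms[of n] by eventually_elim simp
  moreover have "AE z in M n. cmod (y n z) \<le> cmod (x n z)" for n
    using assms[of n] by eventually_elim simp
  ultimately show ?thesis
    by (intro antisym sqsum_mono_AE)
qed

text \<open>From (a + b)^2 <= 2 (a^2 + b^2). The closure properties of \<open>l2fam\<close> under
  sums, differences, scalars and multipliers reduce to this bound.\<close>

lemma l2fam_bound:
  assumes x: "x \<in> l2fam M" and y: "y \<in> l2fam M"
    and w: "\<And>n. w n \<in> borel_measurable (M n)"
    and b: "\<And>n. AE z in M n. cmod (w n z) \<le> c * (cmod (x n z) + cmod (y n z))"
  shows "w \<in> l2fam M"
proof -
  have [measurable]: "x n \<in> borel_measurable (M n)" "y n \<in> borel_measurable (M n)" for n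
    using x y by (auto simp: l2fam_def)
  have "sqsum M w \<le> (\<integral>\<^sup>+n. \<integral>\<^sup>+z. ennreal (2 * c\<^sup>2) * (ennreal ((cmod (x n z))\<^sup>2) + ennreal ((cmod (y n z))\<^sup>2)) \<partial>M n \<partial>count_space UNIV)"
    unfolding sqsum_def
  proof (rule nn_integral_mono, rule nn_integral_mono_AE)
    fix n
    show "AE z in M n. ennreal ((cmod (w n z))\<^sup>2) \<le>
        ennreal (2 * c\<^sup>2) * (ennreal ((cmod (x n z))\<^sup>2) + ennreal ((cmod (y n z))\<^sup>2))"
      using b[of n]
    proof eventually_elim
      case (elim z)
      have "(cmod (w n z))\<^sup>2 \<le> (c * (cmod (x n z) + cmod (y n z)))\<^sup>2"
        using elim by (intro power_mono) auto
      also have "\<dots> = c\<^sup>2 * (cmod (x n z) + cmod (y n z))\<^sup>2"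
        by (simp add: power_mult_distrib)
      also have "\<dots> \<le> c\<^sup>2 * (2 * ((cmod (x n z))\<^sup>2 + (cmod (y n z))\<^sup>2))"
        using sum_squares_bound[of "cmod (x n z)" "cmod (y n z)"]
        by (intro mult_left_mono) (auto simp: power2_sum algebra_simps)
      finally show ?case
        by (simp add: ennreal_mult[symmetric] ennreal_plus[symmetric] algebra_simps del: ennreal_plus)
    qed
  qed
  also have "\<dots> = ennreal (2 * c\<^sup>2) * (sqsum M x + sqsum M y)"
    unfolding sqsum_def by (simp add: nn_integral_cmult nn_integral_add)
  also have "\<dots> < \<infinity>"
    using x y by (simp add: l2fam_def ennreal_mult_less_top)
  finally show ?thesis using w by (simp add: l2fam_def)
qed

text \<open>\<open>x\<close> serves as both bounding families, hence the constant
  \<open>c / 2\<close>.\<close>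

lemma l2fam_dominated:
  assumes "x \<in> l2fam M" "\<And>n. w n \<in> borel_measurable (M n)"
    "\<And>n. AE z in M n. cmod (w n z) \<le> c * cmod (x n z)"
  shows "w \<in> l2fam M"
  by (rule l2fam_bound[OF assms(1,1,2), of "c / 2"]) (use assms(3) in \<open>simp add: field_simps\<close>)

lemma l2fam_cong_AE:
  assumes "x \<in> l2fam M" "\<And>n. w n \<in> borel_measurable (M n)" "\<And>n. AE z in M n. w n z = x n z"
  shows "w \<in> l2fam M"
  using assms sqsum_cong_AE[where M = M and x = w and y = x] by (auto simp: l2fam_def)

lemma l2fam_add: "\<lbrakk>x \<in> l2fam M; y \<in> l2fam M\<rbrakk> \<Longrightarrow> (\<lambda>n z. x n z + y n z) \<in> l2fam M"
  by (rule l2fam_bound[where x = x and y = y and c = 1])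
    (auto simp: l2fam_def norm_triangle_ineq intro!: borel_measurable_add)

lemma l2fam_diff: "\<lbrakk>x \<in> l2fam M; y \<in> l2fam M\<rbrakk> \<Longrightarrow> (\<lambda>n z. x n z - y n z) \<in> l2fam M"
  by (rule l2fam_bound[where x = x and y = y and c = 1])
    (auto simp: l2fam_def norm_triangle_ineq4 intro!: borel_measurable_diff)

lemma l2fam_smult: "x \<in> l2fam M \<Longrightarrow> (\<lambda>n z. c * x n z) \<in> l2fam M"
  by (rule l2fam_dominated[where x = x and c = "cmod c"])
    (auto simp: l2fam_def norm_mult intro!: borel_measurable_times)

lemma l2fam_zero: "(\<lambda>n z. 0) \<in> l2fam M"
  by (simp add: l2fam_def sqsum_def)

lemma l2cls_cong_AE: "(\<And>n. AE z in M n. x n z = y n z) \<Longrightarrow> l2cls M x = l2cls M y"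
  by (auto simp: l2cls_def intro!: ext L2_class_cong_AE)

lemma l2cls_eq_iff: "x \<in> l2fam M \<Longrightarrow> l2cls M x = l2cls M y \<longleftrightarrow> (\<forall>n. AE z in M n. x n z = y n z)"
  by (auto simp: l2cls_def fun_eq_iff L2_class_eq_iff l2fam_component)

lemma l2rep_l2cls:
  assumes "x \<in> l2fam M"
  shows "AE z in M n. l2rep (l2cls M x) n z = x n z" "l2rep (l2cls M x) \<in> l2fam M"
proof -
  note r = rep_L2_class[OF l2fam_component[OF assms]]
  show ae: "AE z in M n. l2rep (l2cls M x) n z = x n z" for n
    using r(2)[of n] by (simp add: l2cls_def l2rep_def)
  show "l2rep (l2cls M x) \<in> l2fam M"
    by (rule l2fam_cong_AE[OF assms _ ae]) (use r(1) in \<open>simp add: l2cls_def l2rep_def sq_integrable_def\<close>)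
qed

lemma hnorm_L2_class:
  assumes "f \<in> sq_integrable M"
  shows "(hnorm (L2 M) (L2_class M f))\<^sup>2 = (\<integral>z. (cmod (f z))\<^sup>2 \<partial>M)"
proof -
  let ?r = "rep (L2_class M f)"
  have "(\<integral>z. cnj (?r z) * ?r z \<partial>M) = (\<integral>z. complex_of_real ((cmod (f z))\<^sup>2) \<partial>M)"
  proof (rule integral_cong_AE)
    show "AE z in M. cnj (?r z) * ?r z = complex_of_real ((cmod (f z))\<^sup>2)"
      using rep_L2_class(2)[OF assms]
      by eventually_elim (simp only: complex_norm_square mult.commute)
  qed (use assms rep_L2_class(1)[OF assms] in
      \<open>auto simp: sq_integrable_def intro!: borel_measurable_times borel_measurable_cnj\<close>)
  also have "\<dots> = of_real (\<integral>z. (cmod (f z))\<^sup>2 \<partial>M)"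
    by (rule integral_complex_of_real)
  finally show ?thesis by (simp add: hnorm_def L2_def)
qed

text \<open>Summability of the squared component norms in \<open>hilbert_sum\<close> is finiteness
  of \<open>sqsum\<close> on representatives.\<close>

lemma carrier_l2sum: "carrier (l2sum M) = l2cls M ` l2fam M"
proof (intro equalityI subsetI)
  fix X assume X: "X \<in> carrier (l2sum M)"
  then have "\<forall>n. \<exists>f. f \<in> sq_integrable (M n) \<and> X n = L2_class (M n) f"
    by (auto simp: l2sum_def hilbert_sum_def L2_def)
  then obtain x where x: "\<And>n. x n \<in> sq_integrable (M n)" "\<And>n. X n = L2_class (M n) (x n)"
    by metis
  have "X = l2cls M x" using x by (auto simp: l2cls_def)
  moreover have "x \<in> l2fam M"
    using X x by (auto simp: l2fam_iff l2sum_def hilbert_sum_def hnorm_L2_class)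
  ultimately show "X \<in> l2cls M ` l2fam M" by blast
next
  fix X assume "X \<in> l2cls M ` l2fam M"
  then obtain x where x: "X = l2cls M x" "x \<in> l2fam M" by blast
  then show "X \<in> carrier (l2sum M)"
    by (auto simp: l2sum_def hilbert_sum_def L2_def l2cls_def l2fam_iff
        simp flip: hnorm_L2_class)
qed

lemma l2cls_in_carrier [simp]: "x \<in> l2fam M \<Longrightarrow> l2cls M x \<in> carrier (l2sum M)"
  by (simp add: carrier_l2sum)

lemma l2rep_carrier:
  assumes "X \<in> carrier (l2sum M)"
  shows "l2rep X \<in> l2fam M" "l2cls M (l2rep X) = X"
proof -
  obtain x where x: "X = l2cls M x" "x \<in> l2fam M" using assms by (auto simp: carrier_l2sum)
  show "l2rep X \<in> l2fam M" using l2rep_l2cls x by blast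
  show "l2cls M (l2rep X) = X"
    unfolding x(1) using l2rep_l2cls(1)[OF x(2)] by (rule l2cls_cong_AE)
qed

lemma zero_l2sum: "\<zero>\<^bsub>l2sum M\<^esub> = l2cls M (\<lambda>n z. 0)"
  by (simp add: l2sum_def hilbert_sum_def L2_def l2cls_def)

lemma add_l2sum:
  assumes "x \<in> l2fam M" "y \<in> l2fam M"
  shows "l2cls M x \<oplus>\<^bsub>l2sum M\<^esub> l2cls M y = l2cls M (\<lambda>n z. x n z + y n z)"
proof
  fix n
  have "AE z in M n. rep (l2cls M x n) z + rep (l2cls M y n) z = x n z + y n z"
    using l2rep_l2cls(1)[OF assms(1), of n] l2rep_l2cls(1)[OF assms(2), of n]
    unfolding l2rep_def by eventually_elim simp
  then show "(l2cls M x \<oplus>\<^bsub>l2sum M\<^esub> l2cls M y) n = l2cls M (\<lambda>n z. x n z + y n z) n"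
    by (simp add: l2sum_def hilbert_sum_def L2_def l2cls_def L2_class_cong_AE)
qed

lemma smult_l2sum:
  assumes "x \<in> l2fam M"
  shows "c \<odot>\<^bsub>l2sum M\<^esub> l2cls M x = l2cls M (\<lambda>n z. c * x n z)"
proof
  fix n
  have "AE z in M n. c * rep (l2cls M x n) z = c * x n z"
    using l2rep_l2cls(1)[OF assms(1), of n] unfolding l2rep_def by eventually_elim simp
  then show "(c \<odot>\<^bsub>l2sum M\<^esub> l2cls M x) n = l2cls M (\<lambda>n z. c * x n z) n"
    by (simp add: l2sum_def hilbert_sum_def L2_def l2cls_def L2_class_cong_AE)
qed

lemma ip_l2sum:
  assumes "x \<in> l2fam M" "y \<in> l2fam M"
  shows "ip (l2sum M) (l2cls M x) (l2cls M y) = (\<Sum>\<^sub>\<infinity>n. \<integral>z. cnj (x n z) * y n z \<partial>M n)"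
proof -
  have "(\<integral>z. cnj (rep (l2cls M x n) z) * rep (l2cls M y n) z \<partial>M n) = (\<integral>z. cnj (x n z) * y n z \<partial>M n)" for n
  proof (rule integral_cong_AE)
    show "AE z in M n. cnj (rep (l2cls M x n) z) * rep (l2cls M y n) z = cnj (x n z) * y n z"
      using l2rep_l2cls(1)[OF assms(1), of n] l2rep_l2cls(1)[OF assms(2), of n]
      unfolding l2rep_def by eventually_elim simp
    show "(\<lambda>z. cnj (rep (l2cls M x n) z) * rep (l2cls M y n) z) \<in> borel_measurable (M n)"
      using l2fam_measurable[OF l2rep_l2cls(2)[OF assms(1)], of n]
        l2fam_measurable[OF l2rep_l2cls(2)[OF assms(2)], of n]
      unfolding l2rep_def by (intro borel_measurable_times borel_measurable_cnj)
  qed (use assms in \<open>intro borel_measurable_times borel_measurable_cnj l2fam_measurable\<close>)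
  then show ?thesis by (simp add: l2sum_def hilbert_sum_def L2_def)
qed

lemma ip_l2sum_summable:
  assumes "x \<in> l2fam M" "y \<in> l2fam M"
  shows "(\<lambda>n. \<integral>z. cnj (x n z) * y n z \<partial>M n) summable_on UNIV"
proof (rule abs_summable_summable)
  have "(\<lambda>n. (\<integral>z. (cmod (x n z))\<^sup>2 \<partial>M n) + (\<integral>z. (cmod (y n z))\<^sup>2 \<partial>M n)) summable_on UNIV"
    using assms by (intro summable_on_add) (auto simp: l2fam_iff)
  then show "(\<lambda>n. norm (\<integral>z. cnj (x n z) * y n z \<partial>M n)) summable_on UNIV"
    by (rule summable_on_comparison_test)
      (simp_all add: sq_integrable_mult_integrable(2) l2fam_component[OF assms(1)] l2fam_component[OF assms(2)])
qed

text \<open>On the diagonal the inner product is a sum of nonnegative terms, so it can be read off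
  from the extended-valued \<open>sqsum\<close>; norms are computed through this identity.\<close>

lemma sqsum_eq_ip:
  assumes "x \<in> l2fam M"
  shows "ip (l2sum M) (l2cls M x) (l2cls M x) = of_real (enn2real (sqsum M x))"
proof -
  have i: "(\<integral>z. cnj (x n z) * x n z \<partial>M n) = of_real (\<integral>z. (cmod (x n z))\<^sup>2 \<partial>M n)" for n
    unfolding integral_complex_of_real[symmetric] complex_norm_square
    by (simp add: mult.commute)
  have "ennreal (\<Sum>\<^sub>\<infinity>n. \<integral>z. (cmod (x n z))\<^sup>2 \<partial>M n) = sqsum M x"
    using assms by (simp add: infsum_real_eq_nn_integral sqsum_eq_integral l2fam_iff)
  moreover have "0 \<le> (\<Sum>\<^sub>\<infinity>n. \<integral>z. (cmod (x n z))\<^sup>2 \<partial>M n)"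
    by (intro infsum_nonneg) simp
  ultimately have "enn2real (sqsum M x) = (\<Sum>\<^sub>\<infinity>n. \<integral>z. (cmod (x n z))\<^sup>2 \<partial>M n)"
    by (metis enn2real_ennreal)
  moreover have "(\<Sum>\<^sub>\<infinity>n. complex_of_real (\<integral>z. (cmod (x n z))\<^sup>2 \<partial>M n)) =
      of_real (\<Sum>\<^sub>\<infinity>n. \<integral>z. (cmod (x n z))\<^sup>2 \<partial>M n)"
    using assms unfolding l2fam_iff
    by (intro infsumI has_sum_of_real_iff[THEN iffD2] has_sum_infsum) blast
  ultimately show ?thesis
    using assms by (simp add: ip_l2sum i)
qed

lemma sqsum_eq_0_iff:
  assumes "\<And>n. x n \<in> borel_measurable (M n)"
  shows "sqsum M x = 0 \<longleftrightarrow> (\<forall>n. AE z in M n. x n z = 0)"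
proof -
  have [measurable]: "x n \<in> borel_measurable (M n)" for n by (rule assms)
  show ?thesis
    unfolding sqsum_def
    by (subst nn_integral_0_iff_AE) (simp_all add: AE_count_space nn_integral_0_iff_AE)
qed

text \<open>Definiteness holds because vectors are classes modulo null sets; additivity and
  homogeneity hold in each component and pass to the sum by summability of the component inner
  products.\<close>

lemma inner_product_space_l2sum: "inner_product_space (l2sum M)"
proof -
  note r = l2fam_add l2fam_smult l2fam_zero
  have car: "\<exists>x\<in>l2fam M. X = l2cls M x" if "X \<in> carrier (l2sum M)" for X
    using that by (auto simp: carrier_l2sum)
  interpret cring complex_ring by (rule cring_complex_ring)
  have ag: "abelian_group (l2sum M)"
  proof (rule abelian_groupI)
    fix X assume "X \<in> carrier (l2sum M)"
    then obtain x where x: "x \<in> l2fam M" "X = l2cls M x" using car by blast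
    show "\<exists>Y\<in>carrier (l2sum M). Y \<oplus>\<^bsub>l2sum M\<^esub> X = \<zero>\<^bsub>l2sum M\<^esub>"
    proof
      show "l2cls M (\<lambda>n z. (- 1) * x n z) \<oplus>\<^bsub>l2sum M\<^esub> X = \<zero>\<^bsub>l2sum M\<^esub>"
        unfolding x(2) using x(1) l2fam_smult[OF x(1), of "- 1"] by (subst add_l2sum) (auto simp: zero_l2sum)
      show "l2cls M (\<lambda>n z. (- 1) * x n z) \<in> carrier (l2sum M)"
        using x(1) l2fam_smult by (intro l2cls_in_carrier)
    qed
  qed (auto simp: carrier_l2sum add_l2sum zero_l2sum r add_ac)
  have "Module.module complex_ring (l2sum M)"
    by (intro module.intro ag cring_complex_ring module_axioms.intro)
      (auto simp: carrier_l2sum add_l2sum smult_l2sum r algebra_simps)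
  moreover have "inner_product_space_axioms (l2sum M)"
  proof
    fix X Y Z :: "'a \<Rightarrow> ('b \<Rightarrow> complex) set"
    assume "X \<in> carrier (l2sum M)" "Y \<in> carrier (l2sum M)" "Z \<in> carrier (l2sum M)"
    then obtain x y z where *: "x \<in> l2fam M" "X = l2cls M x" "y \<in> l2fam M" "Y = l2cls M y"
        "z \<in> l2fam M" "Z = l2cls M z" using car by metis
    have "(\<integral>t. cnj (x n t) * (y n t + z n t) \<partial>M n) =
       (\<integral>t. cnj (x n t) * y n t \<partial>M n) + (\<integral>t. cnj (x n t) * z n t \<partial>M n)" for n
      unfolding distrib_left using *
      by (intro Bochner_Integration.integral_add sq_integrable_mult_integrable) (auto simp: l2fam_component)
    then show "ip (l2sum M) X (Y \<oplus>\<^bsub>l2sum M\<^esub> Z) = ip (l2sum M) X Y + ip (l2sum M) X Z"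
      using *(1,3,5) unfolding *(2,4,6)
      by (simp add: add_l2sum ip_l2sum l2fam_add infsum_add ip_l2sum_summable)
  next
    fix c and X Y :: "'a \<Rightarrow> ('b \<Rightarrow> complex) set"
    assume "X \<in> carrier (l2sum M)" "Y \<in> carrier (l2sum M)"
    then obtain x y where *: "x \<in> l2fam M" "X = l2cls M x" "y \<in> l2fam M" "Y = l2cls M y"
      using car by metis
    have "(\<integral>t. cnj (x n t) * (c * y n t) \<partial>M n) = c * (\<integral>t. cnj (x n t) * y n t \<partial>M n)" for n
      by (simp add: mult.left_commute)
    then show "ip (l2sum M) X (c \<odot>\<^bsub>l2sum M\<^esub> Y) = c * ip (l2sum M) X Y"
      using *(1,3) unfolding *(2,4)
      by (simp add: smult_l2sum ip_l2sum l2fam_smult infsum_cmult_right ip_l2sum_summable)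
    have "cnj (\<integral>t. cnj (x n t) * y n t \<partial>M n) = (\<integral>t. cnj (y n t) * x n t \<partial>M n)" for n
      unfolding Bochner_Integration.integral_cnj[symmetric] by (simp add: mult.commute)
    then show "ip (l2sum M) Y X = cnj (ip (l2sum M) X Y)"
      using *(1,3) unfolding *(2,4) by (simp add: ip_l2sum infsum_cnj[symmetric] del: infsum_cnj)
  next
    fix X assume "X \<in> carrier (l2sum M)"
    then obtain x where x: "x \<in> l2fam M" "X = l2cls M x" using car by blast
    then show "ip (l2sum M) X X \<in> \<real>\<^sub>\<ge>\<^sub>0" by (simp add: sqsum_eq_ip)
    assume "ip (l2sum M) X X = 0"
    then have "sqsum M x = 0"
      using x by (auto simp: sqsum_eq_ip enn2real_eq_0_iff l2fam_def)
    then show "X = \<zero>\<^bsub>l2sum M\<^esub>"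
      using x sqsum_eq_0_iff[of x M] by (auto simp: zero_l2sum l2fam_def intro!: l2cls_cong_AE)
  qed
  ultimately show ?thesis
    by (simp add: inner_product_space_def complex_module_def)
qed

lemma hnorm_l2sum:
  assumes "x \<in> l2fam M"
  shows "ennreal ((hnorm (l2sum M) (l2cls M x))\<^sup>2) = sqsum M x"
  using assms by (simp add: hnorm_def sqsum_eq_ip l2fam_def less_top)

text \<open>Turns approximation in the Hilbert norm, as in \<open>graph_closure\<close> and
  \<open>hdense\<close>, into estimates of integrals.\<close>

lemma hnorm_l2sum_less_iff:
  assumes "x \<in> l2fam M" "e > 0"
  shows "hnorm (l2sum M) (l2cls M x) < e \<longleftrightarrow> sqsum M x < ennreal (e\<^sup>2)"
proof -
  interpret inner_product_space "l2sum M" by (rule inner_product_space_l2sum)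
  show ?thesis
    using assms power_mono_iff[of e "hnorm (l2sum M) (l2cls M x)" 2]
    by (simp add: hnorm_l2sum[symmetric] ennreal_less_iff flip: not_le)
qed

lemma diff_l2sum:
  assumes "x \<in> l2fam M" "y \<in> l2fam M"
  shows "l2cls M x \<ominus>\<^bsub>l2sum M\<^esub> l2cls M y = l2cls M (\<lambda>n z. x n z - y n z)"
proof -
  interpret inner_product_space "l2sum M" by (rule inner_product_space_l2sum)
  show ?thesis
    using assms l2fam_smult[OF assms(2), of "- 1"] by (simp add: diff_eq_smult smult_l2sum add_l2sum)
qed

section \<open>Uniqueness of positive square roots\<close>

lemma semilinear_opI:
  assumes "\<And>x y. (x, y) \<in> T \<Longrightarrow> x \<in> carrier H \<and> y \<in> carrier H"
    and "\<And>x y z. \<lbrakk>(x, y) \<in> T; (x, z) \<in> T\<rbrakk> \<Longrightarrow> y = z"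
    and "(\<zero>\<^bsub>H\<^esub>, \<zero>\<^bsub>H\<^esub>) \<in> T"
    and "\<And>x y x' y'. \<lbrakk>(x, y) \<in> T; (x', y') \<in> T\<rbrakk> \<Longrightarrow> (x \<oplus>\<^bsub>H\<^esub> x', y \<oplus>\<^bsub>H\<^esub> y') \<in> T"
    and "\<And>c x y. (x, y) \<in> T \<Longrightarrow> (c \<odot>\<^bsub>H\<^esub> x, \<sigma> c \<odot>\<^bsub>H\<^esub> y) \<in> T"
  shows "semilinear_op H \<sigma> T"
proof -
  have "T \<subseteq> carrier H \<times> carrier H" using assms(1) by (auto simp: subset_iff)
  moreover have "single_valued T" using assms(2) by (rule single_valuedI)
  ultimately show ?thesis
    unfolding semilinear_op_def using assms(3-5) by (intro conjI ballI allI; clarsimp)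
qed

lemma semilinear_op_add:
  assumes "semilinear_op H \<sigma> T" "(x, y) \<in> T" "(x', y') \<in> T"
  shows "(x \<oplus>\<^bsub>H\<^esub> x', y \<oplus>\<^bsub>H\<^esub> y') \<in> T"
proof -
  have "\<forall>(x, y)\<in>T. \<forall>(x', y')\<in>T. (x \<oplus>\<^bsub>H\<^esub> x', y \<oplus>\<^bsub>H\<^esub> y') \<in> T"
    using assms(1) unfolding semilinear_op_def by (elim conjE)
  from bspec[OF bspec[OF this assms(2), simplified] assms(3)] show ?thesis by simp
qed

lemma semilinear_op_smult:
  assumes "semilinear_op H \<sigma> T" "(x, y) \<in> T"
  shows "(c \<odot>\<^bsub>H\<^esub> x, \<sigma> c \<odot>\<^bsub>H\<^esub> y) \<in> T"
proof -
  have "\<forall>c. \<forall>(x, y)\<in>T. (c \<odot>\<^bsub>H\<^esub> x, \<sigma> c \<odot>\<^bsub>H\<^esub> y) \<in> T"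
    using assms(1) unfolding semilinear_op_def by (elim conjE)
  from bspec[OF spec[OF this] assms(2)] show ?thesis by simp
qed

lemma semilinear_op_carrier:
  assumes "semilinear_op H \<sigma> T" "(x, y) \<in> T"
  shows "x \<in> carrier H" "y \<in> carrier H"
proof -
  have "T \<subseteq> carrier H \<times> carrier H"
    using assms(1) unfolding semilinear_op_def by (elim conjE)
  then show "x \<in> carrier H" "y \<in> carrier H" using assms(2) by auto
qed

context inner_product_space
begin

text \<open>The condition on \<open>\<sigma>\<close> holds for both \<open>id\<close> and
  \<open>cnj\<close>, so linear and conjugate-linear operators are treated together.\<close>

lemma semilinear_op_diff:
  assumes "semilinear_op H \<sigma> T" "(x, y) \<in> T" "(x', y') \<in> T" "\<sigma> (- 1) = - 1"
  shows "(x \<ominus> x', y \<ominus> y') \<in> T"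
proof -
  have c: "x \<in> carrier H" "y \<in> carrier H" "x' \<in> carrier H" "y' \<in> carrier H"
    using semilinear_op_carrier[OF assms(1,2)] semilinear_op_carrier[OF assms(1,3)] by simp_all
  have "((- 1) \<odot> x', (- 1) \<odot> y') \<in> T"
    using semilinear_op_smult[OF assms(1,3), of "- 1"] assms(4) by simp
  then have "(x \<oplus> (- 1) \<odot> x', y \<oplus> (- 1) \<odot> y') \<in> T"
    by (rule semilinear_op_add[OF assms(1,2)])
  then show ?thesis using c by (simp add: diff_eq_smult)
qed

text \<open>Norm equality, applied to \<open>x \<oplus> c \<odot> x'\<close> for the four scalars of
  the polarization identity, yields equality of inner products.\<close>

lemma ip_eq_of_hnorm_eq:
  assumes T: "semilinear_op H id T" and T': "semilinear_op H id T'"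
    and n: "\<And>x y z. \<lbrakk>(x, y) \<in> T; (x, z) \<in> T'\<rbrakk> \<Longrightarrow> hnorm H y = hnorm H z"
    and xy: "(x, y) \<in> T" "(x, z) \<in> T'" "(x', y') \<in> T" "(x', z') \<in> T'"
  shows "ip H y y' = ip H z z'"
proof -
  have c: "y \<in> carrier H" "y' \<in> carrier H" "z \<in> carrier H" "z' \<in> carrier H"
    using semilinear_op_carrier[OF T xy(1)] semilinear_op_carrier[OF T' xy(2)]
      semilinear_op_carrier[OF T xy(3)] semilinear_op_carrier[OF T' xy(4)] by simp_all
  have e: "hnorm H (y \<oplus> c \<odot> y') = hnorm H (z \<oplus> c \<odot> z')" for c
  proof -
    have "(c \<odot> x', c \<odot> y') \<in> T" "(c \<odot> x', c \<odot> z') \<in> T'"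
      using semilinear_op_smult[OF T xy(3), of c] semilinear_op_smult[OF T' xy(4), of c] by simp_all
    then have "(x \<oplus> c \<odot> x', y \<oplus> c \<odot> y') \<in> T" "(x \<oplus> c \<odot> x', z \<oplus> c \<odot> z') \<in> T'"
      using semilinear_op_add[OF T xy(1)] semilinear_op_add[OF T' xy(2)] by simp_all
    then show ?thesis by (rule n)
  qed
  have e1: "hnorm H (y \<oplus> y') = hnorm H (z \<oplus> z')"
    using e[of 1] c by simp
  have "4 * ip H y y' = 4 * ip H z z'"
    unfolding polarization[OF c(1,2)] polarization[OF c(3,4)] e e1 ..
  then show ?thesis by simp
qed

text \<open>By self-adjointness, \<open>(v, u) \<in> T\<close> can be tested on the graph of
  \<open>T\<close>, so the square is described by the form ip (T x) (T y) alone.\<close>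

lemma self_adjoint_relcomp_iff:
  assumes T: "positive_self_adjoint H T"
  shows "(x, u) \<in> T O T \<longleftrightarrow> u \<in> carrier H \<and> (\<exists>v. (x, v) \<in> T \<and> (\<forall>(y, w)\<in>T. ip H v w = ip H u y))"
proof -
  have adj: "op_adjoint H T = T" and sub: "T \<subseteq> carrier H \<times> carrier H"
    using T by (simp_all add: positive_self_adjoint_def semilinear_op_def)
  have *: "(v, u) \<in> T \<longleftrightarrow> u \<in> carrier H \<and> (\<forall>(y, w)\<in>T. ip H v w = ip H u y)" if "v \<in> carrier H" for v
  proof -
    have "(v, u) \<in> op_adjoint H T \<longleftrightarrow> u \<in> carrier H \<and> (\<forall>(y, w)\<in>T. ip H v w = ip H u y)"
      using that by (auto simp: op_adjoint_def)
    then show ?thesis using adj by simp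
  qed
  show ?thesis
  proof
    assume "(x, u) \<in> T O T"
    then obtain v where v: "(x, v) \<in> T" "(v, u) \<in> T" by (rule relcompE) simp
    then have "v \<in> carrier H" using sub by auto
    then show "u \<in> carrier H \<and> (\<exists>v. (x, v) \<in> T \<and> (\<forall>(y, w)\<in>T. ip H v w = ip H u y))"
      using v * by blast
  next
    assume "u \<in> carrier H \<and> (\<exists>v. (x, v) \<in> T \<and> (\<forall>(y, w)\<in>T. ip H v w = ip H u y))"
    then obtain v where v: "u \<in> carrier H" "(x, v) \<in> T" "\<forall>(y, w)\<in>T. ip H v w = ip H u y" by blast
    then have "v \<in> carrier H" using sub by auto
    then have "(v, u) \<in> T" using v * by blast
    then show "(x, u) \<in> T O T" using v(2) by (rule relcompI[rotated])
  qed
qed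

text \<open>The domain and the norms of the values fix the form in
  \<open>self_adjoint_relcomp_iff\<close>, and hence the square. This is how a second positive polar
  factor is compared with the known one.\<close>

lemma self_adjoint_square_eq:
  assumes T: "positive_self_adjoint H T" and T': "positive_self_adjoint H T'"
    and D: "Domain T = Domain T'"
    and n: "\<And>x y z. \<lbrakk>(x, y) \<in> T; (x, z) \<in> T'\<rbrakk> \<Longrightarrow> hnorm H y = hnorm H z"
  shows "T O T = T' O T'"
proof -
  have sub: "A O A \<subseteq> B O B" if A: "positive_self_adjoint H A" and B: "positive_self_adjoint H B"
    and D: "Domain A = Domain B"
    and n: "\<And>x y z. \<lbrakk>(x, y) \<in> A; (x, z) \<in> B\<rbrakk> \<Longrightarrow> hnorm H y = hnorm H z" for A B
  proof (rule subrelI)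
    have sA: "semilinear_op H id A" and sB: "semilinear_op H id B"
      using A B by (simp_all add: positive_self_adjoint_def)
    fix x u assume "(x, u) \<in> A O A"
    then obtain v where v: "(x, v) \<in> A" "u \<in> carrier H" "\<And>y w. (y, w) \<in> A \<Longrightarrow> ip H v w = ip H u y"
      unfolding self_adjoint_relcomp_iff[OF A] by blast
    have "x \<in> Domain B" using DomainI[OF v(1)] unfolding D .
    then obtain v' where v': "(x, v') \<in> B" by (rule DomainE)
    have "ip H v' w' = ip H u y" if "(y, w') \<in> B" for y w'
    proof -
      have "y \<in> Domain A" using DomainI[OF that] unfolding D .
      then obtain w where w: "(y, w) \<in> A" by (rule DomainE)
      have "ip H v w = ip H v' w'"
        by (rule ip_eq_of_hnorm_eq[OF sA sB _ v(1) v' w that]) (erule (1) n)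
      then show ?thesis using v(3)[OF w] by simp
    qed
    then show "(x, u) \<in> B O B"
      unfolding self_adjoint_relcomp_iff[OF B] using v' v(2) by blast
  qed
  show ?thesis
    by (rule equalityI; rule sub[OF T T' D] sub[OF T' T D[symmetric]])
      (erule (1) n n[symmetric])+
qed

end

section \<open>Multiplication operators on Hilbert sums\<close>

type_synonym ('i, 't) l2op = "(('i \<Rightarrow> ('t \<Rightarrow> complex) set) \<times> ('i \<Rightarrow> ('t \<Rightarrow> complex) set)) set"

definition fmul :: "('i \<Rightarrow> 't \<Rightarrow> real) \<Rightarrow> ('i \<Rightarrow> 't \<Rightarrow> complex) \<Rightarrow> 'i \<Rightarrow> 't \<Rightarrow> complex" where
  "fmul \<phi> x = (\<lambda>n z. of_real (\<phi> n z) * x n z)"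

text \<open>The domain is the maximal one, which is what makes the operator self-adjoint for
  positive \<open>\<phi>\<close>.\<close>

definition mult_op :: "('i \<Rightarrow> 't measure) \<Rightarrow> ('i \<Rightarrow> 't \<Rightarrow> real) \<Rightarrow>
    ('i, 't) l2op" where
  "mult_op M \<phi> = {(l2cls M x, l2cls M (fmul \<phi> x)) | x. x \<in> l2fam M \<and> fmul \<phi> x \<in> l2fam M}"

lemma fmul_measurable:
  assumes "\<And>n. \<phi> n \<in> borel_measurable (M n)" "x \<in> l2fam M"
  shows "fmul \<phi> x n \<in> borel_measurable (M n)"
proof -
  have [measurable]: "\<phi> n \<in> borel_measurable (M n)" "x n \<in> borel_measurable (M n)"
    using assms by (auto simp: l2fam_def)
  show ?thesis unfolding fmul_def by measurable
qed

lemma fmul_l2fam: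
  assumes "\<And>n. \<phi> n \<in> borel_measurable (M n)" "\<And>n z. \<bar>\<phi> n z\<bar> \<le> c" "x \<in> l2fam M"
  shows "fmul \<phi> x \<in> l2fam M"
  by (rule l2fam_dominated[OF assms(3) fmul_measurable[OF assms(1,3)], of c])
    (use assms(2) in \<open>auto simp: fmul_def norm_mult intro!: AE_I2 mult_right_mono\<close>)

text \<open>Lets a multiplier of no larger growth inherit the domain of \<open>\<psi>\<close>; used
  for sqrt s <= 1 + s and for s <= 1 + s^2.\<close>

lemma fmul_l2fam_le:
  assumes "\<And>n. \<phi> n \<in> borel_measurable (M n)" "\<And>n z. \<bar>\<phi> n z\<bar> \<le> c * (1 + \<bar>\<psi> n z\<bar>)"
    "x \<in> l2fam M" "fmul \<psi> x \<in> l2fam M"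
  shows "fmul \<phi> x \<in> l2fam M"
proof (rule l2fam_bound[OF assms(3,4) fmul_measurable[OF assms(1,3)]], intro AE_I2)
  fix n z
  have "cmod (fmul \<phi> x n z) \<le> c * (1 + \<bar>\<psi> n z\<bar>) * cmod (x n z)"
    unfolding fmul_def norm_mult norm_of_real by (intro mult_right_mono assms(2)) simp
  then show "cmod (fmul \<phi> x n z) \<le> c * (cmod (x n z) + cmod (fmul \<psi> x n z))"
    by (simp add: fmul_def norm_mult algebra_simps)
qed

lemma fmul_cong_AE: "(AE z in M n. x n z = y n z) \<Longrightarrow> AE z in M n. fmul \<phi> x n z = fmul \<phi> y n z"
  by (auto simp: fmul_def elim: eventually_mono)

lemma mult_op_iff:
  assumes \<phi>: "\<And>n. \<phi> n \<in> borel_measurable (M n)" and x: "x \<in> l2fam M"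
  shows "(l2cls M x, Y) \<in> mult_op M \<phi> \<longleftrightarrow> fmul \<phi> x \<in> l2fam M \<and> Y = l2cls M (fmul \<phi> x)"
proof
  assume "(l2cls M x, Y) \<in> mult_op M \<phi>"
  then obtain y where y: "l2cls M x = l2cls M y" "Y = l2cls M (fmul \<phi> y)" "fmul \<phi> y \<in> l2fam M"
    by (auto simp: mult_op_def)
  have ae: "AE z in M n. fmul \<phi> x n z = fmul \<phi> y n z" for n
    using y(1) x l2cls_eq_iff fmul_cong_AE by metis
  have "fmul \<phi> x \<in> l2fam M"
    by (rule l2fam_cong_AE[OF y(3) fmul_measurable[OF \<phi> x] ae])
  then show "fmul \<phi> x \<in> l2fam M \<and> Y = l2cls M (fmul \<phi> x)"
    unfolding y(2) using l2cls_cong_AE[where M = M, OF ae] by simp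
qed (use x in \<open>auto simp: mult_op_def\<close>)

lemma mult_op_cases:
  assumes "(X, Y) \<in> mult_op M \<phi>"
  obtains x where "x \<in> l2fam M" "fmul \<phi> x \<in> l2fam M" "X = l2cls M x" "Y = l2cls M (fmul \<phi> x)"
  using assms by (auto simp: mult_op_def)

lemma hnorm_l2sum_mono:
  assumes "x \<in> l2fam M" "y \<in> l2fam M" "\<And>n. AE z in M n. cmod (x n z) \<le> cmod (y n z)"
  shows "hnorm (l2sum M) (l2cls M x) \<le> hnorm (l2sum M) (l2cls M y)"
proof -
  interpret inner_product_space "l2sum M" by (rule inner_product_space_l2sum)
  have "ennreal ((hnorm (l2sum M) (l2cls M x))\<^sup>2) \<le> ennreal ((hnorm (l2sum M) (l2cls M y))\<^sup>2)"
    using assms by (simp add: hnorm_l2sum sqsum_mono_AE)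
  then show ?thesis using assms by (simp add: power2_le_iff_abs_le)
qed

lemma hnorm_fmul_le:
  assumes "\<And>n. \<phi> n \<in> borel_measurable (M n)" "\<And>n z. \<bar>\<phi> n z\<bar> \<le> c" "x \<in> l2fam M" "0 \<le> c"
  shows "hnorm (l2sum M) (l2cls M (fmul \<phi> x)) \<le> c * hnorm (l2sum M) (l2cls M x)"
proof -
  interpret inner_product_space "l2sum M" by (rule inner_product_space_l2sum)
  have "hnorm (l2sum M) (l2cls M (fmul \<phi> x)) \<le> hnorm (l2sum M) (l2cls M (\<lambda>n z. of_real c * x n z))"
    using assms by (intro hnorm_l2sum_mono fmul_l2fam[of \<phi> M c] l2fam_smult AE_I2)
      (auto simp: fmul_def norm_mult intro!: mult_right_mono)
  also have "\<dots> = c * hnorm (l2sum M) (l2cls M x)"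
    using assms by (simp add: smult_l2sum[symmetric] hnorm_smult)
  finally show ?thesis .
qed

lemma ip_l2sum_cong:
  assumes "x \<in> l2fam M" "y \<in> l2fam M" "x' \<in> l2fam M" "y' \<in> l2fam M"
    and "\<And>n z. cnj (x n z) * y n z = cnj (x' n z) * y' n z"
  shows "ip (l2sum M) (l2cls M x) (l2cls M y) = ip (l2sum M) (l2cls M x') (l2cls M y')"
  using assms by (simp add: ip_l2sum)

lemma l2fam_eq_0_of_ip:
  assumes "x \<in> l2fam M" "ip (l2sum M) (l2cls M x) (l2cls M x) = 0"
  shows "AE z in M n. x n z = 0"
  using assms sqsum_eq_0_iff[of x M] by (auto simp: sqsum_eq_ip enn2real_eq_0_iff l2fam_def)

lemma semilinear_mult_op:
  assumes \<phi>: "\<And>n. \<phi> n \<in> borel_measurable (M n)"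
  shows "semilinear_op (l2sum M) id (mult_op M \<phi>)"
proof (rule semilinear_opI)
  fix X Y Z assume XY: "(X, Y) \<in> mult_op M \<phi>" and XZ: "(X, Z) \<in> mult_op M \<phi>"
  from XY show "Y = Z"
  proof (rule mult_op_cases)
    fix x assume "x \<in> l2fam M" "X = l2cls M x" "Y = l2cls M (fmul \<phi> x)"
    then show "Y = Z" using XZ mult_op_iff[where M = M and \<phi> = \<phi>, OF \<phi>] by simp
  qed
next
  have "fmul \<phi> (\<lambda>n z. 0) = (\<lambda>n z. 0)" by (simp add: fmul_def)
  then show "(\<zero>\<^bsub>l2sum M\<^esub>, \<zero>\<^bsub>l2sum M\<^esub>) \<in> mult_op M \<phi>"
    by (simp add: zero_l2sum mult_op_iff[where M = M and \<phi> = \<phi>, OF \<phi>] l2fam_zero)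
next
  fix X Y X' Y' assume "(X, Y) \<in> mult_op M \<phi>" "(X', Y') \<in> mult_op M \<phi>"
  then obtain x x' where *: "x \<in> l2fam M" "fmul \<phi> x \<in> l2fam M" "X = l2cls M x" "Y = l2cls M (fmul \<phi> x)"
    "x' \<in> l2fam M" "fmul \<phi> x' \<in> l2fam M" "X' = l2cls M x'" "Y' = l2cls M (fmul \<phi> x')"
    by (elim mult_op_cases) simp
  have "fmul \<phi> (\<lambda>n z. x n z + x' n z) = (\<lambda>n z. fmul \<phi> x n z + fmul \<phi> x' n z)"
    by (simp add: fmul_def algebra_simps)
  then show "(X \<oplus>\<^bsub>l2sum M\<^esub> X', Y \<oplus>\<^bsub>l2sum M\<^esub> Y') \<in> mult_op M \<phi>"
    using * by (simp add: add_l2sum mult_op_iff[where M = M and \<phi> = \<phi>, OF \<phi>] l2fam_add)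
next
  fix c X Y assume "(X, Y) \<in> mult_op M \<phi>"
  then obtain x where *: "x \<in> l2fam M" "fmul \<phi> x \<in> l2fam M" "X = l2cls M x" "Y = l2cls M (fmul \<phi> x)"
    by (elim mult_op_cases) simp
  have "fmul \<phi> (\<lambda>n z. c * x n z) = (\<lambda>n z. c * fmul \<phi> x n z)"
    by (simp add: fmul_def algebra_simps)
  then show "(c \<odot>\<^bsub>l2sum M\<^esub> X, id c \<odot>\<^bsub>l2sum M\<^esub> Y) \<in> mult_op M \<phi>"
    using * by (simp add: smult_l2sum mult_op_iff[where M = M and \<phi> = \<phi>, OF \<phi>] l2fam_smult)
qed (auto elim!: mult_op_cases)

text \<open>Strict positivity at every point makes the multiplication injective and, by truncation
  where \<open>s\<close> is small, gives it dense range.\<close>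

locale positive_multiplier =
  fixes M :: "'i \<Rightarrow> 't measure" and s :: "'i \<Rightarrow> 't \<Rightarrow> real"
  assumes s_meas [measurable]: "s n \<in> borel_measurable (M n)" and s_pos: "0 < s n z"
begin

sublocale H: inner_product_space "l2sum M"
  by (rule inner_product_space_l2sum)

text \<open>Indicator of 1/m <= s <= m for positive \<open>m\<close>. The upper bound puts truncated
  vectors into the domain, the lower bound into the range.\<close>

definition cutoff :: "nat \<Rightarrow> 'i \<Rightarrow> 't \<Rightarrow> real" where
  "cutoff m n z = (if s n z \<le> real m \<and> 1 \<le> real m * s n z then 1 else 0)"

lemma cutoff_meas [measurable]: "cutoff m n \<in> borel_measurable (M n)"
  unfolding cutoff_def by measurable

lemma cutoff_l2fam: "x \<in> l2fam M \<Longrightarrow> fmul (cutoff m) x \<in> l2fam M"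
  by (rule fmul_l2fam[where c = 1]) (auto simp: cutoff_def)

lemma cutoff_eventually: "\<forall>\<^sub>F m in sequentially. cutoff m n z = 1"
proof -
  obtain N :: nat where N: "real N \<ge> max (s n z) (1 / s n z)" using real_arch_simple by blast
  show ?thesis
    using eventually_ge_at_top[of N]
  proof eventually_elim
    case (elim m)
    then have "real m \<ge> s n z" "real m \<ge> 1 / s n z" using N by linarith+
    then show ?case using s_pos[of n z] by (simp add: cutoff_def field_simps)
  qed
qed

text \<open>Dominated convergence on each component and once more over the index; at every point the
  truncations agree with \<open>x\<close> from some \<open>m\<close> on.\<close>

lemma cutoff_tendsto:
  assumes x: "x \<in> l2fam M"
  shows "(\<lambda>m. sqsum M (\<lambda>n z. x n z - fmul (cutoff m) x n z)) \<longlonglongrightarrow> 0"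
proof -
  have xm [measurable]: "x n \<in> borel_measurable (M n)" for n using x by (simp add: l2fam_def)
  have le: "cmod (x n z - fmul (cutoff m) x n z) \<le> cmod (x n z)" for m n z
    by (simp add: fmul_def cutoff_def)
  have le2: "ennreal ((cmod (x n z - fmul (cutoff m) x n z))\<^sup>2) \<le> ennreal ((cmod (x n z))\<^sup>2)" for m n z
    using power_mono[OF le norm_ge_zero] by (simp add: ennreal_leI)
  have fin: "(\<integral>\<^sup>+z. ennreal ((cmod (x n z))\<^sup>2) \<partial>M n) < \<infinity>" for n
    using l2fam_component[OF x, of n] by (simp add: sq_integrable_iff)
  have 1: "(\<lambda>m. \<integral>\<^sup>+z. ennreal ((cmod (x n z - fmul (cutoff m) x n z))\<^sup>2) \<partial>M n) \<longlonglongrightarrow> (\<integral>\<^sup>+z. 0 \<partial>M n)" for n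
  proof (rule nn_integral_dominated_convergence[where w = "\<lambda>z. ennreal ((cmod (x n z))\<^sup>2)"])
    show "(\<lambda>z. ennreal ((cmod (x n z - fmul (cutoff m) x n z))\<^sup>2)) \<in> borel_measurable (M n)" for m
      unfolding fmul_def by measurable
    show "AE z in M n. (\<lambda>m. ennreal ((cmod (x n z - fmul (cutoff m) x n z))\<^sup>2)) \<longlonglongrightarrow> 0"
    proof (intro AE_I2 tendsto_eventually)
      fix z
      show "\<forall>\<^sub>F m in sequentially. ennreal ((cmod (x n z - fmul (cutoff m) x n z))\<^sup>2) = 0"
        using cutoff_eventually[of n z] by eventually_elim (simp add: fmul_def)
    qed
  qed (use le2 fin in auto)
  have "(\<lambda>m. sqsum M (\<lambda>n z. x n z - fmul (cutoff m) x n z)) \<longlonglongrightarrow> (\<integral>\<^sup>+(n::'i). 0 \<partial>count_space UNIV)"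
    unfolding sqsum_def
  proof (rule nn_integral_dominated_convergence[where w = "\<lambda>n. \<integral>\<^sup>+z. ennreal ((cmod (x n z))\<^sup>2) \<partial>M n"])
    show "(\<integral>\<^sup>+n. \<integral>\<^sup>+z. ennreal ((cmod (x n z))\<^sup>2) \<partial>M n \<partial>count_space UNIV) < \<infinity>"
      using x by (simp add: l2fam_def sqsum_def)
    show "AE n in count_space UNIV. (\<lambda>m. \<integral>\<^sup>+z. ennreal ((cmod (x n z - fmul (cutoff m) x n z))\<^sup>2) \<partial>M n) \<longlonglongrightarrow> 0"
      using 1 by (simp add: AE_count_space)
  qed (auto intro!: nn_integral_mono le2)
  then show ?thesis by simp
qed

lemma hdense_of_cutoff:
  assumes "D \<subseteq> carrier (l2sum M)" "\<And>x m. x \<in> l2fam M \<Longrightarrow> l2cls M (fmul (cutoff m) x) \<in> D"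
  shows "hdense (l2sum M) D"
  unfolding hdense_def
proof (intro conjI ballI allI impI assms(1))
  fix X and e :: real assume X: "X \<in> carrier (l2sum M)" and e: "e > 0"
  obtain x where x: "x \<in> l2fam M" "X = l2cls M x" using X by (auto simp: carrier_l2sum)
  have "\<forall>\<^sub>F m in sequentially. sqsum M (\<lambda>n z. x n z - fmul (cutoff m) x n z) < ennreal (e\<^sup>2)"
    using cutoff_tendsto[OF x(1)] e by (intro order_tendstoD) auto
  then obtain m where m: "sqsum M (\<lambda>n z. x n z - fmul (cutoff m) x n z) < ennreal (e\<^sup>2)"
    by (auto simp: eventually_sequentially)
  show "\<exists>Y\<in>D. hnorm (l2sum M) (X \<ominus>\<^bsub>l2sum M\<^esub> Y) < e"
    using m x e assms(2)[OF x(1), of m]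
    by (intro bexI[of _ "l2cls M (fmul (cutoff m) x)"])
      (simp_all add: diff_l2sum cutoff_l2fam l2fam_diff hnorm_l2sum_less_iff)
qed

lemma cutoff_in_domain:
  assumes x: "x \<in> l2fam M"
  shows "(l2cls M (fmul (cutoff m) x), l2cls M (fmul s (fmul (cutoff m) x))) \<in> mult_op M s"
proof -
  have "fmul s (fmul (cutoff m) x) = fmul (\<lambda>n z. s n z * cutoff m n z) x"
    by (simp add: fmul_def mult_ac)
  moreover have "\<dots> \<in> l2fam M"
    by (rule fmul_l2fam[OF _ _ x, of _ "real m"])
      (auto simp: cutoff_def abs_of_pos[OF s_pos])
  ultimately show ?thesis using x by (simp add: mult_op_iff cutoff_l2fam s_meas)
qed

lemma hdense_domain: "hdense (l2sum M) (Domain (mult_op M s))"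
  by (rule hdense_of_cutoff) (auto elim!: mult_op_cases intro!: DomainI[OF cutoff_in_domain])

lemma hdense_range: "hdense (l2sum M) (Range (mult_op M s))"
proof (rule hdense_of_cutoff)
  fix x m assume x: "x \<in> l2fam M"
  \<comment> \<open>On the cutoff set 1/s is bounded by \<open>m\<close>, so this preimage of the
    truncated vector is square-summable.\<close>
  let ?y = "fmul (\<lambda>n z. cutoff m n z / s n z) x"
  have y: "?y \<in> l2fam M"
  proof (rule fmul_l2fam[OF _ _ x, of _ "real m"])
    show "\<bar>cutoff m n z / s n z\<bar> \<le> real m" for n z
      using s_pos[of n z] by (auto simp: cutoff_def field_simps)
  qed measurable
  have "fmul s ?y = fmul (cutoff m) x"
  proof (intro ext)
    fix n z show "fmul s ?y n z = fmul (cutoff m) x n z"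
      using s_pos[of n z] by (simp add: fmul_def)
  qed
  then have "(l2cls M ?y, l2cls M (fmul (cutoff m) x)) \<in> mult_op M s"
    using y x by (simp add: mult_op_iff s_meas cutoff_l2fam)
  then show "l2cls M (fmul (cutoff m) x) \<in> Range (mult_op M s)" by blast
qed (auto elim!: mult_op_cases)

text \<open>Writes the form of \<open>s\<close> as a squared norm: this gives positivity, and its
  vanishing forces \<open>x\<close> to vanish almost everywhere.\<close>

lemma sqrt_mult:
  assumes "x \<in> l2fam M" "fmul s x \<in> l2fam M"
  defines "w \<equiv> fmul (\<lambda>n z. sqrt (s n z)) x"
  shows "w \<in> l2fam M"
    "ip (l2sum M) (l2cls M x) (l2cls M (fmul s x)) = ip (l2sum M) (l2cls M w) (l2cls M w)"
proof -
  show w: "w \<in> l2fam M"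
    unfolding w_def
  proof (rule fmul_l2fam_le[OF _ _ assms(1,2), of _ 1])
    fix n z
    have "sqrt (s n z) \<le> sqrt ((1 + s n z)\<^sup>2)"
      using s_pos[of n z] by (intro real_sqrt_le_mono) (simp add: power2_eq_square algebra_simps)
    then show "\<bar>sqrt (s n z)\<bar> \<le> 1 * (1 + \<bar>s n z\<bar>)" using s_pos[of n z] by simp
  qed measurable
  show "ip (l2sum M) (l2cls M x) (l2cls M (fmul s x)) = ip (l2sum M) (l2cls M w) (l2cls M w)"
  proof (rule ip_l2sum_cong[OF assms(1,2) w w])
    fix n z
    have "complex_of_real (s n z) = of_real (sqrt (s n z)) * of_real (sqrt (s n z))"
      using s_pos[of n z] by (simp flip: of_real_mult)
    then show "cnj (x n z) * fmul s x n z = cnj (w n z) * w n z"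
      by (simp add: fmul_def w_def)
  qed
qed

text \<open>Symmetry is a pointwise identity; for the converse inclusion an adjoint pair is tested
  against truncated vectors.\<close>

lemma self_adjoint_mult_op: "op_adjoint (l2sum M) (mult_op M s) = mult_op M s"
proof (intro equalityI subrelI)
  fix Y W assume YW: "(Y, W) \<in> mult_op M s"
  then obtain y where y: "y \<in> l2fam M" "fmul s y \<in> l2fam M" "Y = l2cls M y" "W = l2cls M (fmul s y)"
    by (rule mult_op_cases)
  have "ip (l2sum M) Y Z = ip (l2sum M) W X" if "(X, Z) \<in> mult_op M s" for X Z
    using that
  proof (rule mult_op_cases)
    fix x assume x: "x \<in> l2fam M" "fmul s x \<in> l2fam M" "X = l2cls M x" "Z = l2cls M (fmul s x)"
    show ?thesis
      unfolding x y by (rule ip_l2sum_cong[OF y(1) x(2) y(2) x(1)]) (simp add: fmul_def)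
  qed
  then show "(Y, W) \<in> op_adjoint (l2sum M) (mult_op M s)"
    using y by (auto simp: op_adjoint_def)
next
  fix Y W assume YW: "(Y, W) \<in> op_adjoint (l2sum M) (mult_op M s)"
  then obtain y w where y: "y \<in> l2fam M" "Y = l2cls M y" and w: "w \<in> l2fam M" "W = l2cls M w"
    by (auto simp: op_adjoint_def carrier_l2sum)
  have ip: "ip (l2sum M) Y Z = ip (l2sum M) W X" if "(X, Z) \<in> mult_op M s" for X Z
    using YW that by (auto simp: op_adjoint_def)
  have ae: "AE z in M n. cutoff m n z = 1 \<longrightarrow> fmul s y n z = w n z" for m n
  proof -
    let ?c = "fmul (cutoff m)"
    define a where "a = fmul s (?c y)"
    \<comment> \<open>The test vector is the truncated discrepancy between s y and \<open>w\<close>.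
      Truncation puts it into the domain, and the adjoint relation makes it orthogonal to
      itself.\<close>
    define u where "u = (\<lambda>n z. a n z - ?c w n z)"
    have a: "a \<in> l2fam M"
      unfolding a_def using cutoff_in_domain[OF y(1)] y(1) by (simp add: mult_op_iff cutoff_l2fam s_meas)
    have u: "u \<in> l2fam M" unfolding u_def by (intro l2fam_diff a cutoff_l2fam w)
    have cu: "?c u = u" by (auto simp: fmul_def u_def a_def cutoff_def fun_eq_iff)
    have su: "(l2cls M u, l2cls M (fmul s u)) \<in> mult_op M s"
      using cutoff_in_domain[OF u, of m] unfolding cu .
    then have su2: "fmul s u \<in> l2fam M" by (simp add: mult_op_iff u s_meas)
    have "ip (l2sum M) (l2cls M a) (l2cls M u) = ip (l2sum M) Y (l2cls M (fmul s u))"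
      unfolding y(2)
      by (rule ip_l2sum_cong[OF a u y(1) su2]) (simp add: a_def u_def fmul_def cutoff_def)
    also have "\<dots> = ip (l2sum M) W (l2cls M u)" by (rule ip[OF su])
    also have "\<dots> = ip (l2sum M) (l2cls M (?c w)) (l2cls M u)"
      unfolding w(2)
      by (rule ip_l2sum_cong[OF w(1) u cutoff_l2fam[OF w(1)] u]) (simp add: a_def u_def fmul_def cutoff_def)
    finally have "ip (l2sum M) (l2cls M a \<ominus>\<^bsub>l2sum M\<^esub> l2cls M (?c w)) (l2cls M u) = 0"
      using a u w by (simp add: H.ip_diff_left cutoff_l2fam)
    then have "ip (l2sum M) (l2cls M u) (l2cls M u) = 0"
      using a w by (simp add: diff_l2sum cutoff_l2fam flip: u_def)
    then have "AE z in M n. u n z = 0" by (rule l2fam_eq_0_of_ip[OF u])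
    then show ?thesis by eventually_elim (auto simp: u_def a_def fmul_def)
  qed
  have ae': "AE z in M n. fmul s y n z = w n z" for n
  proof -
    \<comment> \<open>A single null set serves all truncation levels, as there are countably
      many.\<close>
    have "AE z in M n. \<forall>m. cutoff m n z = 1 \<longrightarrow> fmul s y n z = w n z"
      unfolding AE_all_countable using ae by blast
    then show ?thesis
    proof eventually_elim
      case (elim z)
      obtain m where "cutoff m n z = 1"
        using cutoff_eventually[of n z] by (auto simp: eventually_sequentially)
      then show ?case using elim by blast
    qed
  qed
  have sy: "fmul s y \<in> l2fam M"
    by (rule l2fam_cong_AE[OF w(1) fmul_measurable[OF s_meas y(1)] ae'])
  show "(Y, W) \<in> mult_op M s"
    unfolding y(2) w(2) using y(1) sy l2cls_cong_AE[where M = M, OF ae'] by (simp add: mult_op_iff s_meas)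
qed

lemma positive_self_adjoint_mult_op: "positive_self_adjoint (l2sum M) (mult_op M s)"
proof -
  have "ip (l2sum M) X Y \<in> \<real>\<^sub>\<ge>\<^sub>0" if "(X, Y) \<in> mult_op M s" for X Y
    using that by (rule mult_op_cases) (simp add: sqrt_mult H.ip_nonneg)
  then show ?thesis
    unfolding positive_self_adjoint_def
    by (intro conjI self_adjoint_mult_op hdense_domain semilinear_mult_op s_meas) auto
qed

end

section \<open>Multipliers commuting with an unbounded operator\<close>

lemma semilinear_op_single:
  assumes "semilinear_op H \<sigma> T" "(x, y) \<in> T" "(x, z) \<in> T"
  shows "y = z"
proof -
  have "single_valued T"
    using assms(1) unfolding semilinear_op_def by (elim conjE)
  then show ?thesis using assms(2,3) by (rule single_valuedD)
qed

text \<open>Bounded real multiplications that preserve the graph of \<open>T\<close>, the usual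
  meaning of commuting with an unbounded operator. Linearity of \<open>T\<close> makes this set an
  algebra, and closedness makes it stable under uniform limits.\<close>

definition commutant :: "('i \<Rightarrow> 't measure) \<Rightarrow>
    ('i, 't) l2op \<Rightarrow> ('i \<Rightarrow> 't \<Rightarrow> real) set" where
  "commutant M T = {\<phi>. (\<forall>n. \<phi> n \<in> borel_measurable (M n)) \<and> (\<exists>c. \<forall>n z. \<bar>\<phi> n z\<bar> \<le> c) \<and>
     (\<forall>x\<in>l2fam M. \<forall>y\<in>l2fam M. (l2cls M x, l2cls M y) \<in> T \<longrightarrow>
        (l2cls M (fmul \<phi> x), l2cls M (fmul \<phi> y)) \<in> T)}"

lemma commutantI:
  assumes "\<And>n. \<phi> n \<in> borel_measurable (M n)" "\<And>n z. \<bar>\<phi> n z\<bar> \<le> c"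
    "\<And>x y. \<lbrakk>x \<in> l2fam M; y \<in> l2fam M; (l2cls M x, l2cls M y) \<in> T\<rbrakk> \<Longrightarrow>
        (l2cls M (fmul \<phi> x), l2cls M (fmul \<phi> y)) \<in> T"
  shows "\<phi> \<in> commutant M T"
  unfolding commutant_def mem_Collect_eq by (intro conjI allI exI[of _ c] ballI impI assms)

lemma commutantD:
  assumes "\<phi> \<in> commutant M T"
  shows "\<phi> n \<in> borel_measurable (M n)" "\<exists>c. \<forall>n z. \<bar>\<phi> n z\<bar> \<le> c"
    "\<lbrakk>x \<in> l2fam M; y \<in> l2fam M; (l2cls M x, l2cls M y) \<in> T\<rbrakk> \<Longrightarrow>
        (l2cls M (fmul \<phi> x), l2cls M (fmul \<phi> y)) \<in> T"
  using assms by (simp_all add: commutant_def)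

lemma commutant_l2fam:
  assumes "\<phi> \<in> commutant M T" "x \<in> l2fam M"
  shows "fmul \<phi> x \<in> l2fam M"
proof -
  obtain c where "\<And>n z. \<bar>\<phi> n z\<bar> \<le> c" using commutantD(2)[OF assms(1)] by auto
  then show ?thesis by (rule fmul_l2fam[OF commutantD(1)[OF assms(1)] _ assms(2)])
qed

context
  fixes M :: "'i \<Rightarrow> 't measure" and T
  assumes T: "semilinear_op (l2sum M) id T"
begin

lemma commutant_const: "(\<lambda>n z. c) \<in> commutant M T"
proof (rule commutantI)
  fix x y assume "x \<in> l2fam M" "y \<in> l2fam M" "(l2cls M x, l2cls M y) \<in> T"
  then show "(l2cls M (fmul (\<lambda>n z. c) x), l2cls M (fmul (\<lambda>n z. c) y)) \<in> T"
    using semilinear_op_smult[OF T, of "l2cls M x" "l2cls M y" "of_real c"]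
    by (simp add: smult_l2sum fmul_def)
qed auto

lemma commutant_add:
  assumes \<phi>: "\<phi> \<in> commutant M T" and \<psi>: "\<psi> \<in> commutant M T"
  shows "(\<lambda>n z. \<phi> n z + \<psi> n z) \<in> commutant M T"
proof -
  obtain c d where b: "\<And>n z. \<bar>\<phi> n z\<bar> \<le> c" "\<And>n z. \<bar>\<psi> n z\<bar> \<le> d"
    using commutantD(2)[OF \<phi>] commutantD(2)[OF \<psi>] by auto
  show ?thesis
  proof (rule commutantI)
    show "(\<lambda>z. \<phi> n z + \<psi> n z) \<in> borel_measurable (M n)" for n
      by (rule borel_measurable_add[OF commutantD(1)[OF \<phi>] commutantD(1)[OF \<psi>]])
    show "\<bar>\<phi> n z + \<psi> n z\<bar> \<le> c + d" for n z
      by (rule order_trans[OF abs_triangle_ineq add_mono[OF b]])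
    fix x y assume x: "x \<in> l2fam M" and y: "y \<in> l2fam M" and xy: "(l2cls M x, l2cls M y) \<in> T"
    have e: "fmul (\<lambda>n z. \<phi> n z + \<psi> n z) w = (\<lambda>n z. fmul \<phi> w n z + fmul \<psi> w n z)" for w
      by (simp add: fmul_def algebra_simps)
    show "(l2cls M (fmul (\<lambda>n z. \<phi> n z + \<psi> n z) x), l2cls M (fmul (\<lambda>n z. \<phi> n z + \<psi> n z) y)) \<in> T"
      using semilinear_op_add[OF T commutantD(3)[OF \<phi> x y xy] commutantD(3)[OF \<psi> x y xy]]
      by (simp add: e add_l2sum commutant_l2fam[OF \<phi>] commutant_l2fam[OF \<psi>] x y)
  qed
qed

lemma commutant_mult:
  assumes \<phi>: "\<phi> \<in> commutant M T" and \<psi>: "\<psi> \<in> commutant M T"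
  shows "(\<lambda>n z. \<phi> n z * \<psi> n z) \<in> commutant M T"
proof -
  obtain c d where b: "\<And>n z. \<bar>\<phi> n z\<bar> \<le> c" "\<And>n z. \<bar>\<psi> n z\<bar> \<le> d"
    using commutantD(2)[OF \<phi>] commutantD(2)[OF \<psi>] by auto
  show ?thesis
  proof (rule commutantI)
    show "(\<lambda>z. \<phi> n z * \<psi> n z) \<in> borel_measurable (M n)" for n
      by (rule borel_measurable_times[OF commutantD(1)[OF \<phi>] commutantD(1)[OF \<psi>]])
    show "\<bar>\<phi> n z * \<psi> n z\<bar> \<le> c * d" for n z
      unfolding abs_mult using b(1)[of n z] by (intro mult_mono b) auto
    fix x y assume x: "x \<in> l2fam M" and y: "y \<in> l2fam M" and xy: "(l2cls M x, l2cls M y) \<in> T"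
    have e: "fmul (\<lambda>n z. \<phi> n z * \<psi> n z) w = fmul \<phi> (fmul \<psi> w)" for w
      by (simp add: fmul_def mult_ac)
    show "(l2cls M (fmul (\<lambda>n z. \<phi> n z * \<psi> n z) x), l2cls M (fmul (\<lambda>n z. \<phi> n z * \<psi> n z) y)) \<in> T"
      unfolding e
      by (intro commutantD(3)[OF \<phi>] commutantD(3)[OF \<psi>] commutant_l2fam[OF \<psi>] x y xy)
  qed
qed

lemma commutant_power: "\<phi> \<in> commutant M T \<Longrightarrow> (\<lambda>n z. \<phi> n z ^ k) \<in> commutant M T"
  by (induction k) (simp_all add: commutant_const commutant_mult)

lemma commutant_sum:
  "\<lbrakk>finite I; \<And>i. i \<in> I \<Longrightarrow> \<phi> i \<in> commutant M T\<rbrakk> \<Longrightarrow> (\<lambda>n z. \<Sum>i\<in>I. \<phi> i n z) \<in> commutant M T"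
  by (induction I rule: finite_induct) (simp_all add: commutant_const commutant_add)

lemma commutant_uniform_limit:
  assumes cl: "graph_closure (l2sum M) T \<subseteq> T"
    and \<phi>: "\<And>n. \<phi> n \<in> borel_measurable (M n)" "\<And>n z. \<bar>\<phi> n z\<bar> \<le> c"
    and lim: "\<And>e. e > 0 \<Longrightarrow> \<exists>\<psi>\<in>commutant M T. \<forall>n z. \<bar>\<phi> n z - \<psi> n z\<bar> \<le> e"
  shows "\<phi> \<in> commutant M T"
proof (rule commutantI[OF \<phi>])
  interpret inner_product_space "l2sum M" by (rule inner_product_space_l2sum)
  fix x y assume x: "x \<in> l2fam M" and y: "y \<in> l2fam M" and xy: "(l2cls M x, l2cls M y) \<in> T"
  have "\<exists>(a, b)\<in>T. hnorm (l2sum M) (l2cls M (fmul \<phi> x) \<ominus>\<^bsub>l2sum M\<^esub> a) < e \<and>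
      hnorm (l2sum M) (l2cls M (fmul \<phi> y) \<ominus>\<^bsub>l2sum M\<^esub> b) < e" if e: "e > 0" for e
  proof -
    \<comment> \<open>\<open>K\<close> strictly exceeds both norms, so one uniform error
      \<open>e / K\<close> serves both entries of the graph pair.\<close>
    define K where "K = hnorm (l2sum M) (l2cls M x) + hnorm (l2sum M) (l2cls M y) + 1"
    have nn: "0 \<le> hnorm (l2sum M) (l2cls M x)" "0 \<le> hnorm (l2sum M) (l2cls M y)" using x y by simp_all
    then have K: "K > 0" by (simp add: K_def)
    obtain \<psi> where \<psi>: "\<psi> \<in> commutant M T" "\<And>n z. \<bar>\<phi> n z - \<psi> n z\<bar> \<le> e / K"
      using lim[of "e / K"] e K by auto
    have est: "hnorm (l2sum M) (l2cls M (fmul \<phi> w) \<ominus>\<^bsub>l2sum M\<^esub> l2cls M (fmul \<psi> w)) < e"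
      if w: "w \<in> l2fam M" and le: "hnorm (l2sum M) (l2cls M w) < K" for w
    proof -
      have eq: "l2cls M (fmul \<phi> w) \<ominus>\<^bsub>l2sum M\<^esub> l2cls M (fmul \<psi> w) = l2cls M (fmul (\<lambda>n z. \<phi> n z - \<psi> n z) w)"
        using w by (simp add: diff_l2sum fmul_l2fam[OF \<phi>] commutant_l2fam[OF \<psi>(1)])
          (simp add: fmul_def algebra_simps)
      have "hnorm (l2sum M) (l2cls M (fmul (\<lambda>n z. \<phi> n z - \<psi> n z) w)) \<le> e / K * hnorm (l2sum M) (l2cls M w)"
        using \<psi>(2) w e K
        by (intro hnorm_fmul_le borel_measurable_diff \<phi> commutantD(1)[OF \<psi>(1)]) auto
      also have "\<dots> < e / K * K" using le e K by (intro mult_strict_left_mono) auto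
      finally show ?thesis using K unfolding eq by simp
    qed
    show ?thesis
      using est[OF x] est[OF y] nn
      by (intro bexI[OF _ commutantD(3)[OF \<psi>(1) x y xy]]) (simp add: K_def)
  qed
  then have "(l2cls M (fmul \<phi> x), l2cls M (fmul \<phi> y)) \<in> graph_closure (l2sum M) T"
    unfolding graph_closure_def by (simp add: fmul_l2fam[OF \<phi>] x y)
  then show "(l2cls M (fmul \<phi> x), l2cls M (fmul \<phi> y)) \<in> T" using cl by (rule subsetD[rotated])
qed

text \<open>Continuous functional calculus for one multiplier with values in the unit interval: the
  Bernstein polynomials of \<open>f\<close> lie in the algebra generated by \<open>r\<close> and the
  constants.\<close>

lemma commutant_continuous:
  fixes f :: "real \<Rightarrow> real"
  assumes cl: "graph_closure (l2sum M) T \<subseteq> T"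
    and r: "r \<in> commutant M T" "\<And>n z. r n z \<in> {0..1}" and f: "continuous_on UNIV f"
  shows "(\<lambda>n z. f (r n z)) \<in> commutant M T"
proof -
  have fc: "continuous_on {0..1} f" using f continuous_on_subset by blast
  have "compact (f ` {0..1})" by (rule compact_continuous_image[OF fc]) simp
  then obtain B where "\<forall>y\<in>f ` {0..1}. norm y \<le> B"
    using compact_imp_bounded[of "f ` {0..1}"] unfolding bounded_iff by blast
  then have B: "\<bar>f t\<bar> \<le> B" if "t \<in> {0..1}" for t
    using that by auto
  show ?thesis
  proof (rule commutant_uniform_limit[OF cl])
    show "(\<lambda>z. f (r n z)) \<in> borel_measurable (M n)" for n
      by (rule borel_measurable_continuous_on[OF f commutantD(1)[OF r(1)]])
    show "\<bar>f (r n z)\<bar> \<le> B" for n z using B r(2) by blast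
    fix e :: real assume "e > 0"
    from Bernstein_Weierstrass[OF fc this] obtain N where
      N: "\<And>x. x \<in> {0..1} \<Longrightarrow> \<bar>f x - (\<Sum>k\<le>N. f (k / N) * Bernstein N k x)\<bar> < e" by blast
    \<comment> \<open>The Bernstein polynomial with its factor 1 - r written as a sum, so that the
      closure rules of \<open>commutant\<close> apply.\<close>
    let ?\<psi> = "\<lambda>n z. \<Sum>k\<le>N. f (k / N) * (real (N choose k) * r n z ^ k * (1 + (- 1) * r n z) ^ (N - k))"
    have "?\<psi> \<in> commutant M T"
      by (intro commutant_sum commutant_mult commutant_const commutant_power commutant_add r(1)) simp
    moreover have "\<bar>f (r n z) - ?\<psi> n z\<bar> \<le> e" for n z
      using N[OF r(2)[of n z]] by (simp add: Bernstein_def)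
    ultimately show "\<exists>\<psi>\<in>commutant M T. \<forall>n z. \<bar>f (r n z) - \<psi> n z\<bar> \<le> e"
      by (intro bexI[of _ ?\<psi>]) simp_all
  qed
qed

end

section \<open>Comparison of an arbitrary square root with the multiplier\<close>

context positive_multiplier
begin

text \<open>The natural domain of the composition is no smaller than that of s^2, since s <= 1 + s^2
  controls the intermediate vector.\<close>

lemma mult_op_square:
  assumes x: "x \<in> l2fam M" and s2: "fmul (\<lambda>n z. (s n z)\<^sup>2) x \<in> l2fam M"
  shows "(l2cls M x, l2cls M (fmul (\<lambda>n z. (s n z)\<^sup>2) x)) \<in> mult_op M s O mult_op M s"
proof -
  have "s n z \<le> 1 + (s n z)\<^sup>2" for n z
    using sum_squares_bound[of "s n z" 1] s_pos[of n z] by simp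
  then have s1: "fmul s x \<in> l2fam M"
    using s_pos by (intro fmul_l2fam_le[OF s_meas _ x s2, of 1]) (simp add: abs_of_pos)
  have e: "fmul s (fmul s x) = fmul (\<lambda>n z. (s n z)\<^sup>2) x"
    by (simp add: fmul_def power2_eq_square mult_ac)
  have "(l2cls M x, l2cls M (fmul s x)) \<in> mult_op M s"
    using x s1 by (simp add: mult_op_iff s_meas)
  moreover have "(l2cls M (fmul s x), l2cls M (fmul (\<lambda>n z. (s n z)\<^sup>2) x)) \<in> mult_op M s"
    using s1 s2 by (simp add: mult_op_iff s_meas e)
  ultimately show ?thesis by (rule relcompI)
qed

lemma mult_op_squareD:
  assumes x: "x \<in> l2fam M" and u: "(l2cls M x, U) \<in> mult_op M s O mult_op M s"
  shows "fmul (\<lambda>n z. (s n z)\<^sup>2) x \<in> l2fam M" "U = l2cls M (fmul (\<lambda>n z. (s n z)\<^sup>2) x)"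
proof -
  have e: "fmul s (fmul s x) = fmul (\<lambda>n z. (s n z)\<^sup>2) x"
    by (simp add: fmul_def power2_eq_square mult_ac)
  obtain V where V: "(l2cls M x, V) \<in> mult_op M s" "(V, U) \<in> mult_op M s" using u by (rule relcompE) simp
  have 1: "fmul s x \<in> l2fam M" "V = l2cls M (fmul s x)" using V(1) x by (simp_all add: mult_op_iff s_meas)
  show "fmul (\<lambda>n z. (s n z)\<^sup>2) x \<in> l2fam M" "U = l2cls M (fmul (\<lambda>n z. (s n z)\<^sup>2) x)"
    using V(2) 1 by (simp_all add: mult_op_iff s_meas e)
qed

text \<open>Symbol of the inverse of 1 + s^2. It takes values in (0, 1] and is determined by the
  square, which is what a second square root shares with \<open>s\<close>.\<close>

definition resolvent :: "'i \<Rightarrow> 't \<Rightarrow> real" where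
  "resolvent n z = 1 / (1 + (s n z)\<^sup>2)"

lemma resolvent_meas [measurable]: "resolvent n \<in> borel_measurable (M n)"
  unfolding resolvent_def by measurable

lemma resolvent_pos: "0 < resolvent n z"
  by (simp add: resolvent_def add_pos_nonneg)

lemma resolvent_le_1: "resolvent n z \<le> 1"
  by (simp add: resolvent_def divide_le_eq_1_pos add_pos_nonneg)

lemma resolvent_l2fam: "x \<in> l2fam M \<Longrightarrow> fmul resolvent x \<in> l2fam M"
  by (rule fmul_l2fam[where c = 1])
    (use resolvent_le_1 in \<open>simp_all add: abs_of_pos[OF resolvent_pos]\<close>)

lemma square_resolvent: "(s n z)\<^sup>2 * resolvent n z = 1 - resolvent n z"
proof -
  have "1 + (s n z)\<^sup>2 \<noteq> 0" by (smt (verit) zero_le_power2)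
  then show ?thesis by (simp add: resolvent_def field_simps)
qed

lemma square_fmul_resolvent:
  "fmul (\<lambda>n z. (s n z)\<^sup>2) (fmul resolvent x) = (\<lambda>n z. x n z - fmul resolvent x n z)"
proof (intro ext)
  fix n z
  have "complex_of_real ((s n z)\<^sup>2 * resolvent n z) = of_real (1 - resolvent n z)"
    by (simp only: square_resolvent)
  from arg_cong[OF this, of "\<lambda>t. t * x n z"]
  show "fmul (\<lambda>n z. (s n z)\<^sup>2) (fmul resolvent x) n z = x n z - fmul resolvent x n z"
    by (simp add: fmul_def algebra_simps)
qed

context
  fixes T
  assumes T: "positive_self_adjoint (l2sum M) T"
    and sq: "T O T = mult_op M s O mult_op M s"
    and dom: "Domain T = Domain (mult_op M s)"
begin

lemma T_semilinear: "semilinear_op (l2sum M) id T"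
  using T by (simp add: positive_self_adjoint_def)

lemma T_closed: "graph_closure (l2sum M) T \<subseteq> T"
proof (rule H.op_adjoint_closed)
  show "T \<subseteq> carrier (l2sum M) \<times> carrier (l2sum M)"
    using semilinear_op_carrier[OF T_semilinear] by auto
  show "op_adjoint (l2sum M) T = T" using T by (simp add: positive_self_adjoint_def)
qed

lemma T_diff:
  "\<lbrakk>x \<in> l2fam M; y \<in> l2fam M; x' \<in> l2fam M; y' \<in> l2fam M; (l2cls M x, l2cls M y) \<in> T;
    (l2cls M x', l2cls M y') \<in> T\<rbrakk> \<Longrightarrow>
    (l2cls M (\<lambda>n z. x n z - x' n z), l2cls M (\<lambda>n z. y n z - y' n z)) \<in> T"
  using H.semilinear_op_diff[OF T_semilinear, of "l2cls M x" "l2cls M y" "l2cls M x'" "l2cls M y'"]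
  by (simp add: diff_l2sum)

lemma T_squareD:
  assumes "x \<in> l2fam M" "(l2cls M x, Y) \<in> T" "(Y, U) \<in> T"
  shows "U = l2cls M (fmul (\<lambda>n z. (s n z)\<^sup>2) x)"
  by (rule mult_op_squareD(2)[OF assms(1)]) (use relcompI[OF assms(2,3)] sq in simp)

text \<open>The resolvent R maps into the domain of s^2, which is T^2, and there T^2 R x = x - R x;
  \<open>v\<close> is the intermediate vector T R x.\<close>

lemma T_resolvent_square:
  assumes "x \<in> l2fam M"
  obtains v where "v \<in> l2fam M" "(l2cls M (fmul resolvent x), l2cls M v) \<in> T"
    "(l2cls M v, l2cls M (\<lambda>n z. x n z - fmul resolvent x n z)) \<in> T"
proof -
  have "(l2cls M (fmul resolvent x), l2cls M (\<lambda>n z. x n z - fmul resolvent x n z)) \<in> T O T"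
    unfolding sq using mult_op_square[OF resolvent_l2fam[OF assms]] assms
    by (simp add: square_fmul_resolvent l2fam_diff resolvent_l2fam)
  then obtain V where V: "(l2cls M (fmul resolvent x), V) \<in> T"
      "(V, l2cls M (\<lambda>n z. x n z - fmul resolvent x n z)) \<in> T"
    by (rule relcompE) simp
  obtain v where "v \<in> l2fam M" "V = l2cls M v"
    using semilinear_op_carrier(2)[OF T_semilinear V(1)] by (auto simp: carrier_l2sum)
  then show ?thesis using V that by simp
qed

text \<open>A square root commutes with the resolvent R of its square: \<open>v\<close> = T R x
  turns out to be R T x.\<close>

lemma resolvent_commutant: "resolvent \<in> commutant M T"
proof (rule commutantI[OF resolvent_meas])
  show "\<bar>resolvent n z\<bar> \<le> 1" for n z
    using resolvent_le_1 by (simp add: abs_of_pos[OF resolvent_pos])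
  fix x y assume x: "x \<in> l2fam M" and y: "y \<in> l2fam M" and xy: "(l2cls M x, l2cls M y) \<in> T"
  obtain v where v: "v \<in> l2fam M" "(l2cls M (fmul resolvent x), l2cls M v) \<in> T"
    "(l2cls M v, l2cls M (\<lambda>n z. x n z - fmul resolvent x n z)) \<in> T"
    using T_resolvent_square[OF x] .
  \<comment> \<open>\<open>T\<close> sends x - R x, which is T v, to y - v. Hence s^2 v = T^2 v = y
    - v, and solving (1 + s^2) v = y pointwise gives v = R y.\<close>
  have "(l2cls M (\<lambda>n z. x n z - fmul resolvent x n z), l2cls M (\<lambda>n z. y n z - v n z)) \<in> T"
    by (rule T_diff[OF x y resolvent_l2fam[OF x] v(1) xy v(2)])
  from T_squareD[OF v(1,3) this]
  have "AE z in M n. y n z - v n z = fmul (\<lambda>n z. (s n z)\<^sup>2) v n z" for n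
    using l2cls_eq_iff[OF l2fam_diff[OF y v(1)]] by blast
  then have "AE z in M n. v n z = fmul resolvent y n z" for n
  proof eventually_elim
    case (elim z)
    have "1 + (s n z)\<^sup>2 \<noteq> 0" by (smt (verit) zero_le_power2)
    then have nz: "1 + (complex_of_real (s n z))\<^sup>2 \<noteq> 0"
      by (metis of_real_1 of_real_add of_real_eq_0_iff of_real_power)
    have "y n z = (1 + (complex_of_real (s n z))\<^sup>2) * v n z"
      using elim by (simp add: fmul_def algebra_simps)
    then show ?case using nz by (simp add: fmul_def resolvent_def)
  qed
  then have "l2cls M v = l2cls M (fmul resolvent y)" by (rule l2cls_cong_AE)
  then show "(l2cls M (fmul resolvent x), l2cls M (fmul resolvent y)) \<in> T" using v(2) by simp
qed

text \<open>With r the resolvent symbol, s r is the square root of r (1 - r), hence a continuous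
  function of r.\<close>

lemma sqrt_resolvent_commutant: "(\<lambda>n z. s n z * resolvent n z) \<in> commutant M T"
proof -
  have "s n z * resolvent n z = sqrt (resolvent n z * (1 - resolvent n z))" for n z
  proof (rule real_sqrt_unique[symmetric])
    show "(s n z * resolvent n z)\<^sup>2 = resolvent n z * (1 - resolvent n z)"
      unfolding square_resolvent[symmetric] by (simp add: power2_eq_square)
    show "0 \<le> s n z * resolvent n z"
      using s_pos resolvent_pos by (simp add: less_imp_le)
  qed
  \<comment> \<open>\<open>sqrt\<close> is extended to negative arguments as an odd continuous
    function, so the function is continuous on \<open>UNIV\<close>, also where t (1 - t) is
    negative.\<close>
  moreover have "(\<lambda>n z. (\<lambda>t. sqrt (t * (1 - t))) (resolvent n z)) \<in> commutant M T"
    by (rule commutant_continuous[OF T_semilinear T_closed resolvent_commutant])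
      (use resolvent_pos resolvent_le_1 in \<open>auto intro!: continuous_intros less_imp_le\<close>)
  ultimately show ?thesis by simp
qed

text \<open>With \<open>R\<close> and \<open>Q\<close> the multiplications by \<open>1/(1 + s\<^sup>2)\<close> and \<open>s/(1 + s\<^sup>2)\<close>, the vector
  \<open>d = T R x - Q x\<close> satisfies \<open>T d = - s d\<close>, which forces \<open>d = 0\<close> by positivity.\<close>

lemma T_subset: "T \<subseteq> mult_op M s"
proof (rule subrelI)
  fix X Y assume XY: "(X, Y) \<in> T"
  obtain x y where x: "x \<in> l2fam M" "X = l2cls M x" and y: "y \<in> l2fam M" "Y = l2cls M y"
    using semilinear_op_carrier[OF T_semilinear XY] by (auto simp: carrier_l2sum)
  have xy: "(l2cls M x, l2cls M y) \<in> T" using XY x y by simp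
  have "X \<in> Domain (mult_op M s)" using DomainI[OF XY] unfolding dom .
  then have sx: "fmul s x \<in> l2fam M" by (auto simp: x mult_op_iff s_meas x(1))
  let ?q = "fmul (\<lambda>n z. s n z * resolvent n z)" and ?r = "fmul resolvent"
  define d where "d = (\<lambda>n z. ?r y n z - ?q x n z)"
  \<comment> \<open>The value of T d: \<open>T\<close> sends R y = T R x to x - R x, and Q x to Q
    y.\<close>
  define d' where "d' = (\<lambda>n z. (x n z - ?r x n z) - ?q y n z)"
  have r: "?r w \<in> l2fam M" if "w \<in> l2fam M" for w using resolvent_l2fam that .
  have q: "?q w \<in> l2fam M" if "w \<in> l2fam M" for w
    using commutant_l2fam[OF sqrt_resolvent_commutant that] .
  have d: "d \<in> l2fam M" unfolding d_def by (intro l2fam_diff r q x y)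
  have d': "d' \<in> l2fam M" unfolding d'_def by (intro l2fam_diff r q x y)
  obtain v where v: "v \<in> l2fam M" "(l2cls M (?r x), l2cls M v) \<in> T"
    "(l2cls M v, l2cls M (\<lambda>n z. x n z - ?r x n z)) \<in> T"
    using T_resolvent_square[OF x(1)] .
  have "(l2cls M (?r x), l2cls M (?r y)) \<in> T"
    by (rule commutantD(3)[OF resolvent_commutant x(1) y(1) xy])
  then have "l2cls M v = l2cls M (?r y)" by (rule semilinear_op_single[OF T_semilinear v(2)])
  then have 1: "(l2cls M (?r y), l2cls M (\<lambda>n z. x n z - ?r x n z)) \<in> T" using v(3) by simp
  have 2: "(l2cls M (?q x), l2cls M (?q y)) \<in> T"
    by (rule commutantD(3)[OF sqrt_resolvent_commutant x(1) y(1) xy])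
  have Td: "(l2cls M d, l2cls M d') \<in> T"
    unfolding d_def d'_def by (intro T_diff l2fam_diff r q x(1) y(1) 1 2)
  \<comment> \<open>Pointwise s R = Q and s Q = 1 - R, so s d = Q y - (x - R x).\<close>
  have sd: "fmul s d = (\<lambda>n z. (- 1) * d' n z)"
  proof (intro ext)
    fix n z
    have "complex_of_real ((s n z)\<^sup>2 * resolvent n z) = of_real (1 - resolvent n z)"
      by (simp only: square_resolvent)
    from arg_cong[OF this, of "\<lambda>t. t * x n z"]
    show "fmul s d n z = (- 1) * d' n z"
      by (simp add: fmul_def d_def d'_def algebra_simps power2_eq_square)
  qed
  have sd2: "fmul s d \<in> l2fam M" unfolding sd by (rule l2fam_smult[OF d'])
  let ?w = "fmul (\<lambda>n z. sqrt (s n z)) d"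
  have w: "?w \<in> l2fam M" by (rule sqrt_mult(1)[OF d sd2])
  have pos: "ip (l2sum M) (l2cls M d) (l2cls M d') \<in> \<real>\<^sub>\<ge>\<^sub>0"
    using T Td unfolding positive_self_adjoint_def by blast
  have neg: "ip (l2sum M) (l2cls M ?w) (l2cls M ?w) = - ip (l2sum M) (l2cls M d) (l2cls M d')"
    unfolding sqrt_mult(2)[OF d sd2, symmetric] sd smult_l2sum[OF d', symmetric]
    using d d' by (simp add: H.ip_smult_right)
  \<comment> \<open>A squared norm that is minus a nonnegative number vanishes.\<close>
  have "ip (l2sum M) (l2cls M ?w) (l2cls M ?w) = 0"
    using pos H.ip_nonneg[OF l2cls_in_carrier[OF w]] unfolding neg
    by (auto simp: complex_nonneg_Reals_iff complex_eq_iff)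
  then have "AE z in M n. ?w n z = 0" for n by (rule l2fam_eq_0_of_ip[OF w])
  then have ae: "AE z in M n. fmul s x n z = y n z" for n
  proof eventually_elim
    case (elim z)
    then have "d n z = 0" using s_pos[of n z] by (simp add: fmul_def)
    \<comment> \<open>\<open>d\<close> is r (y - s x) with the positive factor r =
      \<open>resolvent n z\<close>.\<close>
    then show ?case using resolvent_pos[of n z] by (simp add: d_def fmul_def)
  qed
  have "l2cls M y = l2cls M (fmul s x)" using l2cls_cong_AE[where M = M, OF ae] by simp
  then show "(X, Y) \<in> mult_op M s"
    using x y sx by (simp add: mult_op_iff s_meas)
qed

end

text \<open>The norm condition yields equality of the squares and thereby an inclusion of graphs;
  equal domains and single-valuedness upgrade it to equality.\<close>

lemma positive_sqrt_unique:
  assumes T: "positive_self_adjoint (l2sum M) T" and D: "Domain T = Domain (mult_op M s)"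
    and n: "\<And>x y z. \<lbrakk>(x, y) \<in> T; (x, z) \<in> mult_op M s\<rbrakk> \<Longrightarrow>
      hnorm (l2sum M) y = hnorm (l2sum M) z"
  shows "T = mult_op M s"
proof
  have sq: "T O T = mult_op M s O mult_op M s"
    by (rule H.self_adjoint_square_eq[OF T positive_self_adjoint_mult_op D]) (erule (1) n)
  show sub: "T \<subseteq> mult_op M s" by (rule T_subset[OF T sq D])
  show "mult_op M s \<subseteq> T"
  proof (rule subrelI)
    fix X Z assume XZ: "(X, Z) \<in> mult_op M s"
    have "X \<in> Domain T" using DomainI[OF XZ] unfolding D .
    then obtain Y where Y: "(X, Y) \<in> T" by (rule DomainE)
    have "(X, Y) \<in> mult_op M s" using Y sub by (rule subsetD[rotated])
    then have "Y = Z" using XZ by (rule semilinear_op_single[OF semilinear_mult_op[OF s_meas]])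
    then show "(X, Z) \<in> T" using Y by simp
  qed
qed

end

section \<open>The polar decomposition of the Tomita operator\<close>

lemma ennreal_square_add_le:
  assumes "0 \<le> a" "a \<le> b + c" "0 \<le> b" "0 \<le> c"
  shows "ennreal (a\<^sup>2) \<le> 2 * ennreal (b\<^sup>2) + 2 * ennreal (c\<^sup>2)"
proof -
  have "a\<^sup>2 \<le> (b + c)\<^sup>2" using assms by (intro power_mono) auto
  also have "\<dots> \<le> 2 * b\<^sup>2 + 2 * c\<^sup>2"
    using sum_squares_bound[of b c] by (simp add: power2_sum algebra_simps)
  finally have "ennreal (a\<^sup>2) \<le> ennreal (2 * b\<^sup>2 + 2 * c\<^sup>2)" by (rule ennreal_leI)
  then show ?thesis by (simp add: ennreal_mult)
qed

text \<open>Continuity of isometries: if \<open>v\<close> in \<open>D\<close> is close to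
  \<open>u\<close>, both images of \<open>u\<close> are close to the common image of
  \<open>v\<close>.\<close>

lemma (in inner_product_space) isometry_subset:
  assumes J: "semilinear_op H \<sigma> J" and J': "semilinear_op H \<sigma> J'" and \<sigma>: "\<sigma> (- 1) = - 1"
    and iso: "\<And>x y. (x, y) \<in> J \<Longrightarrow> hnorm H y = hnorm H x"
    and iso': "\<And>x y. (x, y) \<in> J' \<Longrightarrow> hnorm H y = hnorm H x"
    and dom: "Domain J = carrier H" "Domain J' = carrier H"
    and D: "hdense H D" "\<And>x y. \<lbrakk>x \<in> D; (x, y) \<in> J\<rbrakk> \<Longrightarrow> (x, y) \<in> J'"
  shows "J \<subseteq> J'"
proof (rule subrelI)
  fix u p assume up: "(u, p) \<in> J"
  then have uc: "u \<in> carrier H" and pc: "p \<in> carrier H" by (rule semilinear_op_carrier[OF J])+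
  then have "u \<in> Domain J'" by (simp only: dom)
  then obtain p' where up': "(u, p') \<in> J'" by (rule DomainE)
  then have pc': "p' \<in> carrier H" by (rule semilinear_op_carrier[OF J'])
  have "hnorm H (p \<ominus> p') \<le> 0 + e" if e: "e > 0" for e
  proof -
    obtain v where v: "v \<in> D" "hnorm H (u \<ominus> v) < e / 2"
      using D(1) uc e unfolding hdense_def by (meson half_gt_zero)
    have "D \<subseteq> carrier H" using D(1) by (simp add: hdense_def)
    then have vc: "v \<in> carrier H" using v(1) by (rule subsetD)
    then have "v \<in> Domain J" by (simp only: dom)
    then obtain w where w: "(v, w) \<in> J" by (rule DomainE)
    have wc: "w \<in> carrier H" by (rule semilinear_op_carrier(2)[OF J w])
    have w': "(v, w) \<in> J'" by (rule D(2)[OF v(1) w])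
    have "hnorm H (p \<ominus> w) < e / 2" "hnorm H (p' \<ominus> w) < e / 2"
      using iso[OF semilinear_op_diff[OF J up w \<sigma>]] iso'[OF semilinear_op_diff[OF J' up' w' \<sigma>]] v(2)
      by simp_all
    then show ?thesis
      using hnorm_triangle_diff[OF pc wc pc'] hnorm_minus_commute[OF pc' wc] by simp
  qed
  then have le: "hnorm H (p \<ominus> p') \<le> 0" by (rule field_le_epsilon)
  have c: "p \<ominus> p' \<in> carrier H" using pc pc' by simp
  have "hnorm H (p \<ominus> p') = 0" using le hnorm_nonneg[OF c] by (rule antisym)
  then have 0: "p \<ominus> p' = \<zero>" using hnorm_eq_0[OF c] by simp
  have "p = (p \<ominus> p') \<oplus> p'" using pc pc' by (simp add: a_minus_def a_assoc l_neg)
  also have "\<dots> = p'" unfolding 0 using pc' by simp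
  finally show "(u, p) \<in> J'" using up' by simp
qed

text \<open>Abstracts from rotations to the densities between \<open>M n\<close> and
  \<open>M (- n)\<close>, on which the polar decomposition depends. Positivity is pointwise so that
  the square root of \<open>g\<close> is a \<open>positive_multiplier\<close>.\<close>

locale reflected_measures =
  fixes M :: "int \<Rightarrow> 't measure" and g :: "int \<Rightarrow> 't \<Rightarrow> real"
  assumes finite_M: "finite_measure (M n)"
    and g_meas [measurable]: "g n \<in> borel_measurable (M n)" and g_pos: "0 < g n z"
    and density_g: "density (M n) (\<lambda>z. ennreal (g n z)) = M (- n)"
begin

text \<open>Symbol of the square root of the modular operator, whose own symbol is
  \<open>g\<close>.\<close>

definition s :: "int \<Rightarrow> 't \<Rightarrow> real" where "s n z = sqrt (g n z)"

sublocale positive_multiplier M s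
proof
  show "s n \<in> borel_measurable (M n)" for n unfolding s_def by measurable
  show "0 < s n z" for n z using g_pos by (simp add: s_def)
qed

lemma sets_reflect [simp]: "sets (M (- n)) = sets (M n)"
  using density_g[of n] by (metis sets_density)

lemma measurable_reflect: "f \<in> borel_measurable (M (- n)) \<longleftrightarrow> f \<in> borel_measurable (M n)"
  by (rule arg_cong[where f = "\<lambda>A. f \<in> A"]) (rule measurable_cong_sets, simp_all)

text \<open>A positive density does not change the null sets.\<close>

lemma AE_reflect: "(AE z in M (- n). P z) \<longleftrightarrow> (AE z in M n. P z)"
  unfolding density_g[of n, symmetric] using g_pos by (subst AE_density) auto

lemma nn_integral_reflect:
  assumes "f \<in> borel_measurable (M n)"
  shows "(\<integral>\<^sup>+z. f z \<partial>M (- n)) = (\<integral>\<^sup>+z. ennreal (g n z) * f z \<partial>M n)"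
  unfolding density_g[of n, symmetric] using assms by (subst nn_integral_density) auto

text \<open>Reflecting twice returns to \<open>M n\<close>, so the product of the two densities is a
  density of \<open>M n\<close> with respect to itself and equals 1 by uniqueness of
  densities.\<close>

lemma g_reflect: "AE z in M n. g n z * g (- n) z = 1"
proof -
  interpret finite_measure "M n" by (rule finite_M)
  have [measurable]: "g (- n) \<in> borel_measurable (M n)"
    using g_meas[of "- n"] by (simp add: measurable_reflect)
  have "density (M n) (\<lambda>z. ennreal (g n z) * ennreal (g (- n) z)) = density (M (- n)) (\<lambda>z. ennreal (g (- n) z))"
    by (subst density_density_eq[symmetric]) (simp_all add: density_g)
  also have "\<dots> = M n" using density_g[of "- n"] by simp
  also have "\<dots> = density (M n) (\<lambda>z. 1)" by (simp add: density_1)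
  finally have "AE z in M n. ennreal (g n z) * ennreal (g (- n) z) = 1"
    by (subst (asm) density_unique_iff) auto
  then show ?thesis
  proof eventually_elim
    case (elim z)
    then show ?case
      using g_pos[of n z] g_pos[of "- n" z]
      by (simp add: ennreal_mult[symmetric] less_imp_le)
  qed
qed

lemma s_reflect: "AE z in M n. s n z * s (- n) z = 1"
  using g_reflect[of n] by eventually_elim (simp add: s_def flip: real_sqrt_mult)

section \<open>Conjugate reflection and its polar factors\<close>

definition conj_refl :: "(int \<Rightarrow> 't \<Rightarrow> complex) \<Rightarrow> int \<Rightarrow> 't \<Rightarrow> complex" where
  "conj_refl x = (\<lambda>n z. cnj (x (- n) z))"

text \<open>The concrete candidate for the Tomita operator, on its maximal domain.\<close>

definition S0 :: "(int, 't) l2op" where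
  "S0 = {(l2cls M x, l2cls M (conj_refl x)) | x. x \<in> l2fam M \<and> conj_refl x \<in> l2fam M}"

text \<open>Defined on every vector: the root of the density compensates for the change from
  \<open>M (- n)\<close> to \<open>M n\<close>, so the reflected family is again
  square-summable.\<close>

definition J0 :: "(int, 't) l2op" where
  "J0 = {(l2cls M x, l2cls M (fmul s (conj_refl x))) | x. x \<in> l2fam M}"

lemma conj_refl_measurable: "x \<in> l2fam M \<Longrightarrow> conj_refl x n \<in> borel_measurable (M n)"
  unfolding conj_refl_def using l2fam_measurable[of x M "- n"]
  by (intro borel_measurable_cnj) (simp add: measurable_reflect)

lemma conj_refl_cong_AE:
  assumes "\<And>n. AE z in M n. x n z = y n z"
  shows "AE z in M n. conj_refl x n z = conj_refl y n z"
proof -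
  have "AE z in M n. x (- n) z = y (- n) z" using assms[of "- n"] by (simp add: AE_reflect)
  then show ?thesis by eventually_elim (simp add: conj_refl_def)
qed

text \<open>Substituting -n for n moves the reflection from the function to the measure, where it
  becomes the density g = s^2. Infinite values are included, so the identity also compares
  domains.\<close>

lemma sqsum_conj_refl:
  assumes "\<And>n. x n \<in> borel_measurable (M n)"
  shows "sqsum M (conj_refl x) = sqsum M (fmul s x)"
proof -
  have xm: "x n \<in> borel_measurable (M n)" for n by (rule assms)
  have e: "(\<integral>\<^sup>+z. ennreal ((cmod (x n z))\<^sup>2) \<partial>M (- n)) = (\<integral>\<^sup>+z. ennreal ((cmod (fmul s x n z))\<^sup>2) \<partial>M n)" for n
    using xm g_pos
    by (subst nn_integral_reflect)
      (auto simp: fmul_def s_def norm_mult power_mult_distrib ennreal_mult[symmetric] less_imp_le intro!: nn_integral_cong)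
  have "sqsum M (conj_refl x) = (\<integral>\<^sup>+n. \<integral>\<^sup>+z. ennreal ((cmod (x (- n) z))\<^sup>2) \<partial>M n \<partial>count_space UNIV)"
    by (simp add: sqsum_def conj_refl_def)
  also have "\<dots> = (\<integral>\<^sup>+n. \<integral>\<^sup>+z. ennreal ((cmod (x n z))\<^sup>2) \<partial>M (- n) \<partial>count_space UNIV)"
    using nn_integral_bij_count_space[of uminus UNIV UNIV
        "\<lambda>n. \<integral>\<^sup>+z. ennreal ((cmod (x n z))\<^sup>2) \<partial>M (- n)"] by (simp add: bij_uminus)
  also have "\<dots> = sqsum M (fmul s x)" unfolding e sqsum_def ..
  finally show ?thesis .
qed

lemma conj_refl_l2fam_iff: "x \<in> l2fam M \<Longrightarrow> conj_refl x \<in> l2fam M \<longleftrightarrow> fmul s x \<in> l2fam M"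
  using conj_refl_measurable[of x] fmul_measurable[of s M x, OF s_meas] sqsum_conj_refl[of x]
  by (simp add: l2fam_def)

text \<open>Pointwise form of the factorization of \<open>S0\<close> through \<open>J0\<close>: the
  reflected factor \<open>s (- n)\<close> cancels against \<open>s n\<close>.\<close>

lemma s_conj_refl_s:
  "AE z in M n. fmul s (conj_refl (fmul s x)) n z = conj_refl x n z"
  using s_reflect[of n]
proof eventually_elim
  case (elim z)
  then have "complex_of_real (s n z) * of_real (s (- n) z) = 1" by (metis of_real_1 of_real_mult)
  then show ?case by (simp add: fmul_def conj_refl_def mult.assoc[symmetric])
qed

text \<open>Instance of \<open>sqsum_conj_refl\<close> for the reflected family, reflection being an
  involution.\<close>

lemma sqsum_s_conj_refl:
  assumes "x \<in> l2fam M"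
  shows "sqsum M (fmul s (conj_refl x)) = sqsum M x"
proof -
  have "sqsum M (fmul s (conj_refl x)) = sqsum M (conj_refl (conj_refl x))"
    using conj_refl_measurable[OF assms] by (simp add: sqsum_conj_refl)
  then show ?thesis by (simp add: conj_refl_def)
qed

lemma s_conj_refl_l2fam: "x \<in> l2fam M \<Longrightarrow> fmul s (conj_refl x) \<in> l2fam M"
proof -
  assume x: "x \<in> l2fam M"
  have [measurable]: "conj_refl x n \<in> borel_measurable (M n)" for n
    by (rule conj_refl_measurable[OF x])
  have "fmul s (conj_refl x) n \<in> borel_measurable (M n)" for n
    unfolding fmul_def by measurable
  then show ?thesis using x sqsum_s_conj_refl[OF x] by (simp add: l2fam_def)
qed

lemma J0_iff:
  assumes "x \<in> l2fam M"
  shows "(l2cls M x, Y) \<in> J0 \<longleftrightarrow> Y = l2cls M (fmul s (conj_refl x))"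
proof
  assume "(l2cls M x, Y) \<in> J0"
  then obtain y where y: "l2cls M x = l2cls M y" "Y = l2cls M (fmul s (conj_refl y))"
    by (auto simp: J0_def)
  have ae: "AE z in M n. x n z = y n z" for n
    using y(1) l2cls_eq_iff[OF assms] by simp
  have ae2: "AE z in M n. fmul s (conj_refl x) n z = fmul s (conj_refl y) n z" for n
    by (rule fmul_cong_AE, rule conj_refl_cong_AE, rule ae)
  then show "Y = l2cls M (fmul s (conj_refl x))"
    using y(2) l2cls_cong_AE[where M = M, OF ae2] by simp
qed (use assms in \<open>auto simp: J0_def\<close>)

lemma S0_eq: "S0 = mult_op M s O J0"
proof (intro equalityI subrelI)
  fix X Y assume "(X, Y) \<in> S0"
  then obtain x where x: "x \<in> l2fam M" "conj_refl x \<in> l2fam M" "X = l2cls M x" "Y = l2cls M (conj_refl x)"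
    by (auto simp: S0_def)
  have sx: "fmul s x \<in> l2fam M" using x by (simp add: conj_refl_l2fam_iff)
  have "(X, l2cls M (fmul s x)) \<in> mult_op M s" using x sx by (simp add: mult_op_iff s_meas)
  moreover have "(l2cls M (fmul s x), Y) \<in> J0"
    using sx l2cls_cong_AE[where M = M, OF s_conj_refl_s] by (simp add: J0_iff x(4))
  ultimately show "(X, Y) \<in> mult_op M s O J0" by (rule relcompI)
next
  fix X Y assume "(X, Y) \<in> mult_op M s O J0"
  then obtain Z where Z: "(X, Z) \<in> mult_op M s" "(Z, Y) \<in> J0" by (rule relcompE) simp
  from Z(1) show "(X, Y) \<in> S0"
  proof (rule mult_op_cases)
    fix x assume x: "x \<in> l2fam M" "fmul s x \<in> l2fam M" "X = l2cls M x" "Z = l2cls M (fmul s x)"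
    have "Y = l2cls M (conj_refl x)"
      using Z(2) l2cls_cong_AE[where M = M, OF s_conj_refl_s] x(2) by (simp add: J0_iff x(4))
    then show "(X, Y) \<in> S0" using x by (auto simp: S0_def conj_refl_l2fam_iff)
  qed
qed

lemma J0_semilinear: "semilinear_op (l2sum M) cnj J0"
proof (rule semilinear_opI)
  fix X Y assume "(X, Y) \<in> J0"
  then show "X \<in> carrier (l2sum M) \<and> Y \<in> carrier (l2sum M)"
    by (auto simp: J0_def s_conj_refl_l2fam)
next
  fix X Y Z assume XY: "(X, Y) \<in> J0" and XZ: "(X, Z) \<in> J0"
  then obtain x where "x \<in> l2fam M" "X = l2cls M x" by (auto simp: J0_def)
  then show "Y = Z" using XY XZ by (simp add: J0_iff)
next
  have "fmul s (conj_refl (\<lambda>n z. 0)) = (\<lambda>n z. 0)" by (simp add: fmul_def conj_refl_def)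
  then show "(\<zero>\<^bsub>l2sum M\<^esub>, \<zero>\<^bsub>l2sum M\<^esub>) \<in> J0"
    by (simp add: zero_l2sum J0_iff l2fam_zero)
next
  fix X Y X' Y' assume "(X, Y) \<in> J0" "(X', Y') \<in> J0"
  then obtain x x' where x: "x \<in> l2fam M" "X = l2cls M x" "Y = l2cls M (fmul s (conj_refl x))"
    and x': "x' \<in> l2fam M" "X' = l2cls M x'" "Y' = l2cls M (fmul s (conj_refl x'))"
    unfolding J0_def by clarsimp
  have "fmul s (conj_refl (\<lambda>n z. x n z + x' n z)) = (\<lambda>n z. fmul s (conj_refl x) n z + fmul s (conj_refl x') n z)"
    by (simp add: fmul_def conj_refl_def algebra_simps)
  then show "(X \<oplus>\<^bsub>l2sum M\<^esub> X', Y \<oplus>\<^bsub>l2sum M\<^esub> Y') \<in> J0"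
    using x(1) x'(1) unfolding x(2,3) x'(2,3)
    by (simp add: add_l2sum J0_iff l2fam_add s_conj_refl_l2fam)
next
  fix c X Y assume "(X, Y) \<in> J0"
  then obtain x where x: "x \<in> l2fam M" "X = l2cls M x" "Y = l2cls M (fmul s (conj_refl x))"
    unfolding J0_def by clarsimp
  have "fmul s (conj_refl (\<lambda>n z. c * x n z)) = (\<lambda>n z. cnj c * fmul s (conj_refl x) n z)"
    by (simp add: fmul_def conj_refl_def algebra_simps)
  then show "(c \<odot>\<^bsub>l2sum M\<^esub> X, cnj c \<odot>\<^bsub>l2sum M\<^esub> Y) \<in> J0"
    using x(1) unfolding x(2,3)
    by (simp add: smult_l2sum J0_iff l2fam_smult s_conj_refl_l2fam)
qed

lemma J0_isometry:
  assumes "(X, Y) \<in> J0"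
  shows "hnorm (l2sum M) Y = hnorm (l2sum M) X"
proof -
  obtain x where x: "x \<in> l2fam M" "X = l2cls M x" "Y = l2cls M (fmul s (conj_refl x))"
    using assms unfolding J0_def by clarsimp
  show ?thesis
    using x(1) unfolding x(2,3) hnorm_def
    by (simp add: sqsum_eq_ip s_conj_refl_l2fam sqsum_s_conj_refl)
qed

lemma Domain_J0: "Domain J0 = carrier (l2sum M)"
  by (auto simp: J0_def carrier_l2sum)

lemma kernel_J0: "op_kernel (l2sum M) J0 = {\<zero>\<^bsub>l2sum M\<^esub>}"
proof -
  have "X = \<zero>\<^bsub>l2sum M\<^esub>" if X: "(X, \<zero>\<^bsub>l2sum M\<^esub>) \<in> J0" for X
  proof -
    have "hnorm (l2sum M) X = 0"
      using J0_isometry[OF X] H.hnorm_eq_0[of "\<zero>\<^bsub>l2sum M\<^esub>"] by simp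
    then show ?thesis
      using semilinear_op_carrier(1)[OF J0_semilinear X] by (simp add: H.hnorm_eq_0)
  qed
  moreover have "(\<zero>\<^bsub>l2sum M\<^esub>, \<zero>\<^bsub>l2sum M\<^esub>) \<in> J0"
    using J0_semilinear by (simp add: semilinear_op_def)
  ultimately show ?thesis unfolding op_kernel_def by blast
qed

lemma kernel_mult_op: "op_kernel (l2sum M) (mult_op M s) = {\<zero>\<^bsub>l2sum M\<^esub>}"
proof -
  have "X = \<zero>\<^bsub>l2sum M\<^esub>" if X: "(X, \<zero>\<^bsub>l2sum M\<^esub>) \<in> mult_op M s" for X
    using X
  proof (rule mult_op_cases)
    fix x assume x: "x \<in> l2fam M" "fmul s x \<in> l2fam M" "X = l2cls M x" "\<zero>\<^bsub>l2sum M\<^esub> = l2cls M (fmul s x)"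
    have "AE z in M n. fmul s x n z = 0" for n
      using x(4) l2cls_eq_iff[OF x(2), of "\<lambda>n z. 0"] by (simp add: zero_l2sum)
    then have "AE z in M n. x n z = 0" for n
    proof eventually_elim
      case (elim z)
      then show ?case using s_pos[of n z] by (simp add: fmul_def)
    qed
    then show ?thesis unfolding zero_l2sum x(3) by (rule l2cls_cong_AE)
  qed
  moreover have "(\<zero>\<^bsub>l2sum M\<^esub>, \<zero>\<^bsub>l2sum M\<^esub>) \<in> mult_op M s"
    using semilinear_mult_op[of s M, OF s_meas] by (simp add: semilinear_op_def)
  ultimately show ?thesis unfolding op_kernel_def by blast
qed

text \<open>Both kernels are trivial, and \<open>J0\<close> preserves all norms.\<close>

lemma polar_decomposition_S0:
  "antilinear_polar_decomposition (l2sum M) S0 J0 (mult_op M s)"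
  unfolding antilinear_polar_decomposition_def antilinear_partial_isometry_def
  using positive_self_adjoint_mult_op J0_semilinear Domain_J0 kernel_J0 kernel_mult_op S0_eq
  by (intro conjI ballI; clarsimp simp: J0_isometry)

lemma S0_single:
  assumes "(X, Y) \<in> S0" "(X, Z) \<in> S0"
  shows "Y = Z"
proof -
  obtain V where V: "(X, V) \<in> mult_op M s" "(V, Y) \<in> J0"
    using assms(1) unfolding S0_eq by (rule relcompE) simp
  obtain W where W: "(X, W) \<in> mult_op M s" "(W, Z) \<in> J0"
    using assms(2) unfolding S0_eq by (rule relcompE) simp
  have "V = W" by (rule semilinear_op_single[OF semilinear_mult_op[of s M, OF s_meas] V(1) W(1)])
  then have "(V, Z) \<in> J0" using W(2) by simp
  with V(2) show ?thesis by (rule semilinear_op_single[OF J0_semilinear])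
qed

text \<open>\<open>S0\<close> determines the kernels of a competing pair, the domain of
  \<open>T\<close> and the norms of its values. This identifies \<open>T\<close>, and
  \<open>J\<close> is fixed by its values on the dense range of \<open>mult_op M s\<close>.\<close>

theorem polar_decomposition_unique:
  assumes "antilinear_polar_decomposition (l2sum M) S0 J T"
  shows "T = mult_op M s" "J = J0"
proof -
  have T: "positive_self_adjoint (l2sum M) T" and S: "S0 = T O J"
    and J: "semilinear_op (l2sum M) cnj J" "Domain J = carrier (l2sum M)"
    and iso: "\<And>X Y. \<lbrakk>(X, Y) \<in> J; \<And>K. K \<in> op_kernel (l2sum M) J \<Longrightarrow> ip (l2sum M) K X = 0\<rbrakk> \<Longrightarrow>
      hnorm (l2sum M) Y = hnorm (l2sum M) X"
    and ker: "op_kernel (l2sum M) J = op_kernel (l2sum M) T"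
    using assms unfolding antilinear_polar_decomposition_def antilinear_partial_isometry_def by auto
  have Tl: "semilinear_op (l2sum M) id T" using T by (simp add: positive_self_adjoint_def)
  \<comment> \<open>A vector of the common kernel is sent to zero by \<open>S0\<close>, whose two
    factors are injective. The partial isometry \<open>J\<close> is therefore isometric on the whole
    space.\<close>
  have ker0: "K = \<zero>\<^bsub>l2sum M\<^esub>" if K: "K \<in> op_kernel (l2sum M) J" for K
  proof -
    have "(K, \<zero>\<^bsub>l2sum M\<^esub>) \<in> T" using K unfolding ker by (simp add: op_kernel_def)
    moreover have "(\<zero>\<^bsub>l2sum M\<^esub>, \<zero>\<^bsub>l2sum M\<^esub>) \<in> J" using J(1) by (simp add: semilinear_op_def)
    ultimately have "(K, \<zero>\<^bsub>l2sum M\<^esub>) \<in> mult_op M s O J0"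
      unfolding S0_eq[symmetric] S by (rule relcompI)
    then obtain V where V: "(K, V) \<in> mult_op M s" "(V, \<zero>\<^bsub>l2sum M\<^esub>) \<in> J0" by (rule relcompE) simp
    have "V = \<zero>\<^bsub>l2sum M\<^esub>" using V(2) kernel_J0 unfolding op_kernel_def by auto
    then show ?thesis using V(1) kernel_mult_op unfolding op_kernel_def by auto
  qed
  have iso': "hnorm (l2sum M) Y = hnorm (l2sum M) X" if XY: "(X, Y) \<in> J" for X Y
  proof (rule iso[OF XY])
    fix K assume "K \<in> op_kernel (l2sum M) J"
    then have "K = \<zero>\<^bsub>l2sum M\<^esub>" by (rule ker0)
    then show "ip (l2sum M) K X = 0"
      using semilinear_op_carrier(1)[OF J(1) XY] by simp
  qed
  have ex_J: "\<exists>Z. (Y, Z) \<in> J" if "(X, Y) \<in> T" for X Y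
  proof -
    have "Y \<in> Domain J" using semilinear_op_carrier(2)[OF Tl that] by (simp only: J(2))
    then show ?thesis by (rule DomainE) blast
  qed
  have ex_J0: "\<exists>Z. (Y, Z) \<in> J0" if "(X, Y) \<in> mult_op M s" for X Y
  proof -
    have "Y \<in> Domain J0"
      using semilinear_op_carrier(2)[OF semilinear_mult_op[of s M, OF s_meas] that] by (simp only: Domain_J0)
    then show ?thesis by (rule DomainE) blast
  qed
  \<comment> \<open>Both isometric factors are defined everywhere, so composing with them does not
    shrink the domain.\<close>
  have dom: "Domain T = Domain (mult_op M s)"
  proof -
    have comp: "Domain (P O Q) = Domain P" if ex: "\<And>X Y. (X, Y) \<in> P \<Longrightarrow> \<exists>Z. (Y, Z) \<in> Q"
      for P Q :: "(int, 't) l2op"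
    proof (intro equalityI subsetI)
      fix X assume "X \<in> Domain P"
      then obtain Y where Y: "(X, Y) \<in> P" by (rule DomainE)
      obtain Z where "(Y, Z) \<in> Q" using ex[OF Y] by (rule exE)
      with Y show "X \<in> Domain (P O Q)" by (intro DomainI relcompI)
    qed auto
    have "Domain T = Domain S0" unfolding S by (rule comp[OF ex_J, symmetric])
    also have "\<dots> = Domain (mult_op M s)" unfolding S0_eq by (rule comp[OF ex_J0])
    finally show ?thesis .
  qed
  \<comment> \<open>Both norms equal the norm of the value of \<open>S0\<close> at
    \<open>X\<close>.\<close>
  have norm: "hnorm (l2sum M) Y = hnorm (l2sum M) Z" if Y: "(X, Y) \<in> T" and Z: "(X, Z) \<in> mult_op M s" for X Y Z
  proof -
    obtain W where W: "(Y, W) \<in> J" using ex_J[OF Y] by blast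
    obtain W' where W': "(Z, W') \<in> J0" using ex_J0[OF Z] by blast
    have "(X, W) \<in> S0" unfolding S using Y W by (rule relcompI)
    moreover have "(X, W') \<in> S0" unfolding S0_eq using Z W' by (rule relcompI)
    ultimately have "W = W'" by (rule S0_single)
    then show ?thesis using iso'[OF W] J0_isometry[OF W'] by simp
  qed
  show TT: "T = mult_op M s" by (rule positive_sqrt_unique[OF T dom norm])
  have sub: "J \<subseteq> J0"
  proof (rule H.isometry_subset[OF J(1) J0_semilinear _ iso' J0_isometry J(2) Domain_J0 hdense_range])
    fix V W assume "V \<in> Range (mult_op M s)" and W: "(V, W) \<in> J"
    then obtain X where X: "(X, V) \<in> mult_op M s" by blast
    obtain W' where W': "(V, W') \<in> J0" using ex_J0[OF X] by blast
    have "(X, W) \<in> S0" unfolding S TT using X W by (rule relcompI)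
    moreover have "(X, W') \<in> S0" unfolding S0_eq using X W' by (rule relcompI)
    ultimately have "W = W'" by (rule S0_single)
    then show "(V, W) \<in> J0" using W' by simp
  qed simp_all
  show "J = J0"
  proof (rule equalityI[OF sub subrelI])
    fix V W assume VW: "(V, W) \<in> J0"
    have "V \<in> Domain J" using semilinear_op_carrier(1)[OF J0_semilinear VW] by (simp only: J(2))
    then obtain W' where W': "(V, W') \<in> J" by (rule DomainE)
    have "(V, W') \<in> J0" using sub W' by (rule subsetD)
    then have "W' = W" using VW by (rule semilinear_op_single[OF J0_semilinear])
    then show "(V, W) \<in> J" using W' by simp
  qed
qed

text \<open>Convergence of a graph pair in component \<open>- n\<close> of its first entry is
  convergence of the reflected function in the measure with density \<open>g n\<close>, while the
  second entry converges in \<open>M n\<close>. The two limits are compared in a measure dominated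
  by both.\<close>

lemma S0_closed: "graph_closure (l2sum M) S0 \<subseteq> S0"
proof (rule subrelI)
  fix X Y assume XY: "(X, Y) \<in> graph_closure (l2sum M) S0"
  then obtain x y where x: "x \<in> l2fam M" "X = l2cls M x" and y: "y \<in> l2fam M" "Y = l2cls M y"
    by (auto simp: graph_closure_def carrier_l2sum)
  have ae: "AE z in M n. y n z = conj_refl x n z" for n
  proof -
    have [measurable]: "conj_refl x n \<in> borel_measurable (M n)" "y n \<in> borel_measurable (M n)"
      using conj_refl_measurable[OF x(1)] l2fam_measurable[OF y(1)] by auto
    \<comment> \<open>The weight min(1, g) lies below both densities and is still positive, so a
      vanishing integral of \<open>w\<close> gives equality almost everywhere.\<close>
    define w where "w z = min 1 (g n z) * (cmod (y n z - conj_refl x n z))\<^sup>2" for z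
    have wm: "w \<in> borel_measurable (M n)" unfolding w_def by measurable
    have "(\<integral>\<^sup>+z. ennreal (w z) \<partial>M n) \<le> 0 + ennreal e" if e: "e > 0" for e
    proof -
      \<comment> \<open>Chosen for the two error terms: 2 d^2 + 2 d^2 = e.\<close>
      define d where "d = sqrt (e / 4)"
      have d: "d > 0" "d\<^sup>2 = e / 4" using e by (simp_all add: d_def)
      obtain A B where AB: "(A, B) \<in> S0" "hnorm (l2sum M) (X \<ominus>\<^bsub>l2sum M\<^esub> A) < d"
          "hnorm (l2sum M) (Y \<ominus>\<^bsub>l2sum M\<^esub> B) < d"
        using XY d(1) unfolding graph_closure_def by blast
      then obtain a where a: "a \<in> l2fam M" "conj_refl a \<in> l2fam M" "A = l2cls M a" "B = l2cls M (conj_refl a)"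
        by (auto simp: S0_def)
      have [measurable]: "conj_refl a n \<in> borel_measurable (M n)"
        using conj_refl_measurable[OF a(1)] .
      have le: "(\<integral>\<^sup>+z. ennreal ((cmod (u m z))\<^sup>2) \<partial>M m) \<le> sqsum M u" for u m
        unfolding sqsum_def
        by (rule nn_integral_ge_point[of m UNIV "\<lambda>n. \<integral>\<^sup>+z. ennreal ((cmod (u n z))\<^sup>2) \<partial>M n"]) simp
      have "sqsum M (\<lambda>n z. x n z - a n z) < ennreal (e / 4)"
        using AB(2) x a d by (simp add: diff_l2sum hnorm_l2sum_less_iff l2fam_diff)
      then have 1: "(\<integral>\<^sup>+z. ennreal ((cmod (x (- n) z - a (- n) z))\<^sup>2) \<partial>M (- n)) \<le> ennreal (e / 4)"
        using le[where u = "\<lambda>n z. x n z - a n z" and m = "- n"] by (meson le_less_trans less_imp_le)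
      have "(\<lambda>z. ennreal ((cmod (x (- n) z - a (- n) z))\<^sup>2)) = (\<lambda>z. ennreal ((cmod (conj_refl x n z - conj_refl a n z))\<^sup>2))"
        by (simp add: conj_refl_def flip: complex_cnj_diff)
      then have 2: "(\<integral>\<^sup>+z. ennreal (g n z) * ennreal ((cmod (conj_refl x n z - conj_refl a n z))\<^sup>2) \<partial>M n) \<le> ennreal (e / 4)"
        using 1 by (simp add: nn_integral_reflect)
      have "sqsum M (\<lambda>n z. y n z - conj_refl a n z) < ennreal (e / 4)"
        using AB(3) y a d by (simp add: diff_l2sum hnorm_l2sum_less_iff l2fam_diff)
      then have 3: "(\<integral>\<^sup>+z. ennreal ((cmod (y n z - conj_refl a n z))\<^sup>2) \<partial>M n) \<le> ennreal (e / 4)"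
        using le[where u = "\<lambda>n z. y n z - conj_refl a n z" and m = n] by (meson le_less_trans less_imp_le)
      have "(\<integral>\<^sup>+z. ennreal (w z) \<partial>M n) \<le> (\<integral>\<^sup>+z. 2 * (ennreal (g n z) * ennreal ((cmod (conj_refl x n z - conj_refl a n z))\<^sup>2)) +
          2 * ennreal ((cmod (y n z - conj_refl a n z))\<^sup>2) \<partial>M n)"
      proof (rule nn_integral_mono)
        fix z
        let ?p = "cmod (conj_refl x n z - conj_refl a n z)" and ?q = "cmod (y n z - conj_refl a n z)"
        let ?m = "min 1 (g n z)"
        have m: "0 \<le> ?m" "?m \<le> g n z" "?m \<le> 1" using g_pos[of n z] by (simp_all add: less_imp_le)
        have "ennreal ((cmod (y n z - conj_refl x n z))\<^sup>2) \<le> 2 * ennreal (?p\<^sup>2) + 2 * ennreal (?q\<^sup>2)"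
          using norm_triangle_ineq4[of "y n z - conj_refl a n z" "conj_refl x n z - conj_refl a n z"]
          by (intro ennreal_square_add_le) (simp_all add: add.commute)
        then have "ennreal (w z) \<le> ennreal ?m * (2 * ennreal (?p\<^sup>2) + 2 * ennreal (?q\<^sup>2))"
          using m(1) unfolding w_def by (simp add: ennreal_mult mult_left_mono)
        also have "\<dots> = 2 * (ennreal ?m * ennreal (?p\<^sup>2)) + 2 * (ennreal ?m * ennreal (?q\<^sup>2))"
          by (simp add: distrib_left mult_ac)
        also have "\<dots> \<le> 2 * (ennreal (g n z) * ennreal (?p\<^sup>2)) + 2 * (1 * ennreal (?q\<^sup>2))"
          using m(2,3) by (intro add_mono mult_left_mono mult_right_mono) (simp_all add: ennreal_leI)
        finally show "ennreal (w z) \<le> 2 * (ennreal (g n z) * ennreal (?p\<^sup>2)) + 2 * ennreal (?q\<^sup>2)"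
          by simp
      qed
      also have "\<dots> = 2 * (\<integral>\<^sup>+z. ennreal (g n z) * ennreal ((cmod (conj_refl x n z - conj_refl a n z))\<^sup>2) \<partial>M n) +
          2 * (\<integral>\<^sup>+z. ennreal ((cmod (y n z - conj_refl a n z))\<^sup>2) \<partial>M n)"
        by (simp add: nn_integral_add nn_integral_cmult)
      also have "\<dots> \<le> 2 * ennreal (e / 4) + 2 * ennreal (e / 4)"
        using 2 3 by (intro add_mono mult_left_mono) auto
      also have "\<dots> = ennreal e"
        using e by (simp add: ennreal_mult[symmetric] ennreal_plus[symmetric] flip: ennreal_numeral del: ennreal_plus)
      finally show ?thesis by simp
    qed
    then have "(\<integral>\<^sup>+z. ennreal (w z) \<partial>M n) \<le> 0" by (rule ennreal_le_epsilon)
    then have "AE z in M n. ennreal (w z) = 0" using wm by (simp add: nn_integral_0_iff_AE)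
    then show ?thesis
    proof eventually_elim
      case (elim z)
      have "0 < min 1 (g n z)" using g_pos[of n z] by simp
      then have "0 \<le> w z" by (simp add: w_def)
      then have "w z = 0" using elim by simp
      then show ?case using \<open>0 < min 1 (g n z)\<close> by (simp add: w_def)
    qed
  qed
  have "conj_refl x \<in> l2fam M"
  proof (rule l2fam_cong_AE[OF y(1) conj_refl_measurable[OF x(1)]])
    show "AE z in M n. conj_refl x n z = y n z" for n using ae[of n] by eventually_elim simp
  qed
  then show "(X, Y) \<in> S0"
    using x y l2cls_cong_AE[where M = M, OF ae] by (auto simp: S0_def)
qed

end

section \<open>Density of trigonometric polynomials\<close>

text \<open>Laurent polynomials as functions on the whole plane; their values on the circle are what
  matters.\<close>

inductive_set trig :: "(complex \<Rightarrow> complex) set" where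
  powi: "(\<lambda>z. z powi k) \<in> trig"
| smult: "p \<in> trig \<Longrightarrow> (\<lambda>z. c * p z) \<in> trig"
| add: "\<lbrakk>p \<in> trig; q \<in> trig\<rbrakk> \<Longrightarrow> (\<lambda>z. p z + q z) \<in> trig"

lemma trig_measurable: "p \<in> trig \<Longrightarrow> p \<in> borel_measurable borel"
proof (induction rule: trig.induct)
  case (powi k)
  have "(\<lambda>z::complex. z powi k) = (\<lambda>z. if k \<ge> 0 then z ^ nat k else inverse z ^ nat (- k))"
    by (auto simp: power_int_def)
  then show ?case by simp
qed auto

text \<open>Membership is tested on the circle because products of Laurent polynomials behave well
  only there: at 0 the law for adding integer exponents fails.\<close>

definition circle_trig :: "(complex \<Rightarrow> complex) set" where
  "circle_trig = {f. \<exists>p\<in>trig. \<forall>z\<in>sphere 0 1. f z = p z}"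

lemma circle_trigI: "p \<in> trig \<Longrightarrow> (\<And>z. cmod z = 1 \<Longrightarrow> f z = p z) \<Longrightarrow> f \<in> circle_trig"
  by (auto simp: circle_trig_def)

lemma circle_trig_smult:
  assumes "f \<in> circle_trig"
  shows "(\<lambda>z. c * f z) \<in> circle_trig"
proof -
  obtain p where "p \<in> trig" "\<And>z. cmod z = 1 \<Longrightarrow> f z = p z"
    using assms by (auto simp: circle_trig_def)
  then show ?thesis by (intro circle_trigI[OF trig.smult]) auto
qed

lemma circle_trig_add:
  assumes "f \<in> circle_trig" "g \<in> circle_trig"
  shows "(\<lambda>z. f z + g z) \<in> circle_trig"
proof -
  obtain p q where "p \<in> trig" "\<And>z. cmod z = 1 \<Longrightarrow> f z = p z" "q \<in> trig" "\<And>z. cmod z = 1 \<Longrightarrow> g z = q z"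
    using assms by (auto simp: circle_trig_def)
  then show ?thesis by (intro circle_trigI[OF trig.add]) auto
qed

lemma circle_trig_const: "(\<lambda>z. c) \<in> circle_trig"
  by (rule circle_trigI[OF trig.smult[OF trig.powi[of 0], of c]]) simp

lemma trig_mult_powi: "p \<in> trig \<Longrightarrow> (\<lambda>z. p z * z powi k) \<in> circle_trig"
proof (induction rule: trig.induct)
  case (powi l)
  show ?case
  proof (rule circle_trigI[OF trig.powi[of "l + k"]])
    fix z :: complex assume "cmod z = 1"
    then have "z \<noteq> 0" by auto
    then show "z powi l * z powi k = z powi (l + k)" by (simp add: power_int_add)
  qed
next
  case (smult p c)
  then show ?case using circle_trig_smult[of "\<lambda>z. p z * z powi k" c] by (simp add: mult.assoc)
next
  case (add p q)
  then show ?case using circle_trig_add by (simp add: distrib_right)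
qed

lemma trig_mult: "q \<in> trig \<Longrightarrow> p \<in> trig \<Longrightarrow> (\<lambda>z. p z * q z) \<in> circle_trig"
proof (induction rule: trig.induct)
  case (powi k)
  then show ?case by (rule trig_mult_powi)
next
  case (smult q c)
  then show ?case using circle_trig_smult[of "\<lambda>z. p z * q z" c] by (simp add: mult.left_commute)
next
  case (add q r)
  then show ?case using circle_trig_add by (simp add: distrib_left)
qed

lemma circle_trig_mult:
  assumes "f \<in> circle_trig" "g \<in> circle_trig"
  shows "(\<lambda>z. f z * g z) \<in> circle_trig"
proof -
  obtain p q where pq: "p \<in> trig" "\<And>z. cmod z = 1 \<Longrightarrow> f z = p z" "q \<in> trig" "\<And>z. cmod z = 1 \<Longrightarrow> g z = q z"
    using assms by (auto simp: circle_trig_def)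
  obtain r where "r \<in> trig" "\<And>z. cmod z = 1 \<Longrightarrow> p z * q z = r z"
    using trig_mult[OF pq(3,1)] by (auto simp: circle_trig_def)
  then show ?thesis using pq by (intro circle_trigI[of r]) auto
qed

text \<open>Prepares the real Stone-Weierstrass theorem: on the circle both coordinate functions are
  Laurent polynomials.\<close>

lemma real_polynomial_circle_trig:
  "real_polynomial_function f \<Longrightarrow> (\<lambda>z. complex_of_real (f z)) \<in> circle_trig"
proof (induction rule: real_polynomial_function.induct)
  case (linear f)
  interpret bounded_linear f by fact
  \<comment> \<open>On the circle 1/z is the conjugate of z, so Re z = (z + 1/z) / 2 and Im z = (z -
    1/z) / (2 i); the coefficients are the values of the real-linear \<open>f\<close> at 1 and
    i.\<close>
  let ?p = "\<lambda>z. (of_real (f 1) / 2) * (z powi 1 + z powi (- 1)) + (of_real (f \<i>) / (2 * \<i>)) * (z powi 1 + (- 1) * z powi (- 1))"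
  show ?case
  proof (rule circle_trigI[of ?p])
    show "?p \<in> trig" by (intro trig.intros)
    fix z :: complex assume z: "cmod z = 1"
    then have "z \<noteq> 0" by auto
    have "z * cnj z = 1" using z complex_norm_square[of z] by simp
    then have inv: "z powi (- 1) = cnj z"
      using \<open>z \<noteq> 0\<close> by (simp add: power_int_minus field_simps)
    have "f z = f (Re z *\<^sub>R 1 + Im z *\<^sub>R \<i>)"
      by (rule arg_cong[where f = f]) (simp add: complex_eq_iff)
    also have "\<dots> = Re z * f 1 + Im z * f \<i>" by (simp only: add scaleR real_scaleR_def)
    finally have "f z = Re z * f 1 + Im z * f \<i>" .
    then show "complex_of_real (f z) = ?p z"
      unfolding inv by (simp add: complex_eq_iff)
  qed
next
  case (const c)
  show ?case by (rule circle_trig_const)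
next
  case (add f g)
  then show ?case using circle_trig_add by simp
next
  case (mult f g)
  then show ?case using circle_trig_mult by simp
qed

section \<open>Approximation in the square mean on the circle\<close>

definition l2dist :: "'t measure \<Rightarrow> ('t \<Rightarrow> complex) \<Rightarrow> ('t \<Rightarrow> complex) \<Rightarrow> ennreal" where
  "l2dist N f g = (\<integral>\<^sup>+z. ennreal ((cmod (f z - g z))\<^sup>2) \<partial>N)"

text \<open>\<open>l2dist\<close> is a squared distance, whence the factors 2 here and in the
  triangle estimate, and the errors \<open>e / 4\<close> in their applications.\<close>

lemma l2dist_add:
  assumes [measurable]: "f \<in> borel_measurable N" "g \<in> borel_measurable N"
    "f' \<in> borel_measurable N" "g' \<in> borel_measurable N"
  shows "l2dist N (\<lambda>z. f z + f' z) (\<lambda>z. g z + g' z) \<le> 2 * l2dist N f g + 2 * l2dist N f' g'"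
proof -
  have "l2dist N (\<lambda>z. f z + f' z) (\<lambda>z. g z + g' z) \<le>
      (\<integral>\<^sup>+z. 2 * ennreal ((cmod (f z - g z))\<^sup>2) + 2 * ennreal ((cmod (f' z - g' z))\<^sup>2) \<partial>N)"
    unfolding l2dist_def
  proof (rule nn_integral_mono, rule ennreal_square_add_le)
    fix z show "cmod (f z + f' z - (g z + g' z)) \<le> cmod (f z - g z) + cmod (f' z - g' z)"
      using norm_triangle_ineq[of "f z - g z" "f' z - g' z"] by (simp add: algebra_simps)
  qed auto
  also have "\<dots> = 2 * l2dist N f g + 2 * l2dist N f' g'"
    unfolding l2dist_def by (simp add: nn_integral_add nn_integral_cmult)
  finally show ?thesis .
qed

lemma l2dist_triangle:
  assumes [measurable]: "f \<in> borel_measurable N" "g \<in> borel_measurable N" "h \<in> borel_measurable N"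
  shows "l2dist N f h \<le> 2 * l2dist N f g + 2 * l2dist N g h"
proof -
  have "l2dist N f h = l2dist N (\<lambda>z. (f z - g z) + g z) (\<lambda>z. (g z - g z) + h z)" by simp
  also have "\<dots> \<le> 2 * l2dist N (\<lambda>z. f z - g z) (\<lambda>z. g z - g z) + 2 * l2dist N g h"
    by (rule l2dist_add) simp_all
  finally show ?thesis by (simp add: l2dist_def)
qed

lemma two_quarters_less:
  assumes "0 < e" "a < ennreal (e / 4)" "b < ennreal (e / 4)"
  shows "2 * a + 2 * b < ennreal e"
proof -
  obtain r t where rt: "a = ennreal r" "0 \<le> r" "b = ennreal t" "0 \<le> t"
    using assms(2,3) by (cases a; cases b) auto
  have "2 * ennreal r + 2 * ennreal t = ennreal (2 * r + 2 * t)"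
    using rt by (simp add: ennreal_mult)
  also have "\<dots> < ennreal e"
    using assms rt by (intro ennreal_lessI) (auto simp: ennreal_less_iff)
  finally show ?thesis using rt by simp
qed

text \<open>A measure on the whole plane carried by the circle, so that inner regularity by compact
  sets and continuous functions on the plane can be used directly.\<close>

locale circle_borel_measure = finite_measure N for N :: "complex measure" +
  assumes sets_N [measurable_cong]: "sets N = sets borel"
    and AE_circle: "AE z in N. cmod z = 1"
begin

lemma space_N: "space N = UNIV"
  using sets_eq_imp_space_eq[OF sets_N] by simp

definition approximable :: "(complex \<Rightarrow> complex) set" where
  "approximable = {f. f \<in> borel_measurable N \<and> (\<forall>e>0. \<exists>p\<in>trig. l2dist N f p < ennreal e)}"

lemma trig_meas_N [measurable_dest]: "p \<in> trig \<Longrightarrow> p \<in> borel_measurable N"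
  using trig_measurable[of p] by simp

lemma approximable_meas: "f \<in> approximable \<Longrightarrow> f \<in> borel_measurable N"
  by (simp add: approximable_def)

text \<open>Approximability survives limits in the square mean, so density can be shown in
  stages.\<close>

lemma approximable_limit:
  assumes f: "f \<in> borel_measurable N"
    and g: "\<And>e. e > 0 \<Longrightarrow> \<exists>g\<in>approximable. l2dist N f g < ennreal e"
  shows "f \<in> approximable"
  unfolding approximable_def
proof (intro CollectI conjI f allI impI)
  fix e :: real assume e: "e > 0"
  then obtain g where g: "g \<in> approximable" "l2dist N f g < ennreal (e / 4)"
    using assms(2)[of "e / 4"] by auto
  then obtain p where p: "p \<in> trig" "l2dist N g p < ennreal (e / 4)"
    using e unfolding approximable_def by (smt (verit) mem_Collect_eq divide_pos_pos)
  have "l2dist N f p \<le> 2 * l2dist N f g + 2 * l2dist N g p"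
    by (rule l2dist_triangle[OF f approximable_meas[OF g(1)] trig_meas_N[OF p(1)]])
  also have "\<dots> < ennreal e" by (rule two_quarters_less[OF e g(2) p(2)])
  finally show "\<exists>p\<in>trig. l2dist N f p < ennreal e" using p(1) by blast
qed

lemma approximable_add:
  assumes f: "f \<in> approximable" and g: "g \<in> approximable"
  shows "(\<lambda>z. f z + g z) \<in> approximable"
  unfolding approximable_def
proof (intro CollectI conjI allI impI)
  show "(\<lambda>z. f z + g z) \<in> borel_measurable N"
    using approximable_meas[OF f] approximable_meas[OF g] by (rule borel_measurable_add)
  fix e :: real assume e: "e > 0"
  then have e4: "e / 4 > 0" by simp
  obtain p where p: "p \<in> trig" "l2dist N f p < ennreal (e / 4)"
    using f e4 unfolding approximable_def by blast
  obtain q where q: "q \<in> trig" "l2dist N g q < ennreal (e / 4)"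
    using g e4 unfolding approximable_def by blast
  have "l2dist N (\<lambda>z. f z + g z) (\<lambda>z. p z + q z) \<le> 2 * l2dist N f p + 2 * l2dist N g q"
    by (rule l2dist_add[OF approximable_meas[OF f] trig_meas_N[OF p(1)] approximable_meas[OF g] trig_meas_N[OF q(1)]])
  also have "\<dots> < ennreal e" by (rule two_quarters_less[OF e p(2) q(2)])
  finally show "\<exists>p\<in>trig. l2dist N (\<lambda>z. f z + g z) p < ennreal e"
    by (rule bexI[OF _ trig.add[OF p(1) q(1)]])
qed

lemma l2dist_smult:
  assumes "f \<in> borel_measurable N" "g \<in> borel_measurable N"
  shows "l2dist N (\<lambda>z. c * f z) (\<lambda>z. c * g z) = ennreal ((cmod c)\<^sup>2) * l2dist N f g"
proof -
  have "(cmod (c * f z - c * g z))\<^sup>2 = (cmod c)\<^sup>2 * (cmod (f z - g z))\<^sup>2" for z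
    by (simp add: norm_mult power_mult_distrib flip: right_diff_distrib)
  then show ?thesis
    using assms by (simp add: l2dist_def ennreal_mult nn_integral_cmult)
qed

lemma approximable_smult:
  assumes f: "f \<in> approximable"
  shows "(\<lambda>z. c * f z) \<in> approximable"
  unfolding approximable_def
proof (intro CollectI conjI allI impI)
  show "(\<lambda>z. c * f z) \<in> borel_measurable N"
    using approximable_meas[OF f] by simp
  fix e :: real assume e: "e > 0"
  define d where "d = e / ((cmod c)\<^sup>2 + 1)"
  have d: "d > 0" using e by (simp add: d_def add_nonneg_pos)
  then obtain p where p: "p \<in> trig" "l2dist N f p < ennreal d"
    using f unfolding approximable_def by blast
  have "l2dist N (\<lambda>z. c * f z) (\<lambda>z. c * p z) = ennreal ((cmod c)\<^sup>2) * l2dist N f p"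
    by (rule l2dist_smult[OF approximable_meas[OF f] trig_meas_N[OF p(1)]])
  also have "\<dots> \<le> ennreal ((cmod c)\<^sup>2) * ennreal d"
    using p(2) by (intro mult_left_mono) auto
  also have "\<dots> = ennreal ((cmod c)\<^sup>2 * d)" using d by (simp add: ennreal_mult)
  also have "\<dots> < ennreal e"
  proof (rule ennreal_lessI[OF e])
    have "(cmod c)\<^sup>2 + 1 > 0" by (simp add: add_nonneg_pos)
    then have "((cmod c)\<^sup>2 + 1) * d = e" by (simp add: d_def)
    then show "(cmod c)\<^sup>2 * d < e" using d by (simp add: distrib_right)
  qed
  finally have "l2dist N (\<lambda>z. c * f z) (\<lambda>z. c * p z) < ennreal e" .
  then show "\<exists>p\<in>trig. l2dist N (\<lambda>z. c * f z) p < ennreal e"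
    by (rule bexI[OF _ trig.smult[OF p(1)]])
qed

lemma approximable_continuous:
  fixes f :: "complex \<Rightarrow> real"
  assumes f: "continuous_on UNIV f"
  shows "(\<lambda>z. complex_of_real (f z)) \<in> approximable"
  unfolding approximable_def
proof (intro CollectI conjI allI impI)
  show "(\<lambda>z. complex_of_real (f z)) \<in> borel_measurable N"
    using borel_measurable_continuous_onI[OF f] by simp
  fix e :: real assume e: "e > 0"
  \<comment> \<open>The summand 1 covers the zero measure and makes the mass times
    \<open>e / K\<close> strictly smaller than \<open>e\<close>.\<close>
  define K where "K = measure N (space N) + 1"
  have K: "K > 0" by (simp add: K_def add_nonneg_pos)
  define d where "d = sqrt (e / K)"
  have d: "d > 0" "d\<^sup>2 = e / K" using e K by (simp_all add: d_def)
  have "continuous_on (sphere 0 1) f" using f continuous_on_subset by blast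
  then obtain q where q: "real_polynomial_function q" "\<And>z. z \<in> sphere 0 1 \<Longrightarrow> \<bar>f z - q z\<bar> < d"
    using Stone_Weierstrass_real_polynomial_function[OF compact_sphere _ d(1)] by metis
  obtain p where p: "p \<in> trig" "\<And>z. cmod z = 1 \<Longrightarrow> complex_of_real (q z) = p z"
    using real_polynomial_circle_trig[OF q(1)] by (auto simp: circle_trig_def)
  have "l2dist N (\<lambda>z. complex_of_real (f z)) p \<le> (\<integral>\<^sup>+z. ennreal (d\<^sup>2) \<partial>N)"
    unfolding l2dist_def
  proof (rule nn_integral_mono_AE)
    show "AE z in N. ennreal ((cmod (complex_of_real (f z) - p z))\<^sup>2) \<le> ennreal (d\<^sup>2)"
      using AE_circle
    proof eventually_elim
      case (elim z)
      have "complex_of_real (f z) - p z = of_real (f z - q z)" using p(2)[OF elim] by simp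
      then have "cmod (complex_of_real (f z) - p z) = \<bar>f z - q z\<bar>" by (simp only: norm_of_real)
      also have "\<dots> \<le> d" using q(2)[of z] elim by simp
      finally show ?case by (intro ennreal_leI power_mono) auto
    qed
  qed
  also have "\<dots> = ennreal (e / K * measure N (space N))"
    using e K by (simp add: d(2) emeasure_eq_measure flip: ennreal_mult)
  also have "\<dots> < ennreal e"
    by (rule ennreal_lessI[OF e]) (use e K in \<open>simp add: K_def field_simps\<close>)
  finally have "l2dist N (\<lambda>z. complex_of_real (f z)) p < ennreal e" .
  then show "\<exists>p\<in>trig. l2dist N (\<lambda>z. complex_of_real (f z)) p < ennreal e"
    using p(1) by blast
qed

text \<open>Dominated convergence for the squared errors, combined with
  \<open>approximable_limit\<close>.\<close>

lemma approximable_dominated_limit: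
  assumes f: "f \<in> borel_measurable N" and F: "\<And>m. F m \<in> approximable"
    and w: "w \<in> borel_measurable N" "\<And>m z. cmod (f z - F m z) \<le> w z" "(\<integral>\<^sup>+z. ennreal ((w z)\<^sup>2) \<partial>N) < \<infinity>"
    and lim: "\<And>z. z \<in> space N \<Longrightarrow> (\<lambda>m. F m z) \<longlonglongrightarrow> f z"
  shows "f \<in> approximable"
proof (rule approximable_limit[OF f])
  fix e :: real assume e: "e > 0"
  have [measurable]: "F m \<in> borel_measurable N" for m by (rule approximable_meas[OF F])
  note [measurable] = f w(1)
  have "(\<lambda>m. l2dist N f (F m)) \<longlonglongrightarrow> (\<integral>\<^sup>+z. 0 \<partial>N)"
    unfolding l2dist_def
  proof (rule nn_integral_dominated_convergence[where w = "\<lambda>z. ennreal ((w z)\<^sup>2)"])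
    show "AE z in N. ennreal ((cmod (f z - F m z))\<^sup>2) \<le> ennreal ((w z)\<^sup>2)" for m
      using w(2) by (intro AE_I2 ennreal_leI power_mono) auto
    show "AE z in N. (\<lambda>m. ennreal ((cmod (f z - F m z))\<^sup>2)) \<longlonglongrightarrow> 0"
    proof (rule AE_I2)
      fix z assume "z \<in> space N"
      from lim[OF this] have "(\<lambda>m. ennreal ((cmod (f z - F m z))\<^sup>2)) \<longlonglongrightarrow> ennreal ((cmod (f z - f z))\<^sup>2)"
        by (intro tendsto_intros)
      then show "(\<lambda>m. ennreal ((cmod (f z - F m z))\<^sup>2)) \<longlonglongrightarrow> 0" by simp
    qed
  qed (use w(3) in auto)
  then have "\<forall>\<^sub>F m in sequentially. l2dist N f (F m) < ennreal e"
    using e by (intro order_tendstoD(2)) auto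
  then obtain m where "l2dist N f (F m) < ennreal e" by (auto simp: eventually_sequentially)
  then show "\<exists>g\<in>approximable. l2dist N f g < ennreal e" using F by blast
qed

lemma approximable_indicator_compact:
  assumes K: "compact K"
  shows "(\<lambda>z. complex_of_real (indicator K z)) \<in> approximable"
\<comment> \<open>The distance to the empty set is 0 by convention, so the functions
  \<open>F m\<close> below would be constantly 1.\<close>
proof (cases "K = {}")
  case True
  then show ?thesis using approximable_continuous[of "\<lambda>_. 0"] by simp
next
  case False
  have Kb [measurable]: "K \<in> sets N" using K by (simp add: sets_N borel_compact)
  \<comment> \<open>Continuous functions equal to 1 on \<open>K\<close> and, for positive
    \<open>m\<close>, vanishing at distance at least 1/m from it.\<close>
  define F where "F m z = max 0 (1 - real m * infdist z K)" for m z
  have F: "0 \<le> F m z" "F m z \<le> 1" for m z by (auto simp: F_def infdist_nonneg)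
  show ?thesis
  proof (rule approximable_dominated_limit[where F = "\<lambda>m z. complex_of_real (F m z)" and w = "\<lambda>_. 1"])
    show "(\<lambda>z. complex_of_real (F m z)) \<in> approximable" for m
      by (rule approximable_continuous) (auto simp: F_def intro!: continuous_intros)
    show "cmod (complex_of_real (indicator K z) - complex_of_real (F m z)) \<le> 1" for m z
      unfolding of_real_diff[symmetric] norm_of_real using F[of m z] by (auto simp: indicator_def)
    show "(\<lambda>m. complex_of_real (F m z)) \<longlonglongrightarrow> complex_of_real (indicator K z)" for z
    proof (cases "z \<in> K")
      case True
      then show ?thesis by (simp add: F_def)
    next
      case out: False
      then have pos: "infdist z K > 0"
        using False K compact_imp_closed in_closed_iff_infdist_zero[of K z] infdist_nonneg[of z K] by force
      obtain m0 :: nat where m0: "real m0 > 1 / infdist z K" using reals_Archimedean2 by blast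
      have "\<forall>\<^sub>F m in sequentially. F m z = 0"
        using eventually_ge_at_top[of m0]
      proof eventually_elim
        case (elim m)
        then have "real m > 1 / infdist z K" using m0 by linarith
        then show ?case using pos by (simp add: F_def field_simps)
      qed
      then have "(\<lambda>m. complex_of_real (F m z)) \<longlonglongrightarrow> 0"
        by (intro tendsto_eventually) (auto elim: eventually_mono)
      then show ?thesis using out by simp
    qed
  qed (auto simp: emeasure_eq_measure)
qed

lemma approximable_indicator:
  assumes B: "B \<in> sets N"
  shows "(\<lambda>z. complex_of_real (indicator B z)) \<in> approximable"
proof (rule approximable_limit)
  note [measurable] = B
  show "(\<lambda>z. complex_of_real (indicator B z)) \<in> borel_measurable N" by measurable
  fix e :: real assume e: "e > 0"
  have Bb: "B \<in> sets borel" using B by (simp add: sets_N)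
  show "\<exists>g\<in>approximable. l2dist N (\<lambda>z. complex_of_real (indicator B z)) g < ennreal e"
  \<comment> \<open>A set of mass below \<open>e\<close> is approximated by 0; otherwise
    \<open>measure N B - e\<close> is nonnegative and inner regularity provides a compact subset of
    larger mass.\<close>
  proof (cases "emeasure N B < ennreal e")
    case True
    have "l2dist N (\<lambda>z. complex_of_real (indicator B z)) (\<lambda>z. 0) = (\<integral>\<^sup>+z. indicator B z \<partial>N)"
      unfolding l2dist_def by (intro nn_integral_cong) (simp add: indicator_def)
    then have "l2dist N (\<lambda>z. complex_of_real (indicator B z)) (\<lambda>z. 0) < ennreal e"
      using True by simp
    moreover have "(\<lambda>z. 0) \<in> approximable" using approximable_continuous[of "\<lambda>_. 0"] by simp
    ultimately show ?thesis by blast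
  next
    case False
    then have pos: "measure N B \<ge> e" using e by (simp add: emeasure_eq_measure not_less)
    have "ennreal (measure N B - e) < emeasure N B"
      using pos e by (simp add: emeasure_eq_measure ennreal_lessI)
    also have "\<dots> = (SUP K \<in> {K. K \<subseteq> B \<and> compact K}. emeasure N K)"
      by (rule inner_regular[OF sets_N _ Bb]) simp
    finally have "ennreal (measure N B - e) < (SUP K \<in> {K. K \<subseteq> B \<and> compact K}. emeasure N K)" .
    then obtain K where K: "K \<subseteq> B" "compact K" "ennreal (measure N B - e) < emeasure N K"
      by (auto simp: less_SUP_iff)
    have [measurable]: "K \<in> sets N" using K(2) by (simp add: sets_N borel_compact)
    have m: "measure N B - e < measure N K"
      using K(3) pos by (simp add: emeasure_eq_measure ennreal_less_iff)
    have "l2dist N (\<lambda>z. complex_of_real (indicator B z)) (\<lambda>z. complex_of_real (indicator K z)) =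
        (\<integral>\<^sup>+z. indicator (B - K) z \<partial>N)"
      unfolding l2dist_def using K(1) by (intro nn_integral_cong) (auto simp: indicator_def)
    also have "\<dots> = ennreal (measure N B - measure N K)"
      using K(1) B by (simp add: emeasure_eq_measure finite_measure_Diff)
    also have "\<dots> < ennreal e" by (rule ennreal_lessI[OF e]) (use m in simp)
    finally have "l2dist N (\<lambda>z. complex_of_real (indicator B z)) (\<lambda>z. complex_of_real (indicator K z)) < ennreal e" .
    then show ?thesis using approximable_indicator_compact[OF K(2)] by blast
  qed
qed

text \<open>Induction over measurable functions; square integrability passes to the summands and to
  the approximating sequence because they are dominated by the given function.\<close>

lemma approximable_nonneg:
  assumes "u \<in> borel_measurable N" "\<And>z. 0 \<le> u z" "(\<integral>\<^sup>+z. ennreal ((u z)\<^sup>2) \<partial>N) < \<infinity>"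
  shows "(\<lambda>z. complex_of_real (u z)) \<in> approximable"
  using assms
proof (induction rule: borel_measurable_induct_real)
  case (set A)
  then show ?case by (simp add: approximable_indicator)
next
  case (mult u c)
  show ?case
  \<comment> \<open>For \<open>c = 0\<close> the integrability of the product says nothing about
    \<open>u\<close>.\<close>
  proof (cases "c = 0")
    case True
    then show ?thesis using approximable_continuous[of "\<lambda>_. 0"] by simp
  next
    case False
    have "(\<integral>\<^sup>+z. ennreal ((c * u z)\<^sup>2) \<partial>N) = ennreal (c\<^sup>2) * (\<integral>\<^sup>+z. ennreal ((u z)\<^sup>2) \<partial>N)"
      using mult.hyps by (simp add: power_mult_distrib ennreal_mult nn_integral_cmult)
    then have "(\<integral>\<^sup>+z. ennreal ((u z)\<^sup>2) \<partial>N) < \<infinity>"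
      using mult.prems False by (auto simp: ennreal_mult_less_top)
    then have "(\<lambda>z. complex_of_real (u z)) \<in> approximable" by (rule mult.IH)
    then show ?thesis using approximable_smult[of "\<lambda>z. complex_of_real (u z)" "of_real c"] by simp
  qed
next
  case (add u v)
  have "(\<integral>\<^sup>+z. ennreal ((u z)\<^sup>2) \<partial>N) \<le> (\<integral>\<^sup>+z. ennreal ((v z + u z)\<^sup>2) \<partial>N)"
    using add.hyps by (intro nn_integral_mono ennreal_leI power_mono) auto
  then have u: "(\<lambda>z. complex_of_real (u z)) \<in> approximable"
    using add.prems by (intro add.IH) (auto intro: order_le_less_trans)
  have "(\<integral>\<^sup>+z. ennreal ((v z)\<^sup>2) \<partial>N) \<le> (\<integral>\<^sup>+z. ennreal ((v z + u z)\<^sup>2) \<partial>N)"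
    using add.hyps by (intro nn_integral_mono ennreal_leI power_mono) auto
  then have v: "(\<lambda>z. complex_of_real (v z)) \<in> approximable"
    using add.prems by (intro add.IH) (auto intro: order_le_less_trans)
  show ?case using approximable_add[OF v u] by simp
next
  case (seq U)
  have lim: "(\<lambda>i. U i z) \<longlonglongrightarrow> u z" for z
    using seq.hyps by (simp add: space_N)
  have le: "U i z \<le> u z" for i z
    using seq.hyps(3) lim[of z] by (intro incseq_le) (auto simp: incseq_def le_fun_def)
  have U0: "0 \<le> U i z" for i z by (rule seq.hyps)
  have F: "(\<lambda>z. complex_of_real (U i z)) \<in> approximable" for i
  proof (rule seq.IH)
    have "(\<integral>\<^sup>+z. ennreal ((U i z)\<^sup>2) \<partial>N) \<le> (\<integral>\<^sup>+z. ennreal ((u z)\<^sup>2) \<partial>N)"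
      using le U0 by (intro nn_integral_mono ennreal_leI power_mono) auto
    then show "(\<integral>\<^sup>+z. ennreal ((U i z)\<^sup>2) \<partial>N) < \<infinity>"
      using seq.prems by (auto intro: order_le_less_trans)
  qed
  have "u \<in> borel_measurable N"
    by (rule borel_measurable_LIMSEQ_real[of N U]) (use lim seq.hyps(1) in auto)
  then show ?case
  proof (intro approximable_dominated_limit[where w = u, OF _ F])
    show "cmod (complex_of_real (u z) - complex_of_real (U m z)) \<le> u z" for m z
      unfolding of_real_diff[symmetric] norm_of_real using le[of m z] U0[of m z] by simp
    show "(\<lambda>m. complex_of_real (U m z)) \<longlonglongrightarrow> complex_of_real (u z)" for z
      using lim by (rule tendsto_of_real)
  qed (use seq.prems in auto)
qed

text \<open>Positive and negative parts of the real and imaginary parts are all dominated by the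
  modulus of \<open>f\<close>.\<close>

lemma approximable_sq_integrable:
  assumes f: "f \<in> borel_measurable N" and fin: "(\<integral>\<^sup>+z. ennreal ((cmod (f z))\<^sup>2) \<partial>N) < \<infinity>"
  shows "f \<in> approximable"
proof -
  have real: "(\<lambda>z. complex_of_real (u z)) \<in> approximable"
    if u: "u \<in> borel_measurable N" and le: "\<And>z. \<bar>u z\<bar> \<le> cmod (f z)" for u :: "complex \<Rightarrow> real"
  proof -
    have part: "(\<lambda>z. complex_of_real (v z)) \<in> approximable"
      if "v \<in> borel_measurable N" "\<And>z. 0 \<le> v z" "\<And>z. v z \<le> cmod (f z)" for v :: "complex \<Rightarrow> real"
    proof (rule approximable_nonneg[OF that(1,2)])
      have "(\<integral>\<^sup>+z. ennreal ((v z)\<^sup>2) \<partial>N) \<le> (\<integral>\<^sup>+z. ennreal ((cmod (f z))\<^sup>2) \<partial>N)"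
        using that by (intro nn_integral_mono ennreal_leI power_mono) auto
      then show "(\<integral>\<^sup>+z. ennreal ((v z)\<^sup>2) \<partial>N) < \<infinity>" using fin by (rule order_le_less_trans)
    qed
    have "(\<lambda>z. complex_of_real (u z)) =
        (\<lambda>z. complex_of_real (max 0 (u z)) + (- 1) * complex_of_real (max 0 (- u z)))"
      by (intro ext) (simp add: max_def)
    moreover have "\<dots> \<in> approximable"
    proof (intro approximable_add approximable_smult part)
      show "max 0 (u z) \<le> cmod (f z)" "max 0 (- u z) \<le> cmod (f z)" for z
        using le[of z] by auto
    qed (use u in auto)
    ultimately show ?thesis by simp
  qed
  have "(\<lambda>z. complex_of_real (Re (f z)) + \<i> * complex_of_real (Im (f z))) \<in> approximable"
    using f by (intro approximable_add approximable_smult real)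
      (auto simp: abs_Re_le_cmod abs_Im_le_cmod)
  then show ?thesis by (simp flip: complex_eq)
qed

end

text \<open>Finitely supported families of trigonometric polynomials. The generators are the vectors
  of single Weyl elements and the rules are those of \<open>weyl_span\<close>, so the same induction
  passes between the two in either direction.\<close>

inductive_set trig_fams :: "(int \<Rightarrow> complex \<Rightarrow> complex) set" where
  powi: "(\<lambda>m z. if m = n then z powi k else 0) \<in> trig_fams"
| smult: "p \<in> trig_fams \<Longrightarrow> (\<lambda>m z. c * p m z) \<in> trig_fams"
| add: "\<lbrakk>p \<in> trig_fams; q \<in> trig_fams\<rbrakk> \<Longrightarrow> (\<lambda>m z. p m z + q m z) \<in> trig_fams"

lemma trig_fams_single: "p \<in> trig \<Longrightarrow> (\<lambda>m z. if m = n then p z else 0) \<in> trig_fams"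
proof (induction rule: trig.induct)
  case (powi k)
  show ?case by (rule trig_fams.powi)
next
  case (smult p c)
  have "(\<lambda>m z. if m = n then c * p z else 0) = (\<lambda>m z. c * (if m = n then p z else 0))"
    by (simp add: fun_eq_iff)
  then show ?case using trig_fams.smult[OF smult.IH] by simp
next
  case (add p q)
  have "(\<lambda>m z. if m = n then p z + q z else 0) =
      (\<lambda>m z. (if m = n then p z else 0) + (if m = n then q z else 0))"
    by (simp add: fun_eq_iff)
  then show ?case using trig_fams.add[OF add.IH] by simp
qed

lemma trig_fams_finite:
  assumes "finite F" "\<And>m. m \<in> F \<Longrightarrow> P m \<in> trig"
  shows "(\<lambda>m z. if m \<in> F then P m z else 0) \<in> trig_fams"
  using assms
proof (induction F rule: finite_induct)
  case empty
  show ?case using trig_fams.smult[OF trig_fams.powi, of 0] by simp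
next
  case (insert n F)
  have "(\<lambda>m z. if m \<in> insert n F then P m z else 0) =
      (\<lambda>m z. (if m = n then P n z else 0) + (if m \<in> F then P m z else 0))"
    using insert.hyps by (auto simp: fun_eq_iff)
  then show ?case
    using trig_fams.add[OF trig_fams_single insert.IH] insert.prems by simp
qed

text \<open>Transfer to the plane: the measure is pushed forward along the inclusion of the circle,
  and \<open>f\<close> is extended by 0.\<close>

lemma trig_dense:
  assumes N: "finite_measure N" "sets N = sets circle_space"
    and f: "f \<in> borel_measurable N" "(\<integral>\<^sup>+z. ennreal ((cmod (f z))\<^sup>2) \<partial>N) < \<infinity>"
    and e: "e > 0"
  shows "\<exists>p\<in>trig. (\<integral>\<^sup>+z. ennreal ((cmod (f z - p z))\<^sup>2) \<partial>N) < ennreal e"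
proof -
  let ?S = "sphere 0 1 :: complex set"
  have spN: "space N = ?S"
    using sets_eq_imp_space_eq[OF N(2)] by (simp add: circle_space_def space_restrict_space)
  have id [measurable]: "(\<lambda>z. z) \<in> measurable N borel"
    by (subst measurable_cong_sets[OF N(2) refl]) (simp add: circle_space_def measurable_restrict_space1)
  define N' where "N' = distr N borel (\<lambda>z. z)"
  interpret N': circle_borel_measure N'
  proof (intro circle_borel_measure.intro circle_borel_measure_axioms.intro)
    show "finite_measure N'" unfolding N'_def by (rule finite_measure.finite_measure_distr[OF N(1) id])
    show "sets N' = sets borel" by (simp add: N'_def)
    have "AE z in N. cmod z = 1" by (rule AE_I2) (simp add: spN)
    then show "AE z in N'. cmod z = 1" unfolding N'_def by (subst AE_distr_iff) auto
  qed
  define f' where "f' z = (if z \<in> ?S then f z else 0)" for z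
  have "f \<in> borel_measurable (restrict_space borel ?S)"
    using f(1) unfolding measurable_cong_sets[OF N(2) refl] circle_space_def .
  then have f'm: "f' \<in> borel_measurable borel"
    unfolding f'_def by (subst (asm) measurable_restrict_space_iff[where c = 0]) auto
  have eq: "(\<integral>\<^sup>+z. ennreal ((cmod (f' z - p z))\<^sup>2) \<partial>N') = (\<integral>\<^sup>+z. ennreal ((cmod (f z - p z))\<^sup>2) \<partial>N)"
    if "p \<in> borel_measurable borel" for p
    unfolding N'_def using f'm that
    by (subst nn_integral_distr) (simp_all, intro nn_integral_cong, simp add: f'_def spN)
  have "f' \<in> N'.approximable"
  proof (rule N'.approximable_sq_integrable)
    show "f' \<in> borel_measurable N'" using f'm by (simp add: N'_def)
    show "(\<integral>\<^sup>+z. ennreal ((cmod (f' z))\<^sup>2) \<partial>N') < \<infinity>" using eq[of "\<lambda>_. 0"] f(2) by simp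
  qed
  then obtain p where p: "p \<in> trig" "l2dist N' f' p < ennreal e"
    using e unfolding N'.approximable_def by blast
  then show ?thesis using eq[OF trig_measurable[OF p(1)]] by (auto simp: l2dist_def)
qed

text \<open>The components outside a finite set contribute little and are replaced by 0; the
  finitely many others are approximated one by one.\<close>

lemma trig_fams_dense:
  assumes N: "\<And>n. finite_measure (N n)" "\<And>n. sets (N n) = sets circle_space"
    and x: "x \<in> l2fam N" and e: "e > 0"
  shows "\<exists>p\<in>trig_fams. sqsum N (\<lambda>n z. x n z - p n z) < ennreal e"
proof -
  define a where "a n = (\<integral>\<^sup>+z. ennreal ((cmod (x n z))\<^sup>2) \<partial>N n)" for n
  have a: "(\<integral>\<^sup>+n. a n \<partial>count_space UNIV) < \<infinity>"
    using x by (simp add: l2fam_def sqsum_def a_def)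
  have fin: "a n < \<infinity>" for n
    using l2fam_component[OF x, of n] by (simp add: a_def sq_integrable_iff)
  have "(\<lambda>m. \<integral>\<^sup>+n. a n * indicator (- {- int m..int m}) n \<partial>count_space UNIV) \<longlonglongrightarrow> (\<integral>\<^sup>+(n::int). 0 \<partial>count_space UNIV)"
  proof (rule nn_integral_dominated_convergence[where w = a])
    show "AE n in count_space UNIV. (\<lambda>m. a n * indicator (- {- int m..int m}) n) \<longlonglongrightarrow> 0"
    proof (rule AE_I2)
      fix n :: int
      have "\<forall>\<^sub>F m in sequentially. a n * indicator (- {- int m..int m}) n = 0"
        using eventually_ge_at_top[of "nat \<bar>n\<bar>"] by eventually_elim (auto simp: indicator_def)
      then show "(\<lambda>m. a n * indicator (- {- int m..int m}) n) \<longlonglongrightarrow> 0" by (rule tendsto_eventually)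
    qed
  qed (use a in \<open>auto simp: indicator_def\<close>)
  then have "\<forall>\<^sub>F m in sequentially. (\<integral>\<^sup>+n. a n * indicator (- {- int m..int m}) n \<partial>count_space UNIV) < ennreal (e / 2)"
    using e by (intro order_tendstoD(2)) auto
  then obtain m where m: "(\<integral>\<^sup>+n. a n * indicator (- {- int m..int m}) n \<partial>count_space UNIV) < ennreal (e / 2)"
    by (auto simp: eventually_sequentially)
  define F where "F = {- int m..int m}"
  have F: "finite F" "card F > 0" by (simp_all add: F_def)
  \<comment> \<open>Half of \<open>e\<close> is shared equally among the components in
    \<open>F\<close>; the other half bounds the tail.\<close>
  define d where "d = e / (2 * real (card F))"
  have d: "d > 0" "real (card F) * d = e / 2" using e F by (auto simp: d_def)
  have "\<exists>p\<in>trig. (\<integral>\<^sup>+z. ennreal ((cmod (x n z - p z))\<^sup>2) \<partial>N n) < ennreal d" for n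
    by (rule trig_dense[OF N l2fam_measurable[OF x] _ d(1)]) (use fin in \<open>simp add: a_def\<close>)
  then obtain P where P: "\<And>n. P n \<in> trig" "\<And>n. (\<integral>\<^sup>+z. ennreal ((cmod (x n z - P n z))\<^sup>2) \<partial>N n) < ennreal d"
    by metis
  define p where "p = (\<lambda>n z. if n \<in> F then P n z else 0)"
  have "(\<integral>\<^sup>+z. ennreal ((cmod (x n z - p n z))\<^sup>2) \<partial>N n) \<le> ennreal d * indicator F n + a n * indicator (- F) n" for n
    using P(2)[of n] by (cases "n \<in> F") (simp_all add: p_def a_def)
  then have "sqsum N (\<lambda>n z. x n z - p n z) \<le> (\<integral>\<^sup>+n. ennreal d * indicator F n + a n * indicator (- F) n \<partial>count_space UNIV)"
    unfolding sqsum_def by (intro nn_integral_mono)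
  also have "\<dots> = (\<integral>\<^sup>+n. ennreal d * indicator F n \<partial>count_space UNIV) + (\<integral>\<^sup>+n. a n * indicator (- F) n \<partial>count_space UNIV)"
    by (rule nn_integral_add) auto
  also have "(\<integral>\<^sup>+n. ennreal d * indicator F n \<partial>count_space UNIV) = ennreal (real (card F)) * ennreal d"
    using F by (simp add: nn_integral_cmult_indicator ennreal_of_nat_eq_real_of_nat mult.commute)
  also have "\<dots> = ennreal (e / 2)"
    unfolding d(2)[symmetric] using d(1) by (simp only: ennreal_mult of_nat_0_le_iff less_imp_le)
  finally have le: "sqsum N (\<lambda>n z. x n z - p n z) \<le> ennreal (e / 2) + (\<integral>\<^sup>+n. a n * indicator (- F) n \<partial>count_space UNIV)" .
  obtain r where r: "(\<integral>\<^sup>+n. a n * indicator (- F) n \<partial>count_space UNIV) = ennreal r" "0 \<le> r"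
    using m unfolding F_def[symmetric] by (cases "\<integral>\<^sup>+n. a n * indicator (- F) n \<partial>count_space UNIV") auto
  have "r < e / 2" using m r(2) unfolding F_def[symmetric] r(1) by (simp add: ennreal_less_iff)
  then have "ennreal (e / 2) + ennreal r < ennreal e"
    using e r(2) by (simp add: ennreal_plus[symmetric] ennreal_less_iff del: ennreal_plus)
  then have "sqsum N (\<lambda>n z. x n z - p n z) < ennreal e"
    using le unfolding r(1) by (rule order_le_less_trans[rotated])
  moreover have "p \<in> trig_fams" unfolding p_def by (rule trig_fams_finite[OF F(1) P(1)])
  ultimately show ?thesis by blast
qed

section \<open>Weyl elements span a dense subalgebra\<close>

context unital_cstar_algebra
begin

sublocale R: ring A by (rule is_ring)
sublocale V: complex_module A using is_module by (simp add: complex_module_def)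

lemma cnorm_minus: "a \<in> carrier A \<Longrightarrow> cnorm A (\<ominus> a) = cnorm A a"
  using cnorm_smult[of a "- 1"] by (simp add: V.a_inv_eq_smult)

lemma cnorm_diff_commute: "\<lbrakk>a \<in> carrier A; b \<in> carrier A\<rbrakk> \<Longrightarrow> cnorm A (a \<ominus> b) = cnorm A (b \<ominus> a)"
  using cnorm_minus[of "a \<ominus> b"] by (simp add: R.minus_add a_minus_def R.a_comm)

lemma cnorm_triangle_diff:
  assumes "a \<in> carrier A" "b \<in> carrier A" "c \<in> carrier A"
  shows "cnorm A (a \<ominus> c) \<le> cnorm A (a \<ominus> b) + cnorm A (b \<ominus> c)"
proof -
  have "(a \<ominus> b) \<oplus> (b \<ominus> c) = a \<ominus> c"
    using assms by (simp add: a_minus_def R.a_assoc R.r_neg1)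
  then show ?thesis using cnorm_triangle[of "a \<ominus> b" "b \<ominus> c"] assms by simp
qed

text \<open>The C*-identity and submultiplicativity bound the norm of an element by that of its
  adjoint; applied to the adjoint, this gives the reverse inequality.\<close>

lemma cnorm_star: "a \<in> carrier A \<Longrightarrow> cnorm A (star A a) = cnorm A a"
proof -
  have le: "cnorm A a \<le> cnorm A (star A a)" if a: "a \<in> carrier A" for a
  proof (cases "cnorm A a = 0")
    case True
    then show ?thesis using cnorm_nonneg[OF star_closed[OF a]] by simp
  next
    case False
    have "cnorm A a * cnorm A a \<le> cnorm A (star A a) * cnorm A a"
      using cstar_identity[OF a] cnorm_mult[OF star_closed[OF a] a] by (simp add: power2_eq_square)
    then show ?thesis using False cnorm_nonneg[OF a] by simp
  qed
  assume a: "a \<in> carrier A"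
  then show ?thesis using le[OF a] le[OF star_closed[OF a]] by (simp add: star_star)
qed

lemma star_diff: "\<lbrakk>a \<in> carrier A; b \<in> carrier A\<rbrakk> \<Longrightarrow> star A (a \<ominus> b) = star A a \<ominus> star A b"
  by (simp add: V.diff_eq_smult star_add star_smult star_closed)

sublocale Met: Metric_space "carrier A" "cstar_dist A"
proof
  fix x y z assume c: "x \<in> carrier A" "y \<in> carrier A"
  have "cnorm A (x \<ominus> y) = 0 \<longleftrightarrow> x = y"
    using c by (simp add: cnorm_eq_0 R.r_right_minus_eq)
  then show "cstar_dist A x y = 0 \<longleftrightarrow> x = y" using c by (simp add: cstar_dist_def)
  assume "z \<in> carrier A"
  then show "cstar_dist A x z \<le> cstar_dist A x y + cstar_dist A y z"
    using c cnorm_triangle_diff[of x y z] by (simp add: cstar_dist_def)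
qed (auto simp: cstar_dist_def cnorm_nonneg cnorm_diff_commute)

lemma one_adjoint: "star A \<one> = \<one>"
proof -
  have "star A \<one> = star A \<one> \<otimes> \<one>" by (simp add: star_closed)
  also have "\<dots> = star A (star A \<one> \<otimes> \<one>)" using star_mult[of "star A \<one>" \<one>] by (simp add: star_closed star_star)
  also have "\<dots> = \<one>" by (simp add: star_closed star_star)
  finally show ?thesis .
qed

lemma unitary_Units:
  assumes "cstar_unitary A u"
  shows "u \<in> Units A" "inv u = star A u"
proof -
  have u: "u \<in> carrier A" "star A u \<otimes> u = \<one>" "u \<otimes> star A u = \<one>"
    using assms by (auto simp: cstar_unitary_def)
  show "u \<in> Units A"
    unfolding Units_def using u star_closed[OF u(1)] by blast
  show "inv u = star A u"
    using R.inv_unique'[OF u(1) star_closed[OF u(1)] u(3,2)] by simp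
qed

lemma unitary_mult:
  assumes "cstar_unitary A u" "cstar_unitary A v"
  shows "cstar_unitary A (u \<otimes> v)"
proof -
  have u: "u \<in> carrier A" "star A u \<otimes> u = \<one>" "u \<otimes> star A u = \<one>"
    and v: "v \<in> carrier A" "star A v \<otimes> v = \<one>" "v \<otimes> star A v = \<one>"
    using assms by (auto simp: cstar_unitary_def)
  note c = star_closed[OF u(1)] star_closed[OF v(1)]
  have "(star A v \<otimes> star A u) \<otimes> (u \<otimes> v) = star A v \<otimes> ((star A u \<otimes> u) \<otimes> v)"
    using u(1) v(1) c by (simp add: R.m_assoc)
  moreover have "(u \<otimes> v) \<otimes> (star A v \<otimes> star A u) = u \<otimes> ((v \<otimes> star A v) \<otimes> star A u)"
    using u(1) v(1) c by (simp add: R.m_assoc)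
  ultimately show ?thesis
    using u v c by (simp add: cstar_unitary_def star_mult)
qed

lemma unitary_star: "cstar_unitary A u \<Longrightarrow> cstar_unitary A (star A u)"
  by (simp add: cstar_unitary_def star_closed star_star)

lemma unitary_one: "cstar_unitary A \<one>"
  by (simp add: cstar_unitary_def one_adjoint)

lemma unitary_nat_pow: "cstar_unitary A u \<Longrightarrow> cstar_unitary A (u [^] (n::nat))"
  by (induction n) (simp_all add: unitary_one unitary_mult)

lemma unitary_int_pow:
  assumes u: "cstar_unitary A u"
  shows "cstar_unitary A (u [^] (k::int))"
proof (cases "k < 0")
  case True
  have "u [^] k = star A (u [^] nat (- k))"
    using True unitary_Units(2)[OF unitary_nat_pow[OF u, of "nat (- k)"]]
    by (subst int_pow_def2) simp
  then show ?thesis using unitary_star[OF unitary_nat_pow[OF u]] by simp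
next
  case False
  then show ?thesis
    using unitary_nat_pow[OF u, of "nat k"] by (subst int_pow_def2) simp
qed

text \<open>Identifies integer powers in the algebra with powers in its group of units, which
  supplies the laws for negative exponents.\<close>

lemma int_pow_units_of:
  assumes "u \<in> Units A"
  shows "u [^]\<^bsub>units_of A\<^esub> (k::int) = u [^] k"
proof -
  have n: "u [^]\<^bsub>units_of A\<^esub> (m::nat) = u [^] m" for m
    by (simp add: nat_pow_def units_of_def)
  have "u [^] (m::nat) \<in> Units A" for m
    using assms by (induction m) simp_all
  note inv = R.units_of_inv[OF this[of "nat (- k)"]]
  show ?thesis
    unfolding int_pow_def2[of _ u] n inv ..
qed

lemma unitary_int_pow_add:
  assumes "cstar_unitary A u"
  shows "u [^] (k + l :: int) = u [^] k \<otimes> u [^] l"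
proof -
  interpret G: group "units_of A" by (rule R.units_group)
  have u: "u \<in> Units A" by (rule unitary_Units[OF assms])
  show ?thesis
    using G.int_pow_mult[of u k l] u by (simp add: int_pow_units_of units_of_carrier units_of_mult)
qed

lemma unitary_closed: "cstar_unitary A u \<Longrightarrow> u \<in> carrier A"
  by (simp add: cstar_unitary_def)

lemma star_int_pow:
  assumes "cstar_unitary A u"
  shows "star A (u [^] (k::int)) = u [^] (- k)"
proof -
  interpret G: group "units_of A" by (rule R.units_group)
  have u: "u \<in> Units A" by (rule unitary_Units[OF assms])
  have "u [^] (- k) = inv\<^bsub>units_of A\<^esub> (u [^] k)"
    using G.int_pow_neg[of u k] u by (simp add: int_pow_units_of units_of_carrier)
  also have "\<dots> = inv (u [^] k)"
    by (rule R.units_of_inv) (rule unitary_Units[OF unitary_int_pow[OF assms]])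
  also have "\<dots> = star A (u [^] k)" by (rule unitary_Units(2)[OF unitary_int_pow[OF assms]])
  finally show ?thesis by simp
qed

section \<open>Commutation relations and Weyl elements\<close>

lemma commute_nat_pow:
  assumes x: "x \<in> carrier A" and y: "y \<in> carrier A" and c: "x \<otimes> y = c \<odot> (y \<otimes> x)"
  shows "x \<otimes> y [^] (n::nat) = (c ^ n) \<odot> (y [^] n \<otimes> x)"
proof (induction n)
  case 0
  then show ?case using x by simp
next
  case (Suc n)
  have "x \<otimes> y [^] Suc n = (x \<otimes> y [^] n) \<otimes> y" using x y by (simp add: R.m_assoc)
  also have "\<dots> = (c ^ n) \<odot> (y [^] n \<otimes> (x \<otimes> y))" using x y by (simp add: Suc smult_mult_left R.m_assoc)
  also have "\<dots> = (c ^ Suc n) \<odot> (y [^] Suc n \<otimes> x)"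
    using x y by (simp add: c smult_mult_right V.smult_smult R.m_assoc mult.commute)
  finally show ?case .
qed

text \<open>For a negative exponent the relation for the positive power \<open>?w\<close> is
  multiplied from both sides by its adjoint, which is its inverse.\<close>

lemma commute_int_pow:
  assumes x: "x \<in> carrier A" and y: "cstar_unitary A y" and c0: "c \<noteq> 0" and c: "x \<otimes> y = c \<odot> (y \<otimes> x)"
  shows "x \<otimes> y [^] (n::int) = (c powi n) \<odot> (y [^] n \<otimes> x)"
proof (cases n)
  case (nonneg m)
  then show ?thesis
    using commute_nat_pow[OF x unitary_closed[OF y] c, of m] by (simp add: int_pow_int power_int_def)
next
  case (neg m)
  let ?w = "y [^] Suc m"
  have yc: "y \<in> carrier A" by (rule unitary_closed[OF y])
  have w: "cstar_unitary A ?w" by (rule unitary_nat_pow[OF y])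
  have wc: "?w \<in> carrier A" "star A ?w \<in> carrier A" "star A ?w \<otimes> ?w = \<one>" "?w \<otimes> star A ?w = \<one>"
    using w star_closed[OF unitary_closed[OF w]] by (simp_all add: cstar_unitary_def)
  have yn: "y [^] n = star A ?w"
    using star_int_pow[OF y, of "int (Suc m)"] unfolding neg int_pow_int by simp
  have *: "x \<otimes> ?w = (c ^ Suc m) \<odot> (?w \<otimes> x)" by (rule commute_nat_pow[OF x yc c])
  have "star A ?w \<otimes> x = star A ?w \<otimes> ((x \<otimes> ?w) \<otimes> star A ?w)"
    using x wc by (simp add: R.m_assoc del: R.nat_pow_Suc)
  also have "\<dots> = (c ^ Suc m) \<odot> ((star A ?w \<otimes> ?w) \<otimes> (x \<otimes> star A ?w))"
    unfolding * using x wc(1,2) by (simp add: smult_mult_left smult_mult_right R.m_assoc del: R.nat_pow_Suc)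
  also have "\<dots> = (c ^ Suc m) \<odot> (x \<otimes> star A ?w)" using x wc by (simp del: R.nat_pow_Suc)
  finally have e: "star A ?w \<otimes> x = (c ^ Suc m) \<odot> (x \<otimes> star A ?w)" .
  have "(c powi n) \<odot> (star A ?w \<otimes> x) = x \<otimes> star A ?w"
    unfolding e using c0 x wc(1,2) neg
    by (simp add: V.smult_smult power_int_minus del: R.nat_pow_Suc power_Suc of_nat_Suc)
  then show ?thesis unfolding yn by simp
qed

context
  fixes \<alpha> U V
  assumes pair: "rotation_pair (2 * \<alpha>) A U V"
begin

private abbreviation "W \<equiv> weyl \<alpha> A U V"
private abbreviation "q \<equiv> cis (4 * pi * \<alpha>)"

lemma rotation_unitary: "cstar_unitary A U" "cstar_unitary A V"
  using pair by (simp_all add: rotation_pair_def)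

lemma pow_closed [simp]: "U [^] (k::int) \<in> carrier A" "V [^] (k::int) \<in> carrier A"
  using unitary_closed[OF unitary_int_pow[OF rotation_unitary(1)]]
    unitary_closed[OF unitary_int_pow[OF rotation_unitary(2)]] by simp_all

lemma weyl_closed [simp]: "W k n \<in> carrier A"
  by (simp add: weyl_def)

text \<open>Two applications of \<open>commute_int_pow\<close>: one moves \<open>U\<close> past a
  power of \<open>V\<close>, the other moves that power past a power of \<open>U\<close> with the
  inverse phase.\<close>

lemma UV_commute: "V [^] (n::int) \<otimes> U [^] (k::int) = (q powi (- (k * n))) \<odot> (U [^] k \<otimes> V [^] n)"
proof -
  have UV: "U \<otimes> V = q \<odot> (V \<otimes> U)"
    using pair by (simp add: rotation_pair_def mult.assoc mult.left_commute)
  have c: "U \<in> carrier A" "V \<in> carrier A" using rotation_unitary by (simp_all add: unitary_closed)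
  have q0: "q \<noteq> 0" by simp
  have "U \<otimes> V [^] n = (q powi n) \<odot> (V [^] n \<otimes> U)"
    by (rule commute_int_pow[OF c(1) rotation_unitary(2) q0 UV])
  then have "(q powi (- n)) \<odot> (U \<otimes> V [^] n) = V [^] n \<otimes> U"
    using c q0 by (simp add: V.smult_smult power_int_minus)
  then have "V [^] n \<otimes> U [^] k = ((q powi (- n)) powi k) \<odot> (U [^] k \<otimes> V [^] n)"
    using q0 by (intro commute_int_pow rotation_unitary) simp_all
  also have "(q powi (- n)) powi k = q powi (- (k * n))"
    by (simp add: power_int_mult[symmetric] mult.commute)
  finally show ?thesis .
qed

text \<open>Proportionality is what closure of the linear span under products requires.\<close>

lemma weyl_mult: "\<exists>d. W k n \<otimes> W l m = d \<odot> W (k + l) (n + m)"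
proof -
  let ?c = "\<lambda>k n. cis (- 2 * pi * \<alpha> * of_int k * of_int n)"
  have "W k n \<otimes> W l m = (?c k n * ?c l m) \<odot> (U [^] k \<otimes> (V [^] n \<otimes> U [^] l) \<otimes> V [^] m)"
    by (simp add: weyl_def smult_mult_left smult_mult_right V.smult_smult R.m_assoc mult.commute)
  also have "\<dots> = (?c k n * ?c l m * q powi (- (l * n))) \<odot> ((U [^] k \<otimes> U [^] l) \<otimes> (V [^] n \<otimes> V [^] m))"
    unfolding UV_commute by (simp add: smult_mult_left smult_mult_right V.smult_smult R.m_assoc)
  also have "\<dots> = (?c k n * ?c l m * q powi (- (l * n))) \<odot> (U [^] (k + l) \<otimes> V [^] (n + m))"
    by (simp add: unitary_int_pow_add rotation_unitary)
  also have "U [^] (k + l) \<otimes> V [^] (n + m) = inverse (?c (k + l) (n + m)) \<odot> W (k + l) (n + m)"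
    by (simp add: weyl_def V.smult_smult cis_mult)
  finally show ?thesis by (auto simp: V.smult_smult)
qed

text \<open>The phase in \<open>weyl\<close> has half the exponent of the commutation phase: its
  conjugate times \<open>q powi (- (k * n))\<close> is the phase of \<open>W (- k) (- n)\<close>.
  Adjoints of Weyl elements thus carry no extra factor, and the star becomes plain conjugate
  reflection of vectors.\<close>

lemma weyl_star: "star A (W k n) = W (- k) (- n)"
proof -
  have "star A (W k n) = cnj (cis (- 2 * pi * \<alpha> * of_int k * of_int n)) \<odot> (V [^] (- n) \<otimes> U [^] (- k))"
    by (simp add: weyl_def star_smult star_mult star_int_pow rotation_unitary)
  also have "\<dots> = (cnj (cis (- 2 * pi * \<alpha> * of_int k * of_int n)) * q powi (- (k * n))) \<odot> (U [^] (- k) \<otimes> V [^] (- n))"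
    unfolding UV_commute by (simp add: V.smult_smult)
  also have "cnj (cis (- 2 * pi * \<alpha> * of_int k * of_int n)) * q powi (- (k * n)) =
      cis (- 2 * pi * \<alpha> * of_int (- k) * of_int (- n))"
    by (simp add: cis_cnj cis_power_int cis_mult algebra_simps)
  finally show ?thesis by (simp add: weyl_def)
qed

lemma weyl_special: "W 0 0 = \<one>" "W 1 0 = U" "W 0 1 = V"
proof -
  have c: "U \<in> carrier A" "V \<in> carrier A" using rotation_unitary by (simp_all add: unitary_closed)
  then show "W 0 0 = \<one>" "W 1 0 = U" "W 0 1 = V"
    using int_pow_int[of A U 1] int_pow_int[of A V 1] by (simp_all add: weyl_def)
qed

inductive_set weyl_span :: "'a set" where
  weyl: "W k n \<in> weyl_span"
| smult: "a \<in> weyl_span \<Longrightarrow> c \<odot> a \<in> weyl_span"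
| add: "\<lbrakk>a \<in> weyl_span; b \<in> weyl_span\<rbrakk> \<Longrightarrow> a \<oplus> b \<in> weyl_span"

lemma weyl_span_closed: "a \<in> weyl_span \<Longrightarrow> a \<in> carrier A"
  by (induction rule: weyl_span.induct) simp_all

lemma weyl_span_star: "a \<in> weyl_span \<Longrightarrow> star A a \<in> weyl_span"
  by (induction rule: weyl_span.induct)
    (auto simp: weyl_star star_smult star_add weyl_span_closed intro: weyl_span.intros)

lemma weyl_span_mult: "a \<in> weyl_span \<Longrightarrow> b \<in> weyl_span \<Longrightarrow> a \<otimes> b \<in> weyl_span"
proof (induction arbitrary: b rule: weyl_span.induct)
  case (weyl k n)
  then show ?case
  proof (induction rule: weyl_span.induct)
    case (weyl l m)
    obtain d where "W k n \<otimes> W l m = d \<odot> W (k + l) (n + m)" using weyl_mult by blast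
    then show ?case using weyl_span.intros by simp
  next
    case (smult b c)
    then show ?case by (simp add: smult_mult_right weyl_span_closed weyl_span.smult)
  next
    case (add b b')
    then show ?case by (simp add: R.r_distr weyl_span_closed weyl_span.add)
  qed
next
  case (smult a c)
  then show ?case by (simp add: smult_mult_left weyl_span_closed weyl_span.smult)
next
  case (add a a')
  then show ?case by (simp add: R.l_distr weyl_span_closed weyl_span.add)
qed

text \<open>Expresses topological closure by norms, the form in which closure under the operations
  is proved.\<close>

lemma in_closure_weyl_span_iff:
  "a \<in> Met.mtopology closure_of weyl_span \<longleftrightarrow>
    a \<in> carrier A \<and> (\<forall>e>0. \<exists>d\<in>weyl_span. cnorm A (a \<ominus> d) < e)"
proof -
  have "(\<exists>d\<in>weyl_span. d \<in> Met.mball a e) \<longleftrightarrow> (\<exists>d\<in>weyl_span. cnorm A (a \<ominus> d) < e)"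
    if "a \<in> carrier A" for e
    using that weyl_span_closed by (auto simp: Met.mball_def cstar_dist_def)
  then show ?thesis unfolding Met.metric_closure_of by auto
qed

lemma weyl_span_subset_closure: "weyl_span \<subseteq> Met.mtopology closure_of weyl_span"
  by (rule closure_of_subset) (auto simp: weyl_span_closed)

text \<open>The span is already stable under the operations, and these are continuous in
  norm.\<close>

lemma closure_weyl_span_subalgebra:
  "unital_cstar_subalgebra (Met.mtopology closure_of weyl_span) A"
proof -
  let ?B = "Met.mtopology closure_of weyl_span"
  have car: "a \<in> carrier A" if "a \<in> ?B" for a
    using that unfolding in_closure_weyl_span_iff by simp
  have add: "a \<oplus> b \<in> ?B" if a: "a \<in> ?B" and b: "b \<in> ?B" for a b
    unfolding in_closure_weyl_span_iff
  proof (intro conjI allI impI)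
    show "a \<oplus> b \<in> carrier A" using car a b by simp
    fix e :: real assume "0 < e"
    then have "0 < e / 2" by simp
    then obtain c d where c: "c \<in> weyl_span" "cnorm A (a \<ominus> c) < e / 2"
      and d: "d \<in> weyl_span" "cnorm A (b \<ominus> d) < e / 2"
      using a b unfolding in_closure_weyl_span_iff by blast
    note cl = car[OF a] car[OF b] weyl_span_closed[OF c(1)] weyl_span_closed[OF d(1)]
    have "(a \<oplus> b) \<ominus> (c \<oplus> d) = (a \<ominus> c) \<oplus> (b \<ominus> d)"
      using cl by (simp add: a_minus_def R.minus_add R.a_ac)
    then have "cnorm A ((a \<oplus> b) \<ominus> (c \<oplus> d)) < e"
      using cnorm_triangle[of "a \<ominus> c" "b \<ominus> d"] c(2) d(2) cl by simp
    then show "\<exists>d\<in>weyl_span. cnorm A (a \<oplus> b \<ominus> d) < e"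
      using weyl_span.add[OF c(1) d(1)] by blast
  qed
  have smult: "c \<odot> a \<in> ?B" if a: "a \<in> ?B" for a c
    unfolding in_closure_weyl_span_iff
  proof (intro conjI allI impI)
    show "c \<odot> a \<in> carrier A" using car a by simp
    fix e :: real assume e: "0 < e"
    have pos: "0 < cmod c + 1" by (simp add: add_nonneg_pos)
    then obtain d where d: "d \<in> weyl_span" "cnorm A (a \<ominus> d) < e / (cmod c + 1)"
      using a e unfolding in_closure_weyl_span_iff by (meson divide_pos_pos)
    note cl = car[OF a] weyl_span_closed[OF d(1)]
    have "c \<odot> a \<ominus> c \<odot> d = c \<odot> (a \<ominus> d)"
      using cl by (simp add: V.diff_eq_smult V.smult_r_distr V.smult_smult mult.commute)
    then have "cnorm A (c \<odot> a \<ominus> c \<odot> d) = cmod c * cnorm A (a \<ominus> d)" using cl by (simp add: cnorm_smult)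
    also have "\<dots> \<le> cmod c * (e / (cmod c + 1))" using d(2) by (intro mult_left_mono) auto
    also have "\<dots> < (cmod c + 1) * (e / (cmod c + 1))"
      using e pos by (intro mult_strict_right_mono) auto
    also have "\<dots> = e" using pos by simp
    finally show "\<exists>d\<in>weyl_span. cnorm A (c \<odot> a \<ominus> d) < e"
      using weyl_span.smult[OF d(1)] by blast
  qed
  have star: "star A a \<in> ?B" if a: "a \<in> ?B" for a
    unfolding in_closure_weyl_span_iff
  proof (intro conjI allI impI)
    show "star A a \<in> carrier A" using car a star_closed by simp
    fix e :: real assume "0 < e"
    then obtain d where d: "d \<in> weyl_span" "cnorm A (a \<ominus> d) < e"
      using a unfolding in_closure_weyl_span_iff by blast
    have "cnorm A (star A a \<ominus> star A d) < e"
      using d(2) car[OF a] weyl_span_closed[OF d(1)] by (simp add: star_diff[symmetric] cnorm_star)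
    then show "\<exists>d\<in>weyl_span. cnorm A (star A a \<ominus> d) < e"
      using weyl_span_star[OF d(1)] by blast
  qed
  have mult: "a \<otimes> b \<in> ?B" if a: "a \<in> ?B" and b: "b \<in> ?B" for a b
    unfolding in_closure_weyl_span_iff
  proof (intro conjI allI impI)
    show "a \<otimes> b \<in> carrier A" using car a b by simp
    fix e :: real assume e: "0 < e"
    define K where "K = cnorm A a + cnorm A b + 1"
    have nn: "0 \<le> cnorm A a" "0 \<le> cnorm A b" using car a b cnorm_nonneg by simp_all
    then have K: "0 < K" by (simp add: K_def)
    \<comment> \<open>The bound 1 keeps \<open>cnorm A d\<close> at most
      \<open>cnorm A b + 1\<close>, and the bound \<open>e / (2 * K)\<close> controls the product
      error \<open>r * K\<close>.\<close>
    define r where "r = min 1 (e / (2 * K))"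
    have r: "0 < r" "r \<le> 1" using e K by (simp_all add: r_def)
    have "r * K \<le> e / (2 * K) * K" using K by (intro mult_right_mono) (simp_all add: r_def)
    then have rK: "r * K \<le> e / 2" using K by simp
    obtain c where c: "c \<in> weyl_span" "cnorm A (a \<ominus> c) < r"
      using a r(1) unfolding in_closure_weyl_span_iff by blast
    obtain d where d: "d \<in> weyl_span" "cnorm A (b \<ominus> d) < r"
      using b r(1) unfolding in_closure_weyl_span_iff by blast
    note cl = car[OF a] car[OF b] weyl_span_closed[OF c(1)] weyl_span_closed[OF d(1)]
    have "(d \<ominus> b) \<oplus> b = d" using cl by (simp add: a_minus_def R.a_assoc R.l_neg)
    then have "cnorm A d \<le> cnorm A b + cnorm A (d \<ominus> b)" using cnorm_triangle[of "d \<ominus> b" b] cl by simp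
    then have dn: "cnorm A d \<le> cnorm A b + 1" using d(2) r(2) cnorm_diff_commute[OF cl(2,4)] by simp
    have "a \<otimes> b \<ominus> c \<otimes> d = a \<otimes> (b \<ominus> d) \<oplus> (a \<ominus> c) \<otimes> d"
      using cl by (simp add: a_minus_def R.r_distr R.l_distr R.r_minus R.l_minus R.a_assoc R.r_neg1)
    then have "cnorm A (a \<otimes> b \<ominus> c \<otimes> d) \<le> cnorm A (a \<otimes> (b \<ominus> d)) + cnorm A ((a \<ominus> c) \<otimes> d)"
      using cnorm_triangle[of "a \<otimes> (b \<ominus> d)" "(a \<ominus> c) \<otimes> d"] cl by simp
    also have "\<dots> \<le> cnorm A a * cnorm A (b \<ominus> d) + cnorm A (a \<ominus> c) * cnorm A d"
      using cl by (intro add_mono cnorm_mult) auto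
    also have "\<dots> \<le> cnorm A a * r + r * (cnorm A b + 1)"
      using nn c(2) d(2) dn r(1) cnorm_nonneg[OF cl(4)] cnorm_nonneg[OF R.minus_closed[OF cl(2,4)]]
      by (intro add_mono mult_mono) auto
    also have "\<dots> = r * K" by (simp add: K_def algebra_simps)
    also have "\<dots> < e" using rK e by simp
    finally show "\<exists>d\<in>weyl_span. cnorm A (a \<otimes> b \<ominus> d) < e"
      using weyl_span_mult[OF c(1) d(1)] by blast
  qed
  have "subring ?B A"
  proof (rule R.subringI)
    show "?B \<subseteq> carrier A" using car by blast
    show "\<one> \<in> ?B" using subsetD[OF weyl_span_subset_closure weyl_span.weyl[of 0 0]] by (simp add: weyl_special)
    show "\<ominus> a \<in> ?B" if "a \<in> ?B" for a using smult[OF that, of "- 1"] car[OF that] by (simp add: V.a_inv_eq_smult)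
  qed (use mult add in auto)
  then show ?thesis
    unfolding unital_cstar_subalgebra_def using smult star by (simp add: closedin_closure_of)
qed

text \<open>The closure of the span is a C*-subalgebra containing \<open>U\<close> and
  \<open>V\<close>, so it is everything because these generate the algebra.\<close>

lemma weyl_span_dense:
  assumes gen: "\<And>B. unital_cstar_subalgebra B A \<Longrightarrow> U \<in> B \<Longrightarrow> V \<in> B \<Longrightarrow> B = carrier A"
    and a: "a \<in> carrier A" and e: "e > 0"
  shows "\<exists>d\<in>weyl_span. cnorm A (a \<ominus> d) < e"
proof -
  have "Met.mtopology closure_of weyl_span = carrier A"
    using subsetD[OF weyl_span_subset_closure weyl_span.weyl[of 1 0]] subsetD[OF weyl_span_subset_closure weyl_span.weyl[of 0 1]]
    by (intro gen closure_weyl_span_subalgebra) (simp_all add: weyl_special)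
  then show ?thesis using a e in_closure_weyl_span_iff by blast
qed

end

end

section \<open>The modular objects of the rotation algebra\<close>

lemma graph_closure_mono: "S \<subseteq> T \<Longrightarrow> graph_closure H S \<subseteq> graph_closure H T"
  unfolding graph_closure_def by blast

text \<open>The set where \<open>h\<close> is not positive has density integral 0, so it is null for
  \<open>N'\<close> and, by absolute continuity, for \<open>N\<close>.\<close>

lemma AE_density_pos:
  assumes h: "h \<in> borel_measurable N" and d: "density N (\<lambda>z. ennreal (h z)) = N'"
    and ac: "absolutely_continuous N' N"
  shows "AE z in N. 0 < h z"
proof -
  let ?B = "{z \<in> space N. \<not> 0 < h z}"
  have B: "?B \<in> sets N" using h by measurable
  have "emeasure N' ?B = (\<integral>\<^sup>+z. ennreal (h z) * indicator ?B z \<partial>N)"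
    unfolding d[symmetric] using h B by (simp add: emeasure_density)
  also have "\<dots> = (\<integral>\<^sup>+z. 0 \<partial>N)"
    by (intro nn_integral_cong) (auto simp: indicator_def ennreal_neg)
  finally have "?B \<in> null_sets N'"
    using B by (simp add: null_sets_def d[symmetric])
  then have "?B \<in> null_sets N" using ac by (auto simp: absolutely_continuous_def)
  then show ?thesis by (rule AE_I') auto
qed

locale circle_reflected = reflected_measures M g
  for M :: "int \<Rightarrow> complex measure" and g +
  assumes sets_M: "sets (M n) = sets circle_space"
begin

lemma space_M: "space (M n) = sphere 0 1"
  using sets_eq_imp_space_eq[OF sets_M] by (simp add: circle_space_def space_restrict_space)

lemma powi_measurable: "(\<lambda>z. z powi k) \<in> borel_measurable (M n)"
  unfolding measurable_cong_sets[OF sets_M refl] circle_space_def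
  by (rule measurable_restrict_space1[OF trig_measurable[OF trig.powi]])

lemma norm_powi_circle: "z \<in> space (M n) \<Longrightarrow> cmod (z powi k) = 1"
  by (simp add: space_M norm_power_int)

lemma trig_fams_l2fam: "p \<in> trig_fams \<Longrightarrow> p \<in> l2fam M"
proof (induction rule: trig_fams.induct)
  case (powi n k)
  let ?p = "\<lambda>m z. if m = n then z powi k else (0::complex)"
  have "?p m \<in> borel_measurable (M m)" for m
    using powi_measurable by (cases "m = n") simp_all
  moreover have "sqsum M ?p < \<infinity>"
  proof -
    have "(\<integral>\<^sup>+z. ennreal ((cmod (?p m z))\<^sup>2) \<partial>M m) \<le> emeasure (M n) (space (M n)) * indicator {n} m" for m
    proof (cases "m = n")
      case True
      have "(\<integral>\<^sup>+z. ennreal ((cmod (z powi k))\<^sup>2) \<partial>M n) = (\<integral>\<^sup>+z. 1 \<partial>M n)"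
        by (intro nn_integral_cong) (simp add: norm_powi_circle)
      then show ?thesis using True by simp
    qed simp
    then have "sqsum M ?p \<le> (\<integral>\<^sup>+m. emeasure (M n) (space (M n)) * indicator {n} m \<partial>count_space UNIV)"
      unfolding sqsum_def by (intro nn_integral_mono)
    also have "\<dots> = emeasure (M n) (space (M n))"
      by (simp add: nn_integral_cmult_indicator)
    also have "\<dots> < \<infinity>"
      using finite_measure.emeasure_finite[OF finite_M] by (simp add: less_top)
    finally show ?thesis .
  qed
  ultimately show ?case by (simp add: l2fam_def)
next
  case (smult p c)
  then show ?case by (simp add: l2fam_smult)
next
  case (add p q)
  then show ?case by (simp add: l2fam_add)
qed

text \<open>Pointwise (1 + g) |w|^2 = |w|^2 + |s w|^2, and the second summand has the same total as
  the reflected family by \<open>sqsum_conj_refl\<close>.\<close>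

lemma sqsum_graph:
  assumes "\<And>n. w n \<in> borel_measurable (M n)"
  shows "sqsum (\<lambda>n. density (M n) (\<lambda>z. ennreal (1 + g n z))) w = sqsum M w + sqsum M (conj_refl w)"
proof -
  have wm [measurable]: "w n \<in> borel_measurable (M n)" for n by (rule assms)
  have "(\<integral>\<^sup>+z. ennreal ((cmod (w n z))\<^sup>2) \<partial>density (M n) (\<lambda>z. ennreal (1 + g n z))) =
      (\<integral>\<^sup>+z. ennreal ((cmod (w n z))\<^sup>2) \<partial>M n) + (\<integral>\<^sup>+z. ennreal ((cmod (fmul s w n z))\<^sup>2) \<partial>M n)" for n
  proof -
    have "(\<integral>\<^sup>+z. ennreal ((cmod (w n z))\<^sup>2) \<partial>density (M n) (\<lambda>z. ennreal (1 + g n z))) =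
        (\<integral>\<^sup>+z. ennreal (1 + g n z) * ennreal ((cmod (w n z))\<^sup>2) \<partial>M n)"
      by (subst nn_integral_density) simp_all
    also have "\<dots> = (\<integral>\<^sup>+z. ennreal ((cmod (w n z))\<^sup>2) + ennreal ((cmod (fmul s w n z))\<^sup>2) \<partial>M n)"
    proof (rule nn_integral_cong)
      fix z
      have "(1 + g n z) * (cmod (w n z))\<^sup>2 = (cmod (w n z))\<^sup>2 + (cmod (fmul s w n z))\<^sup>2"
        using g_pos[of n z] by (simp add: fmul_def s_def norm_mult power_mult_distrib algebra_simps)
      then show "ennreal (1 + g n z) * ennreal ((cmod (w n z))\<^sup>2) =
          ennreal ((cmod (w n z))\<^sup>2) + ennreal ((cmod (fmul s w n z))\<^sup>2)"
        using g_pos[of n z] by (simp add: ennreal_mult[symmetric] ennreal_plus[symmetric] del: ennreal_plus)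
    qed
    also have "\<dots> = (\<integral>\<^sup>+z. ennreal ((cmod (w n z))\<^sup>2) \<partial>M n) + (\<integral>\<^sup>+z. ennreal ((cmod (fmul s w n z))\<^sup>2) \<partial>M n)"
      unfolding fmul_def by (rule nn_integral_add) measurable
    finally show ?thesis .
  qed
  then show ?thesis
    unfolding sqsum_conj_refl[OF assms] unfolding sqsum_def by (simp add: nn_integral_add)
qed

text \<open>One approximation in the measures with density 1 + g controls the error in
  \<open>x\<close> and in its reflection simultaneously, which separate approximations would not
  do.\<close>

lemma S0_subset_closure:
  "S0 \<subseteq> graph_closure (l2sum M) {(l2cls M p, l2cls M (conj_refl p)) | p. p \<in> trig_fams \<and> conj_refl p \<in> l2fam M}"
proof (rule subrelI)
  fix X Y assume "(X, Y) \<in> S0"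
  then obtain x where x: "x \<in> l2fam M" "conj_refl x \<in> l2fam M" "X = l2cls M x" "Y = l2cls M (conj_refl x)"
    by (auto simp: S0_def)
  let ?N = "\<lambda>n. density (M n) (\<lambda>z. ennreal (1 + g n z))"
  have gr: "sqsum ?N w = sqsum M w + sqsum M (conj_refl w)" if "\<And>n. w n \<in> borel_measurable (M n)" for w
    by (rule sqsum_graph[OF that])
  \<comment> \<open>The mass is that of \<open>M n\<close> plus that of
    \<open>M (- n)\<close>.\<close>
  have N1: "finite_measure (?N n)" for n
  proof
    have "emeasure (?N n) (space (?N n)) = (\<integral>\<^sup>+z. ennreal (1 + g n z) \<partial>M n)"
      by (simp add: emeasure_density cong: nn_integral_cong)
    also have "\<dots> = (\<integral>\<^sup>+z. 1 + ennreal (g n z) * 1 \<partial>M n)"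
      using g_pos by (intro nn_integral_cong) (simp add: less_imp_le)
    also have "\<dots> = emeasure (M n) (space (M n)) + (\<integral>\<^sup>+z. 1 \<partial>M (- n))"
      by (subst nn_integral_reflect) (simp_all add: nn_integral_add)
    also have "\<dots> < \<infinity>"
      using finite_measure.emeasure_finite[OF finite_M] by (simp add: less_top)
    finally show "emeasure (?N n) (space (?N n)) \<noteq> \<infinity>" by simp
  qed
  have N2: "sets (?N n) = sets circle_space" for n by (simp add: sets_M)
  have xN: "x \<in> l2fam ?N"
    using x(1,2) gr[of x] unfolding l2fam_def by simp
  have "\<exists>p. p \<in> trig_fams \<and> conj_refl p \<in> l2fam M \<and> hnorm (l2sum M) (X \<ominus>\<^bsub>l2sum M\<^esub> l2cls M p) < e \<and>
      hnorm (l2sum M) (Y \<ominus>\<^bsub>l2sum M\<^esub> l2cls M (conj_refl p)) < e" if e: "e > 0" for e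
  proof -
    obtain p where p: "p \<in> trig_fams" "sqsum ?N (\<lambda>n z. x n z - p n z) < ennreal (e\<^sup>2)"
      using trig_fams_dense[OF N1 N2 xN, of "e\<^sup>2"] e by auto
    have pl: "p \<in> l2fam M" by (rule trig_fams_l2fam[OF p(1)])
    let ?d = "\<lambda>n z. x n z - p n z"
    have dl: "?d \<in> l2fam M" by (rule l2fam_diff[OF x(1) pl])
    have sum: "sqsum M ?d + sqsum M (conj_refl ?d) < ennreal (e\<^sup>2)"
      using p(2) gr[of ?d] l2fam_measurable[OF dl] by simp
    then have lt: "sqsum M ?d < ennreal (e\<^sup>2)" "sqsum M (conj_refl ?d) < ennreal (e\<^sup>2)"
      by (rule order_le_less_trans[rotated], simp)+
    have cd: "conj_refl ?d \<in> l2fam M"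
      using lt(2) conj_refl_measurable[OF dl] by (auto simp: l2fam_def intro: order_less_trans)
    \<comment> \<open>The reflection of \<open>p\<close> is square-summable as the difference of two
      such families, the reflections of \<open>x\<close> and of the error.\<close>
    have e1: "conj_refl p = (\<lambda>n z. conj_refl x n z - conj_refl ?d n z)"
      and e2: "conj_refl ?d = (\<lambda>n z. conj_refl x n z - conj_refl p n z)"
      by (simp_all add: conj_refl_def)
    have cp: "conj_refl p \<in> l2fam M" unfolding e1 by (rule l2fam_diff[OF x(2) cd])
    have "hnorm (l2sum M) (X \<ominus>\<^bsub>l2sum M\<^esub> l2cls M p) < e"
      using lt(1) e dl unfolding x(3) diff_l2sum[OF x(1) pl] by (simp add: hnorm_l2sum_less_iff)
    moreover have "hnorm (l2sum M) (Y \<ominus>\<^bsub>l2sum M\<^esub> l2cls M (conj_refl p)) < e"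
      using lt(2) e cd unfolding x(4) diff_l2sum[OF x(2) cp] e2[symmetric] by (simp add: hnorm_l2sum_less_iff)
    ultimately show ?thesis using p(1) cp by blast
  qed
  then have ap: "\<exists>(a, b)\<in>{(l2cls M p, l2cls M (conj_refl p)) | p. p \<in> trig_fams \<and> conj_refl p \<in> l2fam M}.
      hnorm (l2sum M) (X \<ominus>\<^bsub>l2sum M\<^esub> a) < e \<and> hnorm (l2sum M) (Y \<ominus>\<^bsub>l2sum M\<^esub> b) < e"
    if "e > 0" for e
    using that by fastforce
  have "X \<in> carrier (l2sum M)" "Y \<in> carrier (l2sum M)" using x by simp_all
  then show "(X, Y) \<in> graph_closure (l2sum M) {(l2cls M p, l2cls M (conj_refl p)) | p. p \<in> trig_fams \<and> conj_refl p \<in> l2fam M}"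
    using ap unfolding graph_closure_def by simp
qed

end

section \<open>Rotations and the action of Weyl elements on the GNS vector\<close>

lemma rot_measurable: "rot \<alpha> n \<in> measurable circle_space circle_space"
proof -
  have "cmod (rot \<alpha> n z) = cmod z" for z
    by (simp add: rot_def norm_mult norm_power_int)
  moreover have "rot \<alpha> n \<in> borel_measurable borel" unfolding rot_def by measurable
  ultimately show ?thesis
    unfolding circle_space_def
    by (intro measurable_restrict_space2 measurable_restrict_space1) (auto simp: space_restrict_space)
qed

lemma rot_rot: "rot \<alpha> k (rot \<alpha> l z) = rot \<alpha> (k + l) z"
  by (simp add: rot_def power_int_add)

context
  fixes \<alpha> :: real and \<mu> :: "complex measure"
  assumes sets_\<mu>: "sets \<mu> = sets circle_space"
begin

lemma rot_measurable_\<mu>: "rot \<alpha> n \<in> measurable \<mu> circle_space"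
  unfolding measurable_cong_sets[OF sets_\<mu> refl] by (rule rot_measurable)

lemma rot_measurable_rot: "rot \<alpha> k \<in> measurable (rot_measure \<alpha> \<mu> n) circle_space"
  using rot_measurable[of \<alpha> k] by (simp add: rot_measure_def)

lemma rot_measure_rot: "distr (rot_measure \<alpha> \<mu> n) circle_space (rot \<alpha> k) = rot_measure \<alpha> \<mu> (k + n)"
  unfolding rot_measure_def
  by (subst distr_distr[OF rot_measurable rot_measurable_\<mu>]) (simp add: comp_def rot_rot)

text \<open>The summand with index \<open>l\<close> alone survives, and the vector is supported in
  component 0, which forces \<open>n = l\<close>; there the rotation inside
  \<open>check_poly\<close> is the identity.\<close>

lemma gns_action_single:
  fixes k l
  defines "f \<equiv> \<lambda>p. if p = (k, l) then 1 else 0 :: complex"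
  assumes \<xi>: "(\<lambda>n z. if n = 0 then 1 else 0) \<in> l2fam (rot_measure \<alpha> \<mu>)"
  shows "gns_action \<alpha> \<mu> f (gns_vector \<alpha> \<mu>) =
    l2cls (rot_measure \<alpha> \<mu>) (\<lambda>n z. if n = l then z powi k else 0)"
proof
  fix n
  have 1: "{l'. \<exists>k'. f (k', l') \<noteq> 0} = {l}" by (auto simp: f_def)
  have 2: "{k'. f (k', l) \<noteq> 0} = {k}" by (auto simp: f_def)
  have 3: "check_poly f l w = w powi k" for w unfolding check_poly_def 2 by (simp add: f_def)
  have idx: "n - l = - l + n" by simp
  have "AE z in rot_measure \<alpha> \<mu> (- l + n). rep (gns_vector \<alpha> \<mu> (n - l)) z = (if n - l = 0 then 1 else 0)"
    using l2rep_l2cls(1)[OF \<xi>, of "n - l"] unfolding l2rep_def l2cls_def gns_vector_def idx .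
  \<comment> \<open>Rotation by \<open>- l\<close> carries the measure with index \<open>n\<close>
    to the one with index \<open>n - l\<close>, so an almost everywhere statement about the
    representative pulls back.\<close>
  then have "AE z in rot_measure \<alpha> \<mu> n. rep (gns_vector \<alpha> \<mu> (n - l)) (rot \<alpha> (- l) z) = (if n - l = 0 then 1 else 0)"
    unfolding rot_measure_rot[symmetric] by (rule AE_distrD[OF rot_measurable_rot])
  then have "AE z in rot_measure \<alpha> \<mu> n. (\<Sum>l' | \<exists>k'. f (k', l') \<noteq> 0. check_poly f l' (rot \<alpha> (n - l') z) *
      rep (gns_vector \<alpha> \<mu> (n - l')) (rot \<alpha> (- l') z)) = (if n = l then z powi k else 0)"
    unfolding 1 by eventually_elim (simp add: 3 rot_def)
  then show "gns_action \<alpha> \<mu> f (gns_vector \<alpha> \<mu>) n =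
      l2cls (rot_measure \<alpha> \<mu>) (\<lambda>n z. if n = l then z powi k else 0) n"
    unfolding gns_action_def l2cls_def by (rule L2_class_cong_AE)
qed

end

lemma (in unital_cstar_algebra) weyl_sum_single:
  assumes "rotation_pair (2 * \<alpha>) A U V"
  shows "weyl_sum \<alpha> A U V (\<lambda>p. if p = (k, l) then 1 else 0) = weyl \<alpha> A U V k l"
proof -
  have "{p. (if p = (k, l) then 1 else 0 :: complex) \<noteq> 0} = {(k, l)}" by auto
  then show ?thesis
    using weyl_closed[OF assms] by (simp add: weyl_sum_def)
qed

section \<open>Identification of the Tomita operator\<close>

context circle_reflected
begin

context
  fixes A :: "'a cstar" and \<alpha> U V \<omega> \<pi> \<xi>
  assumes A: "unital_cstar_algebra A" and pair: "rotation_pair (2 * \<alpha>) A U V"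
    and gen: "\<And>B. unital_cstar_subalgebra B A \<Longrightarrow> U \<in> B \<Longrightarrow> V \<in> B \<Longrightarrow> B = carrier A"
    and state: "cstar_state A \<omega>"
    and gns: "gns_representation A \<omega> (l2sum M) \<pi> \<xi>"
    and weyl_vec: "\<And>k l. \<pi> (weyl \<alpha> A U V k l) \<xi> = l2cls M (\<lambda>n z. if n = l then z powi k else 0)"
begin

interpretation A: unital_cstar_algebra A by (rule A)

lemma rep_rules:
  assumes "a \<in> carrier A"
  shows "\<pi> a \<xi> \<in> carrier (l2sum M)"
    and "b \<in> carrier A \<Longrightarrow> \<pi> (a \<oplus>\<^bsub>A\<^esub> b) \<xi> = \<pi> a \<xi> \<oplus>\<^bsub>l2sum M\<^esub> \<pi> b \<xi>"
    and "\<pi> (c \<odot>\<^bsub>A\<^esub> a) \<xi> = c \<odot>\<^bsub>l2sum M\<^esub> \<pi> a \<xi>"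
  using gns assms by (auto simp: gns_representation_def star_representation_def bounded_op_def)

lemma rep_diff:
  assumes "a \<in> carrier A" "b \<in> carrier A"
  shows "\<pi> a \<xi> \<ominus>\<^bsub>l2sum M\<^esub> \<pi> b \<xi> = \<pi> (a \<ominus>\<^bsub>A\<^esub> b) \<xi>"
  using assms by (simp add: A.V.diff_eq_smult H.diff_eq_smult rep_rules)

text \<open>The squared norm is the value of the state at the adjoint of \<open>a\<close> times
  \<open>a\<close>, hence bounded by the norm of that product, which is the squared norm of
  \<open>a\<close>.\<close>

lemma hnorm_rep_le:
  assumes a: "a \<in> carrier A"
  shows "hnorm (l2sum M) (\<pi> a \<xi>) \<le> cnorm A a"
proof -
  let ?a = "star A a \<otimes>\<^bsub>A\<^esub> a"
  have sa: "star A a \<in> carrier A" by (rule A.star_closed[OF a])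
  have \<xi>: "\<xi> \<in> carrier (l2sum M)" and st: "star_representation A (l2sum M) \<pi>"
    and \<omega>: "\<omega> ?a = ip (l2sum M) \<xi> (\<pi> ?a \<xi>)"
    using gns a sa by (simp_all add: gns_representation_def)
  have m: "\<pi> ?a \<xi> = \<pi> (star A a) (\<pi> a \<xi>)"
    using st a sa \<xi> unfolding star_representation_def by simp
  have "ip (l2sum M) (\<pi> (star A (star A a)) \<xi>) (\<pi> a \<xi>) = ip (l2sum M) \<xi> (\<pi> ?a \<xi>)"
  proof -
    have adj: "ip (l2sum M) (\<pi> b x) y = ip (l2sum M) x (\<pi> (star A b) y)"
      if "b \<in> carrier A" "x \<in> carrier (l2sum M)" "y \<in> carrier (l2sum M)" for b x y
      using st that unfolding star_representation_def by simp
    show ?thesis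
      unfolding m A.star_star[OF a] by (rule adj[OF a \<xi> rep_rules(1)[OF a]])
  qed
  then have "complex_of_real ((hnorm (l2sum M) (\<pi> a \<xi>))\<^sup>2) = \<omega> ?a"
    unfolding \<omega> A.star_star[OF a] using H.ip_self[OF rep_rules(1)[OF a]] by simp
  then have "\<bar>(hnorm (l2sum M) (\<pi> a \<xi>))\<^sup>2\<bar> = cmod (\<omega> ?a)" by (metis norm_of_real)
  also have "\<dots> \<le> cnorm A ?a" using state a sa by (simp add: cstar_state_def)
  finally have "(hnorm (l2sum M) (\<pi> a \<xi>))\<^sup>2 \<le> (cnorm A a)\<^sup>2"
    by (simp add: A.cstar_identity[OF a])
  then show ?thesis using A.cnorm_nonneg[OF a] by (rule power2_le_imp_le)
qed

text \<open>Keeps track of an element and of its adjoint at once, so that linear combinations can be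
  followed by induction both in the algebra and among the families.\<close>

definition matches :: "'a \<Rightarrow> (int \<Rightarrow> complex \<Rightarrow> complex) \<Rightarrow> bool" where
  "matches d p \<longleftrightarrow> d \<in> carrier A \<and> p \<in> l2fam M \<and> conj_refl p \<in> l2fam M \<and>
     \<pi> d \<xi> = l2cls M p \<and> \<pi> (star A d) \<xi> = l2cls M (conj_refl p)"

text \<open>On the circle the conjugate of z^k is z^(-k), so the reflection of the vector of a Weyl
  element is the vector of its adjoint.\<close>

lemma matches_weyl: "matches (weyl \<alpha> A U V k l) (\<lambda>n z. if n = l then z powi k else 0)"
proof -
  let ?p = "\<lambda>n z. if n = l then z powi k else 0 :: complex"
  let ?q = "\<lambda>n z. if n = - l then z powi (- k) else 0 :: complex"
  have ae: "AE z in M n. conj_refl ?p n z = ?q n z" for n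
  proof (rule AE_I2)
    fix z assume "z \<in> space (M n)"
    then have z: "cmod z = 1" by (simp add: space_M)
    then have "z * cnj z = 1" using complex_norm_square[of z] by simp
    then have "cnj z = inverse z" by (metis inverse_unique)
    then have "cnj (z powi k) = z powi (- k)"
      by (simp add: power_int_minus flip: power_int_inverse)
    then show "conj_refl ?p n z = ?q n z" by (auto simp: conj_refl_def)
  qed
  have p: "?p \<in> l2fam M" "?q \<in> l2fam M" by (rule trig_fams_l2fam[OF trig_fams.powi])+
  have "conj_refl ?p \<in> l2fam M"
    by (rule l2fam_cong_AE[OF p(2) conj_refl_measurable[OF p(1)] ae])
  then show ?thesis
    using p l2cls_cong_AE[where M = M, OF ae]
    by (simp add: matches_def A.weyl_closed[OF pair] A.weyl_star[OF pair] weyl_vec)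
qed

lemma matches_smult:
  assumes "matches d p"
  shows "matches (c \<odot>\<^bsub>A\<^esub> d) (\<lambda>n z. c * p n z)"
proof -
  have "conj_refl (\<lambda>n z. c * p n z) = (\<lambda>n z. cnj c * conj_refl p n z)" by (simp add: conj_refl_def)
  then show ?thesis
    using assms by (simp add: matches_def l2fam_smult A.star_smult A.star_closed rep_rules smult_l2sum)
qed

lemma matches_add:
  assumes "matches d p" "matches e q"
  shows "matches (d \<oplus>\<^bsub>A\<^esub> e) (\<lambda>n z. p n z + q n z)"
proof -
  have "conj_refl (\<lambda>n z. p n z + q n z) = (\<lambda>n z. conj_refl p n z + conj_refl q n z)" by (simp add: conj_refl_def)
  then show ?thesis
    using assms by (simp add: matches_def l2fam_add A.star_add A.star_closed rep_rules add_l2sum)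
qed

lemma weyl_span_matches: "d \<in> A.weyl_span \<alpha> U V \<Longrightarrow> \<exists>p. matches d p"
proof (induction rule: A.weyl_span.induct[OF pair, consumes 1])
qed (blast intro: matches_weyl matches_smult matches_add)+

lemma trig_fams_matches: "p \<in> trig_fams \<Longrightarrow> \<exists>d. matches d p"
proof (induction rule: trig_fams.induct)
qed (blast intro: matches_weyl matches_smult matches_add)+

text \<open>The pairs of the Weyl span lie in \<open>S0\<close>; density of the span,
  \<open>hnorm_rep_le\<close> and closedness of \<open>S0\<close> extend this to the whole algebra.
  Conversely, the trigonometric families already have \<open>S0\<close> in their closure.\<close>

lemma tomita_operator_eq_S0: "tomita_operator A (l2sum M) \<pi> \<xi> = S0"
proof -
  let ?G = "{(\<pi> a \<xi>, \<pi> (star A a) \<xi>) | a. a \<in> carrier A}"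
  have match_S0: "(\<pi> d \<xi>, \<pi> (star A d) \<xi>) \<in> S0" if "matches d p" for d p
    using that by (auto simp: matches_def S0_def)
  have G: "?G \<subseteq> S0"
  proof (rule subrelI)
    fix X Y assume "(X, Y) \<in> ?G"
    then obtain a where a: "a \<in> carrier A" "X = \<pi> a \<xi>" "Y = \<pi> (star A a) \<xi>" by blast
    have "(X, Y) \<in> graph_closure (l2sum M) S0"
    proof -
      have "\<exists>(x, y)\<in>S0. hnorm (l2sum M) (X \<ominus>\<^bsub>l2sum M\<^esub> x) < e \<and> hnorm (l2sum M) (Y \<ominus>\<^bsub>l2sum M\<^esub> y) < e"
        if e: "e > 0" for e
      proof -
        obtain d where d: "d \<in> A.weyl_span \<alpha> U V" "cnorm A (a \<ominus>\<^bsub>A\<^esub> d) < e"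
          using A.weyl_span_dense[OF pair gen a(1) e] by blast
        have dc: "d \<in> carrier A" by (rule A.weyl_span_closed[OF pair d(1)])
        obtain p where "matches d p" using weyl_span_matches[OF d(1)] by blast
        then have S: "(\<pi> d \<xi>, \<pi> (star A d) \<xi>) \<in> S0" by (rule match_S0)
        have "hnorm (l2sum M) (X \<ominus>\<^bsub>l2sum M\<^esub> \<pi> d \<xi>) < e"
          using hnorm_rep_le[of "a \<ominus>\<^bsub>A\<^esub> d"] d(2) a(1) dc by (simp add: a(2) rep_diff)
        \<comment> \<open>The star is isometric, so the same approximant works for the second entry
          of the pair.\<close>
        moreover have "hnorm (l2sum M) (Y \<ominus>\<^bsub>l2sum M\<^esub> \<pi> (star A d) \<xi>) < e"
          using hnorm_rep_le[of "star A (a \<ominus>\<^bsub>A\<^esub> d)"] d(2) a(1) dc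
          by (simp add: a(3) rep_diff A.star_closed A.cnorm_star A.star_diff[symmetric])
        ultimately show ?thesis using S by (intro bexI[of _ "(\<pi> d \<xi>, \<pi> (star A d) \<xi>)"]) simp_all
      qed
      then show ?thesis
        using a(1) rep_rules(1)[OF a(1)] rep_rules(1)[OF A.star_closed[OF a(1)]]
        by (simp add: graph_closure_def a(2,3))
    qed
    then show "(X, Y) \<in> S0" using S0_closed by (rule subsetD[rotated])
  qed
  have "graph_closure (l2sum M) ?G \<subseteq> S0"
    using graph_closure_mono[OF G] S0_closed by (rule subset_trans)
  moreover have "S0 \<subseteq> graph_closure (l2sum M) ?G"
  proof (rule subset_trans[OF S0_subset_closure graph_closure_mono])
    show "{(l2cls M p, l2cls M (conj_refl p)) | p. p \<in> trig_fams \<and> conj_refl p \<in> l2fam M} \<subseteq> ?G"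
    proof clarify
      fix p assume "p \<in> trig_fams"
      then obtain d where "matches d p" using trig_fams_matches by blast
      then show "\<exists>a. (l2cls M p, l2cls M (conj_refl p)) = (\<pi> a \<xi>, \<pi> (star A a) \<xi>) \<and> a \<in> carrier A"
        unfolding matches_def by (intro exI[of _ d]) simp
    qed
  qed
  ultimately show ?thesis unfolding tomita_operator_def by (rule equalityI)
qed

text \<open>Existence and uniqueness of the polar decomposition of \<open>S0\<close> evaluate the
  definite description.\<close>

lemma modular_operator_eq: "modular_operator A (l2sum M) \<pi> \<xi> = mult_op M s O mult_op M s"
  unfolding modular_operator_def tomita_operator_eq_S0
proof (rule the_equality)
  show "\<exists>J T. antilinear_polar_decomposition (l2sum M) S0 J T \<and> mult_op M s O mult_op M s = T O T"
    using polar_decomposition_S0 by blast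
  fix D assume "\<exists>J T. antilinear_polar_decomposition (l2sum M) S0 J T \<and> D = T O T"
  then obtain J T where "antilinear_polar_decomposition (l2sum M) S0 J T" "D = T O T" by blast
  then show "D = mult_op M s O mult_op M s" using polar_decomposition_unique(1) by simp
qed

lemma modular_conjugation_eq: "modular_conjugation A (l2sum M) \<pi> \<xi> = J0"
  unfolding modular_conjugation_def tomita_operator_eq_S0
proof (rule the_equality)
  show "\<exists>T. antilinear_polar_decomposition (l2sum M) S0 J0 T"
    using polar_decomposition_S0 by blast
  fix J assume "\<exists>T. antilinear_polar_decomposition (l2sum M) S0 J T"
  then obtain T where "antilinear_polar_decomposition (l2sum M) S0 J T" by blast
  then show "J = J0" by (rule polar_decomposition_unique(2))
qed

end

end

text \<open>The operators computed for \<open>circle_reflected\<close> are expressed in terms of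
  \<open>h\<close> and the representatives chosen by \<open>rep\<close>; the passage from
  \<open>g\<close> to \<open>h\<close> changes the multiplier only on null sets.\<close>

theorem theorem5p2:
  fixes \<alpha> :: real
    and \<mu> :: "complex measure"
    and h :: "int \<Rightarrow> complex \<Rightarrow> real"
    and A :: "'a cstar" and U V :: 'a
    and \<omega> :: "'a \<Rightarrow> complex"
    and \<pi> :: "'a \<Rightarrow> (int \<Rightarrow> (complex \<Rightarrow> complex) set) \<Rightarrow> (int \<Rightarrow> (complex \<Rightarrow> complex) set)"
  assumes "0 < \<alpha>" and "\<alpha> < 1 / 2" and "\<alpha> \<notin> \<rat>"
    and "prob_space \<mu>" and "sets \<mu> = sets circle_space"
    and "\<And>n. equivalent_measures (rot_measure \<alpha> \<mu> (- n)) (rot_measure \<alpha> \<mu> n)"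
    and "\<And>n. h n \<in> borel_measurable (rot_measure \<alpha> \<mu> n)"
    and "\<And>n. AE z in rot_measure \<alpha> \<mu> n. 0 \<le> h n z"
    and "\<And>n. density (rot_measure \<alpha> \<mu> n) (\<lambda>z. ennreal (h n z)) = rot_measure \<alpha> \<mu> (- n)"
    and "universal_rotation_algebra (2 * \<alpha>) A U V"
    and "cstar_state A \<omega>"
    and "\<And>f. finite {p. f p \<noteq> 0} \<Longrightarrow>
           \<omega> (weyl_sum \<alpha> A U V f) = (\<Sum>k | f (k, 0) \<noteq> 0. (\<integral>z. z powi k \<partial>\<mu>) * f (k, 0))"
    and "gns_representation A \<omega> (gns_space \<alpha> \<mu>) \<pi> (gns_vector \<alpha> \<mu>)"
    and "\<And>f g. finite {p. f p \<noteq> 0} \<Longrightarrow> g \<in> carrier (gns_space \<alpha> \<mu>) \<Longrightarrow>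
           \<pi> (weyl_sum \<alpha> A U V f) g = gns_action \<alpha> \<mu> f g"
  shows "Domain (modular_operator A (gns_space \<alpha> \<mu>) \<pi> (gns_vector \<alpha> \<mu>)) =
           {x \<in> carrier (gns_space \<alpha> \<mu>).
             (\<Sum>\<^sub>\<infinity>n. \<integral>\<^sup>+z. ennreal ((cmod (of_real (h n z) * rep (x n) z))\<^sup>2)
                \<partial>rot_measure \<alpha> \<mu> n) < \<infinity>} \<and>
         (\<forall>(x, y) \<in> modular_operator A (gns_space \<alpha> \<mu>) \<pi> (gns_vector \<alpha> \<mu>). \<forall>n.
           y n = L2_class (rot_measure \<alpha> \<mu> n) (\<lambda>z. of_real (h n z) * rep (x n) z)) \<and>
         (\<forall>x \<in> carrier (gns_space \<alpha> \<mu>). \<forall>y.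
           (x, y) \<in> modular_conjugation A (gns_space \<alpha> \<mu>) \<pi> (gns_vector \<alpha> \<mu>) \<longleftrightarrow>
           (\<forall>n. y n = L2_class (rot_measure \<alpha> \<mu> n)
                   (\<lambda>z. of_real (sqrt (h n z)) * cnj (rep (x (- n)) z))))"
proof -
  let ?M = "rot_measure \<alpha> \<mu>"
  note h_meas = assms(7) and h_density = assms(9)
  \<comment> \<open>A version of \<open>h\<close> that is positive everywhere; equivalence of the
    measures makes the set where it is altered a null set.\<close>
  define g where "g n z = (if 0 < h n z then h n z else 1)" for n z
  have "AE z in ?M n. 0 < h n z" for n
    using assms(6)[of n] by (intro AE_density_pos[OF h_meas h_density]) (simp add: equivalent_measures_def)
  then have gh: "AE z in ?M n. g n z = h n z" for n
    by (rule eventually_mono) (simp add: g_def)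
  have prob: "prob_space (?M n)" for n
    unfolding rot_measure_def
    by (rule prob_space.prob_space_distr[OF assms(4) rot_measurable_\<mu>[OF assms(5)]])
  have g_meas: "g n \<in> borel_measurable (?M n)" for n
    unfolding g_def using h_meas[of n] by measurable
  interpret circle_reflected ?M g
  proof (intro circle_reflected.intro reflected_measures.intro circle_reflected_axioms.intro)
    show "finite_measure (?M n)" for n
      by (rule prob_space.finite_measure[OF prob])
    show "g n \<in> borel_measurable (?M n)" for n by (rule g_meas)
    show "0 < g n z" for n z by (simp add: g_def)
    have "density (?M n) (\<lambda>z. ennreal (g n z)) = density (?M n) (\<lambda>z. ennreal (h n z))" for n
    proof (rule density_cong)
      show "AE z in ?M n. ennreal (g n z) = ennreal (h n z)"
        using gh[of n] by eventually_elim simp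
    qed (use g_meas[of n] h_meas[of n] in measurable)
    then show "density (?M n) (\<lambda>z. ennreal (g n z)) = ?M (- n)" for n
      using h_density by simp
    show "sets (?M n) = sets circle_space" for n by (simp add: rot_measure_def)
  qed
  have A: "unital_cstar_algebra A" and pair: "rotation_pair (2 * \<alpha>) A U V"
    and gen: "\<And>B. unital_cstar_subalgebra B A \<Longrightarrow> U \<in> B \<Longrightarrow> V \<in> B \<Longrightarrow> B = carrier A"
    using assms(10) unfolding universal_rotation_algebra_def by blast+
  interpret A: unital_cstar_algebra A by (rule A)
  have space: "gns_space \<alpha> \<mu> = l2sum ?M" by (simp add: gns_space_def l2sum_def)
  have gns: "gns_representation A \<omega> (l2sum ?M) \<pi> (gns_vector \<alpha> \<mu>)"
    using assms(13) by (simp add: space)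
  \<comment> \<open>The cyclic vector is the generating trigonometric family with both parameters
    0.\<close>
  have \<xi>: "(\<lambda>n z. if n = 0 then 1 else 0) \<in> l2fam ?M"
    using trig_fams_l2fam[OF trig_fams.powi[of 0 0]] unfolding power_int_0_right .
  have weyl_vec: "\<pi> (weyl \<alpha> A U V k l) (gns_vector \<alpha> \<mu>) = l2cls ?M (\<lambda>n z. if n = l then z powi k else 0)" for k l
  proof -
    \<comment> \<open>A Weyl sum with the single coefficient 1 is a Weyl element, so the prescribed
      action determines its vector.\<close>
    let ?f = "\<lambda>p. if p = (k, l) then 1 else 0 :: complex"
    have "{p. ?f p \<noteq> 0} = {(k, l)}" by auto
    then have fin: "finite {p. ?f p \<noteq> 0}" by simp
    have "gns_vector \<alpha> \<mu> \<in> carrier (gns_space \<alpha> \<mu>)"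
      using assms(13) by (simp add: gns_representation_def)
    from assms(14)[OF fin this] show ?thesis
      unfolding A.weyl_sum_single[OF pair] gns_action_single[OF assms(5) \<xi>] .
  qed
  have mod: "modular_operator A (l2sum ?M) \<pi> (gns_vector \<alpha> \<mu>) = mult_op ?M s O mult_op ?M s"
    by (rule modular_operator_eq[OF A pair _ assms(11) gns weyl_vec]) (erule (2) gen)
  have conj: "modular_conjugation A (l2sum ?M) \<pi> (gns_vector \<alpha> \<mu>) = J0"
    by (rule modular_conjugation_eq[OF A pair _ assms(11) gns weyl_vec]) (erule (2) gen)
  let ?h = "\<lambda>x n z. complex_of_real (h n z) * rep (x n) z"
  have s2: "(s n z)\<^sup>2 = g n z" for n z using g_pos[of n z] by (simp add: s_def)
  have ae: "AE z in ?M n. fmul (\<lambda>n z. (s n z)\<^sup>2) (l2rep x) n z = ?h x n z" for x n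
    using gh[of n] by eventually_elim (simp add: fmul_def s2 l2rep_def)
  have s2_meas: "(\<lambda>z. (s n z)\<^sup>2) \<in> borel_measurable (?M n)" for n
    unfolding s2 by (rule g_meas)
  let ?T = "mult_op ?M s"
  have Tl: "semilinear_op (l2sum ?M) id ?T" by (rule semilinear_mult_op[OF s_meas])
  \<comment> \<open>The square is defined at \<open>x\<close> exactly when s^2 x is square-summable,
    and s^2 = g agrees with \<open>h\<close> almost everywhere.\<close>
  have domain_iff: "x \<in> Domain (?T O ?T) \<longleftrightarrow>
      (\<Sum>\<^sub>\<infinity>n. \<integral>\<^sup>+z. ennreal ((cmod (?h x n z))\<^sup>2) \<partial>?M n) < \<infinity>"
    if x: "x \<in> carrier (l2sum ?M)" for x
  proof -
    note r = l2rep_carrier[OF x]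
    have "x \<in> Domain (?T O ?T) \<longleftrightarrow> fmul (\<lambda>n z. (s n z)\<^sup>2) (l2rep x) \<in> l2fam ?M"
    proof
      assume "x \<in> Domain (?T O ?T)"
      then obtain y where "(x, y) \<in> ?T O ?T" by (rule DomainE)
      then have "(l2cls ?M (l2rep x), y) \<in> ?T O ?T" unfolding r(2) .
      then show "fmul (\<lambda>n z. (s n z)\<^sup>2) (l2rep x) \<in> l2fam ?M"
        by (rule mult_op_squareD(1)[OF r(1)])
    next
      assume "fmul (\<lambda>n z. (s n z)\<^sup>2) (l2rep x) \<in> l2fam ?M"
      from mult_op_square[OF r(1) this] show "x \<in> Domain (?T O ?T)"
        unfolding r(2) by (rule DomainI)
    qed
    also have "\<dots> \<longleftrightarrow> sqsum ?M (fmul (\<lambda>n z. (s n z)\<^sup>2) (l2rep x)) < \<infinity>"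
      unfolding l2fam_def using fmul_measurable[where M = ?M, OF s2_meas r(1)] by simp
    also have "sqsum ?M (fmul (\<lambda>n z. (s n z)\<^sup>2) (l2rep x)) = sqsum ?M (?h x)"
      by (rule sqsum_cong_AE, rule ae)
    finally show ?thesis by (simp only: sqsum_def infsum_ennreal_eq_nn_integral)
  qed
  have dom: "Domain (?T O ?T) = {x \<in> carrier (l2sum ?M).
      (\<Sum>\<^sub>\<infinity>n. \<integral>\<^sup>+z. ennreal ((cmod (?h x n z))\<^sup>2) \<partial>?M n) < \<infinity>}"
  proof (intro equalityI subsetI CollectI conjI)
    fix x assume x: "x \<in> Domain (?T O ?T)"
    then obtain z where "(x, z) \<in> ?T O ?T" by (rule DomainE)
    then obtain y where "(x, y) \<in> ?T" by (rule relcompE) simp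
    then show xc: "x \<in> carrier (l2sum ?M)" by (rule semilinear_op_carrier(1)[OF Tl])
    show "(\<Sum>\<^sub>\<infinity>n. \<integral>\<^sup>+z. ennreal ((cmod (?h x n z))\<^sup>2) \<partial>?M n) < \<infinity>"
      using x unfolding domain_iff[OF xc] .
  next
    fix x assume "x \<in> {x \<in> carrier (l2sum ?M).
      (\<Sum>\<^sub>\<infinity>n. \<integral>\<^sup>+z. ennreal ((cmod (?h x n z))\<^sup>2) \<partial>?M n) < \<infinity>}"
    then have x: "x \<in> carrier (l2sum ?M)"
      and fin: "(\<Sum>\<^sub>\<infinity>n. \<integral>\<^sup>+z. ennreal ((cmod (?h x n z))\<^sup>2) \<partial>?M n) < \<infinity>"
      unfolding mem_Collect_eq by (rule conjunct1, rule conjunct2)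
    show "x \<in> Domain (?T O ?T)" using fin unfolding domain_iff[OF x] .
  qed
  have op: "\<forall>n. y n = L2_class (?M n) (?h x n)" if xy: "(x, y) \<in> ?T O ?T" for x y
  proof
    fix n
    obtain v where "(x, v) \<in> ?T" using xy by (rule relcompE) simp
    then have x: "x \<in> carrier (l2sum ?M)" by (rule semilinear_op_carrier(1)[OF Tl])
    note r = l2rep_carrier[OF x]
    have "(l2cls ?M (l2rep x), y) \<in> ?T O ?T" using xy unfolding r(2) .
    then have "y = l2cls ?M (fmul (\<lambda>n z. (s n z)\<^sup>2) (l2rep x))"
      by (rule mult_op_squareD(2)[OF r(1)])
    then show "y n = L2_class (?M n) (?h x n)"
      unfolding l2cls_def using L2_class_cong_AE[OF ae] by simp
  qed
  have cj: "(x, y) \<in> J0 \<longleftrightarrow>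
      (\<forall>n. y n = L2_class (?M n) (\<lambda>z. of_real (sqrt (h n z)) * cnj (rep (x (- n)) z)))"
    if x: "x \<in> carrier (l2sum ?M)" for x y
  proof -
    note r = l2rep_carrier[OF x]
    have "(x, y) \<in> J0 \<longleftrightarrow> y = l2cls ?M (fmul s (conj_refl (l2rep x)))"
      using J0_iff[OF r(1)] unfolding r(2) .
    also have "l2cls ?M (fmul s (conj_refl (l2rep x))) =
        l2cls ?M (\<lambda>n z. of_real (sqrt (h n z)) * cnj (rep (x (- n)) z))"
    proof (rule l2cls_cong_AE)
      fix n
      show "AE z in ?M n. fmul s (conj_refl (l2rep x)) n z = of_real (sqrt (h n z)) * cnj (rep (x (- n)) z)"
        using gh[of n] by eventually_elim (simp add: fmul_def s_def conj_refl_def l2rep_def)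
    qed
    finally show ?thesis by (simp add: l2cls_def fun_eq_iff)
  qed
  show ?thesis
    unfolding space mod conj
  proof (intro conjI ballI allI)
    fix p assume p: "p \<in> ?T O ?T"
    show "case p of (x, y) \<Rightarrow> \<forall>n. y n = L2_class (?M n) (?h x n)"
    proof (cases p)
      case (Pair x y)
      then show ?thesis using op[of x y] p by simp
    qed
  qed (rule dom, erule cj)
qed

end
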